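(* Let $\mathbf{K}$ be a Fraïssé structure with universe $\omega$ in a countable language $L$, let $\mathcal{K}$ be its Fraïssé class, and let $G=\mathrm{Aut}(\mathbf{K})$. Then, up to isomorphism of $G$-flows, the metrizable topologically transitive $G$-projective flows are exactly the flows of the form $X_{\mathcal{K}^*}$, where $\mathcal{K}^*$ is a reasonable precompact Fraïssé expansion of $\mathcal{K}$ (in a countable language $L^*\supseteq L$) with the Ramsey property.
   Context: A $G$-flow is a (nonempty) compact Hausdorff space with a continuous left action of $G$; a $G$-map is a continuous $G$-equivariant map. It is topologically transitive if for all nonempty open $U,V$ there is $g\in G$ with $gU\cap V\ne\emptyset$. A $G$-flow $X$ is $G$-projective if for all $G$-flows $Y,Z$, every $G$-map $\phi\colon X\to Y$ and every surjective $G$-map $\pi\colon Z\to Y$, there is a $G$-map $\psi\colon X\to Z$ with $\pi\circ\psi=\phi$. A Fraïssé structure is a countably infinite, locally finite, ultrahomogeneous structure; its Fraïssé class $\mathcal{K}$ is the class of finite structures embeddable in it. $\mathrm{Aut}(\mathbf{K})$ carries the topology of pointwise convergence. $\mathrm{Fin}(\mathbf{K})$ is the set of finite substructures of $\mathbf{K}$. Let $L^*\supseteq L$ be a countable language with $L^*\setminus L$ relational. A Fraïssé expansion of $\mathcal{K}$ is a Fraïssé class $\mathcal{K}^*$ of $L^*$-structures whose class of $L$-reducts is $\mathcal{K}$. It is precompact if each $A\in\mathcal{K}$ has only finitely many expansions in $\mathcal{K}^*$, and reasonable if for all $A,B\in\mathcal{K}$, every embedding $f\colon A\to B$ and every expansion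 $A^*\in\mathcal{K}^*$ of $A$, there is an expansion $B^*\in\mathcal{K}^*$ of $B$ such that $f\colon A^*\to B^*$ is an embedding. $\mathcal{K}^*$ has the Ramsey property if for all $A\leq B$ in $\mathcal{K}^*$ and every $r\ge1$ there is $C\in\mathcal{K}^*$ such that for every colouring of the embeddings $A\to C$ with $r$ colours there is an embedding $f\colon B\to C$ such that $\{f\circ e: e\colon A\to B \text{ an embedding}\}$ is monochromatic. $X_{\mathcal{K}^*}$ is the set of expansions $\langle\mathbf{K},\vec S\rangle$ of $\mathbf{K}$ to $L^*$-structures (where $\vec S$ interprets $L^*\setminus L$) such that $\langle A,\vec S|_A\rangle\in\mathcal{K}^*$ for all $A\in\mathrm{Fin}(\mathbf{K})$. Its topology has as basis the sets $\{\langle\mathbf{K},\vec S\rangle\in X_{\mathcal K^*}:\langle A,\vec S|_A\rangle=A^*\}$ with $A\in\mathrm{Fin}(\mathbf{K})$ and $A^*\in\mathcal{K}^*$ an expansion of $A$. $G$ acts by the logic action: for $R\in L^*\setminus L$ of arity $n$, $(a_1,\dots,a_n)\in R^{g\mathbf{K}'}$ iff $(g^{-1}a_1,\dots,g^{-1}a_n)\in R^{\mathbf{K}'}$. *)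

theory Defs
  imports "HOL-Analysis.Analysis" "HOL-Algebra.Group_Action" "HOL-Library.Equipollence"
begin

section \<open>Flows\<close>

text \<open>
  The group is an algebraic group \<open>G\<close> together with a topology \<open>T\<close> on its carrier. The action is
  given in the form used by the locale \<^locale>\<open>group_action\<close>, i.e.\ every \<open>a g\<close> is an extensional
  bijection of the space.
\<close>

definition G_flow ::
    "('g, 'm) monoid_scheme \<Rightarrow> 'g topology \<Rightarrow> 'x topology \<Rightarrow> ('g \<Rightarrow> 'x \<Rightarrow> 'x) \<Rightarrow> bool" where
  "G_flow G T X a \<longleftrightarrow>
     topspace X \<noteq> {} \<and> compact_space X \<and> Hausdorff_space X \<and>
     group_action G (topspace X) a \<and>
     continuous_map (prod_topology T X) X (\<lambda>(g, x). a g x)"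

definition G_map ::
    "('g, 'm) monoid_scheme \<Rightarrow> 'x topology \<Rightarrow> ('g \<Rightarrow> 'x \<Rightarrow> 'x) \<Rightarrow>
     'y topology \<Rightarrow> ('g \<Rightarrow> 'y \<Rightarrow> 'y) \<Rightarrow> ('x \<Rightarrow> 'y) \<Rightarrow> bool" where
  "G_map G X a Y b f \<longleftrightarrow>
     continuous_map X Y f \<and> (\<forall>g\<in>carrier G. \<forall>x\<in>topspace X. f (a g x) = b g (f x))"

definition G_flow_isomorphic ::
    "('g, 'm) monoid_scheme \<Rightarrow> 'x topology \<Rightarrow> ('g \<Rightarrow> 'x \<Rightarrow> 'x) \<Rightarrow>
     'y topology \<Rightarrow> ('g \<Rightarrow> 'y \<Rightarrow> 'y) \<Rightarrow> bool" where
  "G_flow_isomorphic G X a Y b \<longleftrightarrow> (\<exists>h. homeomorphic_map X Y h \<and> G_map G X a Y b h)"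

definition topologically_transitive ::
    "('g, 'm) monoid_scheme \<Rightarrow> 'x topology \<Rightarrow> ('g \<Rightarrow> 'x \<Rightarrow> 'x) \<Rightarrow> bool" where
  "topologically_transitive G X a \<longleftrightarrow>
     (\<forall>U V. openin X U \<and> openin X V \<and> U \<noteq> {} \<and> V \<noteq> {} \<longrightarrow>
        (\<exists>g\<in>carrier G. a g ` U \<inter> V \<noteq> {}))"

text \<open>
  Since HOL cannot quantify over types inside a formula, the flows \<open>Y\<close> and \<open>Z\<close> range over all flows
  whose points lie in a type \<open>'u\<close>, which is passed as a parameter. If \<open>G\<close> is separable and \<open>X\<close> is
  metrizable, this is projectivity with respect to all flows as soon as \<open>'u\<close> has at least
  \<open>2^(2^aleph_0)\<close> elements: it suffices to split the projection onto \<open>X\<close> of the pullback of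
  \<open>\<phi>\<close> and \<open>\<pi>\<close>, and this pullback may be replaced by the closure of the union of the orbits of
  countably many of its points that lie over a dense subset of \<open>X\<close>. This closure is a flow that
  still maps onto \<open>X\<close>, and as a separable Hausdorff space it has at most \<open>2^(2^aleph_0)\<close> points.
\<close>

definition G_projective ::
    "'u itself \<Rightarrow> ('g, 'm) monoid_scheme \<Rightarrow> 'g topology \<Rightarrow> 'x topology \<Rightarrow> ('g \<Rightarrow> 'x \<Rightarrow> 'x) \<Rightarrow> bool"
  where
  "G_projective (_ :: 'u itself) G T X a \<longleftrightarrow>
     (\<forall>(Y :: 'u topology) b (Z :: 'u topology) c \<phi> \<pi>.
        G_flow G T Y b \<and> G_flow G T Z c \<and> G_map G X a Y b \<phi> \<and> G_map G Z c Y b \<pi> \<and>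
        \<pi> ` topspace Z = topspace Y \<longrightarrow>
        (\<exists>\<psi>. G_map G X a Z c \<psi> \<and> (\<forall>x\<in>topspace X. \<pi> (\<psi> x) = \<phi> x)))"


section \<open>First-order structures\<close>

record ('f, 'r) lang =
  funs :: "'f set"
  rels :: "'r set"
  fun_arity :: "'f \<Rightarrow> nat"
  rel_arity :: "'r \<Rightarrow> nat"

record ('f, 'r, 'a) struc =
  univ :: "'a set"
  fun_interp :: "'f \<Rightarrow> 'a list \<Rightarrow> 'a"
  rel_interp :: "'r \<Rightarrow> 'a list set"

definition countable_lang :: "('f, 'r) lang \<Rightarrow> bool" where
  "countable_lang L \<longleftrightarrow> countable (funs L) \<and> countable (rels L)"

definition tuples :: "'a set \<Rightarrow> nat \<Rightarrow> 'a list set" where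
  "tuples A n = {xs. length xs = n \<and> set xs \<subseteq> A}"

definition closed_in :: "('f, 'r) lang \<Rightarrow> ('f, 'r, 'a) struc \<Rightarrow> 'a set \<Rightarrow> bool" where
  "closed_in L M A \<longleftrightarrow>
     A \<subseteq> univ M \<and> (\<forall>F\<in>funs L. \<forall>xs\<in>tuples A (fun_arity L F). fun_interp M F xs \<in> A)"

text \<open>
  Interpretations carry no junk outside the language and the universe, so that equality of records
  is equality of structures.
\<close>

definition lang_structure :: "('f, 'r) lang \<Rightarrow> ('f, 'r, 'a) struc \<Rightarrow> bool" where
  "lang_structure L M \<longleftrightarrow>
     univ M \<noteq> {} \<and> closed_in L M (univ M) \<and>
     (\<forall>F xs. \<not> (F \<in> funs L \<and> xs \<in> tuples (univ M) (fun_arity L F)) \<longrightarrow>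
        fun_interp M F xs = undefined) \<and>
     (\<forall>R. rel_interp M R \<subseteq> (if R \<in> rels L then tuples (univ M) (rel_arity L R) else {}))"

definition induced :: "('f, 'r, 'a) struc \<Rightarrow> 'a set \<Rightarrow> ('f, 'r, 'a) struc" where
  "induced M A =
     \<lparr>univ = A,
      fun_interp = (\<lambda>F xs. if set xs \<subseteq> A then fun_interp M F xs else undefined),
      rel_interp = (\<lambda>R. {xs \<in> rel_interp M R. set xs \<subseteq> A})\<rparr>"

definition Fin :: "('f, 'r) lang \<Rightarrow> ('f, 'r, 'a) struc \<Rightarrow> ('f, 'r, 'a) struc set" where
  "Fin L M = {induced M A | A. finite A \<and> A \<noteq> {} \<and> closed_in L M A}"

text \<open>
  Embeddings are extensional functions, so that two embeddings are equal if and only if they agree on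
  the domain; the colourings in the Ramsey property depend on this.
\<close>

definition embeddings ::
    "('f, 'r) lang \<Rightarrow> ('f, 'r, 'a) struc \<Rightarrow> ('f, 'r, 'b) struc \<Rightarrow> ('a \<Rightarrow> 'b) set" where
  "embeddings L A B =
     {f \<in> univ A \<rightarrow>\<^sub>E univ B. inj_on f (univ A) \<and>
        (\<forall>F\<in>funs L. \<forall>xs\<in>tuples (univ A) (fun_arity L F).
           f (fun_interp A F xs) = fun_interp B F (map f xs)) \<and>
        (\<forall>R\<in>rels L. \<forall>xs\<in>tuples (univ A) (rel_arity L R).
           xs \<in> rel_interp A R \<longleftrightarrow> map f xs \<in> rel_interp B R)}"

definition isomorphisms ::
    "('f, 'r) lang \<Rightarrow> ('f, 'r, 'a) struc \<Rightarrow> ('f, 'r, 'b) struc \<Rightarrow> ('a \<Rightarrow> 'b) set" where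
  "isomorphisms L A B = {f \<in> embeddings L A B. f ` univ A = univ B}"

definition locally_finite :: "('f, 'r) lang \<Rightarrow> ('f, 'r, 'a) struc \<Rightarrow> bool" where
  "locally_finite L M \<longleftrightarrow>
     (\<forall>S. finite S \<and> S \<subseteq> univ M \<longrightarrow> finite ((closed_in L M) hull S))"

definition ultrahomogeneous :: "('f, 'r) lang \<Rightarrow> ('f, 'r, 'a) struc \<Rightarrow> bool" where
  "ultrahomogeneous L M \<longleftrightarrow>
     (\<forall>A\<in>Fin L M. \<forall>B\<in>Fin L M. \<forall>f\<in>isomorphisms L A B.
        \<exists>g\<in>isomorphisms L M M. \<forall>x\<in>univ A. g x = f x)"

definition fraisse_structure :: "('f, 'r) lang \<Rightarrow> ('f, 'r, 'a) struc \<Rightarrow> bool" where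
  "fraisse_structure L M \<longleftrightarrow>
     lang_structure L M \<and> countable (univ M) \<and> infinite (univ M) \<and>
     locally_finite L M \<and> ultrahomogeneous L M"


section \<open>Fraisse classes and expansions\<close>

text \<open>
  A class of finite structures is represented by the set of its members whose universe is a (finite)
  set of natural numbers. Every finite structure is isomorphic to such a structure, and every
  countably infinite structure is isomorphic to one with universe in \<^typ>\<open>nat\<close>.
\<close>

definition age :: "('f, 'r) lang \<Rightarrow> ('f, 'r, 'a) struc \<Rightarrow> ('f, 'r, nat) struc set" where
  "age L M = {A. lang_structure L A \<and> finite (univ A) \<and> embeddings L A M \<noteq> {}}"

definition fraisse_class :: "('f, 'r) lang \<Rightarrow> ('f, 'r, nat) struc set \<Rightarrow> bool" where
  "fraisse_class L \<K> \<longleftrightarrow> (\<exists>M :: ('f, 'r, nat) struc. fraisse_structure L M \<and> \<K> = age L M)"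

text \<open>
  In an extension \<open>L'\<close> of a language \<open>L\<close>, the relation symbols of \<open>L\<close> are tagged by \<^const>\<open>Inl\<close> and
  the new ones by \<^const>\<open>Inr\<close>.
\<close>

definition relational_extension :: "('f, 'r) lang \<Rightarrow> ('f, 'r + 's) lang \<Rightarrow> bool" where
  "relational_extension L L' \<longleftrightarrow>
     funs L' = funs L \<and> (\<forall>F\<in>funs L. fun_arity L' F = fun_arity L F) \<and>
     {R. Inl R \<in> rels L'} = rels L \<and> (\<forall>R\<in>rels L. rel_arity L' (Inl R) = rel_arity L R)"

definition reduct :: "('f, 'r + 's, 'a) struc \<Rightarrow> ('f, 'r, 'a) struc" where
  "reduct M = \<lparr>univ = univ M, fun_interp = fun_interp M, rel_interp = (\<lambda>R. rel_interp M (Inl R))\<rparr>"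

definition fraisse_expansion ::
    "('f, 'r) lang \<Rightarrow> ('f, 'r, nat) struc set \<Rightarrow>
     ('f, 'r + 's) lang \<Rightarrow> ('f, 'r + 's, nat) struc set \<Rightarrow> bool" where
  "fraisse_expansion L \<K> L' \<K>' \<longleftrightarrow>
     countable_lang L' \<and> relational_extension L L' \<and> fraisse_class L' \<K>' \<and> reduct ` \<K>' = \<K>"

definition precompact_expansion ::
    "('f, 'r, nat) struc set \<Rightarrow> ('f, 'r + 's, nat) struc set \<Rightarrow> bool" where
  "precompact_expansion \<K> \<K>' \<longleftrightarrow> (\<forall>A\<in>\<K>. finite {A' \<in> \<K>'. reduct A' = A})"

definition reasonable_expansion ::
    "('f, 'r) lang \<Rightarrow> ('f, 'r, nat) struc set \<Rightarrow>
     ('f, 'r + 's) lang \<Rightarrow> ('f, 'r + 's, nat) struc set \<Rightarrow> bool" where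
  "reasonable_expansion L \<K> L' \<K>' \<longleftrightarrow>
     (\<forall>A\<in>\<K>. \<forall>B\<in>\<K>. \<forall>f\<in>embeddings L A B. \<forall>A'\<in>\<K>'. reduct A' = A \<longrightarrow>
        (\<exists>B'\<in>\<K>'. reduct B' = B \<and> f \<in> embeddings L' A' B'))"

definition ramsey_property :: "('f, 'r) lang \<Rightarrow> ('f, 'r, nat) struc set \<Rightarrow> bool" where
  "ramsey_property L \<K> \<longleftrightarrow>
     (\<forall>A\<in>\<K>. \<forall>B\<in>\<K>. embeddings L A B \<noteq> {} \<longrightarrow>
        (\<forall>r::nat. r \<ge> 1 \<longrightarrow>
           (\<exists>C\<in>\<K>. \<forall>col \<in> embeddings L A C \<rightarrow> {..<r}.
              \<exists>f\<in>embeddings L B C. \<exists>k. \<forall>e\<in>embeddings L A B. col (compose (univ A) f e) = k)))"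


section \<open>The automorphism group and the space of expansions\<close>

definition aut_group :: "('f, 'r) lang \<Rightarrow> ('f, 'r, 'a) struc \<Rightarrow> ('a \<Rightarrow> 'a) monoid" where
  "aut_group L M = (BijGroup (univ M)) \<lparr>carrier := isomorphisms L M M\<rparr>"

definition aut_topology :: "('f, 'r) lang \<Rightarrow> ('f, 'r, 'a) struc \<Rightarrow> ('a \<Rightarrow> 'a) topology" where
  "aut_topology L M =
     subtopology (product_topology (\<lambda>_. discrete_topology (univ M)) (univ M)) (isomorphisms L M M)"

text \<open>
  Below, \<open>M\<close> is the structure whose expansions are considered, \<open>L\<close> its language, and \<open>\<K>'\<close> a class of
  finite structures in the extended language \<open>L'\<close>.
\<close>

definition expansions ::
    "('f, 'r) lang \<Rightarrow> ('f, 'r, nat) struc \<Rightarrow> ('f, 'r + 's) lang \<Rightarrow>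
     ('f, 'r + 's, nat) struc set \<Rightarrow> ('f, 'r + 's, nat) struc set" where
  "expansions L M L' \<K>' =
     {N. lang_structure L' N \<and> reduct N = M \<and> (\<forall>A\<in>Fin L M. induced N (univ A) \<in> \<K>')}"

definition expansions_topology ::
    "('f, 'r) lang \<Rightarrow> ('f, 'r, nat) struc \<Rightarrow> ('f, 'r + 's) lang \<Rightarrow>
     ('f, 'r + 's, nat) struc set \<Rightarrow> ('f, 'r + 's, nat) struc topology" where
  "expansions_topology L M L' \<K>' =
     topology_generated_by
       {{N \<in> expansions L M L' \<K>'. induced N (univ A) = A'} | A A'.
          A \<in> Fin L M \<and> A' \<in> \<K>' \<and> reduct A' = A}"

definition logic_action ::
    "('f, 'r) lang \<Rightarrow> ('f, 'r, nat) struc \<Rightarrow> ('f, 'r + 's) lang \<Rightarrow>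
     ('f, 'r + 's, nat) struc set \<Rightarrow>
     (nat \<Rightarrow> nat) \<Rightarrow> ('f, 'r + 's, nat) struc \<Rightarrow> ('f, 'r + 's, nat) struc" where
  "logic_action L M L' \<K>' g =
     (\<lambda>N \<in> expansions L M L' \<K>'.
        N \<lparr>rel_interp :=
             case_sum
               (\<lambda>R. rel_interp N (Inl R))
               (\<lambda>R. {xs \<in> tuples (univ M) (rel_arity L' (Inr R)).
                       map (inv_into (univ M) g) xs \<in> rel_interp N (Inr R)})\<rparr>)"

end

theory Submission
  imports Defs
begin

text \<open>
  Throughout, a finite set \<open>A\<close> of natural numbers has the pointwise stabilizer \<open>stab A\<close> in \<open>G\<close>; these
  are a basis of neighbourhoods of the identity.

  \<^emph>\<open>From Ramsey expansions to projective flows.\<close> By back-and-forth, the reduct of the Fraisse limit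
  of the expanded class is isomorphic to \<open>K\<close>, so the flow of expansions has a generic point: an
  expansion \<open>N\<close> of \<open>K\<close> that is homogeneous in the expanded language and has a dense orbit
  (\<open>generic_expansion_exists\<close>, \<open>orbit_dense\<close>). The Ramsey property of the class becomes a property of
  colourings of the stabilizer \<open>H\<close> of \<open>N\<close> (\<open>oscillation_stable\<close>), which makes \<open>H\<close> fix a point
  in every nonempty closed \<open>H\<close>-invariant subset of a flow
  (\<open>fixed_point_if_oscillation_stable\<close>). To lift a map \<open>\<phi>\<close> into \<open>Y\<close> along a surjection \<open>\<pi>\<close> from \<open>Z\<close>, take a point \<open>z\<close> over \<open>\<phi> N\<close> fixed by \<open>H\<close>. Two
  translates of \<open>N\<close> that agree on a finite set differ by \<open>H\<close> and a small stabilizer, by homogeneity.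
  Hence the closure of the orbit of \<open>(N, z)\<close> is the graph of a function, and this is the lift
  (\<open>projective_if_oscillation_stable\<close>).

  \<^emph>\<open>From projective flows to Ramsey expansions.\<close> A closed invariant relation between points of \<open>X\<close>
  and finite colourings of the cosets of \<open>stab A\<close> is a flow over \<open>X\<close>. If it is total, projectivity
  yields a continuous equivariant choice of colourings (\<open>equivariant_selection\<close>); this is used
  twice. First, it shows that an open set invariant under \<open>stab A\<close> has an open closure
  (\<open>closure_open\<close>). With metrizability it follows that the clopen sets invariant under \<open>stab A\<close> are
  the unions of finitely many atoms, the cells of \<open>A\<close> (\<open>cell_clopen\<close>, \<open>finite_cells\<close>). Cells
  separate points, and they take the role of the expansions of \<open>A\<close>: turning all invariant clopen
  sets into relations gives an expansion \<open>KX x\<close> of \<open>K\<close> for each point \<open>x\<close>, whose restriction to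
  \<open>A\<close> and the cell of \<open>x\<close> determine each other (\<open>agree_if_cell_eq\<close>, \<open>cell_eq_if_agree\<close>). At a
  point \<open>x0\<close> that is generic in the sense of Baire category, \<open>KX x0\<close> is a Fraisse structure
  (\<open>N_fraisse\<close>); its age is the required class, and \<open>KX\<close> is an isomorphism of flows
  (\<open>flow_isomorphism\<close>). Second, a failure of the Ramsey property of this class would give every point
  a colouring of the copies of some \<open>A\<close> without monochromatic copy of some \<open>B\<close>; but a continuous
  equivariant choice is constant on the copies of \<open>A\<close> in \<open>KX x0\<close> (\<open>ramsey\<close>).
\<close>

section \<open>Flows of permutation groups\<close>

lemma openinI:
  assumes "\<And>x. x \<in> S \<Longrightarrow> \<exists>V. openin X V \<and> x \<in> V \<and> V \<subseteq> S"
  shows "openin X S"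
  using assms by (subst openin_subopen) blast

lemma openin_product_discrete:
  "openin (product_topology (\<lambda>i. discrete_topology (D i)) I) S \<longleftrightarrow>
     S \<subseteq> Pi\<^sub>E I D \<and>
     (\<forall>f\<in>S. \<exists>J. finite J \<and> J \<subseteq> I \<and> (\<forall>h\<in>Pi\<^sub>E I D. (\<forall>i\<in>J. h i = f i) \<longrightarrow> h \<in> S))"
proof
  assume S: "openin (product_topology (\<lambda>i. discrete_topology (D i)) I) S"
  show "S \<subseteq> Pi\<^sub>E I D \<and>
     (\<forall>f\<in>S. \<exists>J. finite J \<and> J \<subseteq> I \<and> (\<forall>h\<in>Pi\<^sub>E I D. (\<forall>i\<in>J. h i = f i) \<longrightarrow> h \<in> S))"
  proof (intro conjI ballI)
    show sub: "S \<subseteq> Pi\<^sub>E I D" using openin_subset[OF S] by simp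
    fix f assume f: "f \<in> S"
    obtain U where U: "finite {i \<in> I. U i \<noteq> D i}" "f \<in> Pi\<^sub>E I U" "Pi\<^sub>E I U \<subseteq> S"
      using S f unfolding openin_product_topology_alt by force
    show "\<exists>J. finite J \<and> J \<subseteq> I \<and> (\<forall>h\<in>Pi\<^sub>E I D. (\<forall>i\<in>J. h i = f i) \<longrightarrow> h \<in> S)"
    proof (intro exI conjI ballI impI)
      show "finite {i \<in> I. U i \<noteq> D i}" "{i \<in> I. U i \<noteq> D i} \<subseteq> I" using U by auto
      fix h assume h: "h \<in> Pi\<^sub>E I D" "\<forall>i\<in>{i \<in> I. U i \<noteq> D i}. h i = f i"
      have "h \<in> Pi\<^sub>E I U"
      proof (rule PiE_I)
        fix i assume i: "i \<in> I"
        show "h i \<in> U i"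
        proof (cases "U i = D i")
          case True
          then show ?thesis using h i by auto
        next
          case False
          then have "h i = f i" using h(2) i by blast
          then show ?thesis using U(2) i by auto
        qed
      qed (use h in auto)
      then show "h \<in> S" using U(3) by blast
    qed
  qed
next
  assume R: "S \<subseteq> Pi\<^sub>E I D \<and>
     (\<forall>f\<in>S. \<exists>J. finite J \<and> J \<subseteq> I \<and> (\<forall>h\<in>Pi\<^sub>E I D. (\<forall>i\<in>J. h i = f i) \<longrightarrow> h \<in> S))"
  show "openin (product_topology (\<lambda>i. discrete_topology (D i)) I) S"
    unfolding openin_product_topology_alt
  proof (intro ballI)
    fix f assume f: "f \<in> S"
    then obtain J where J: "finite J" "J \<subseteq> I"
      "\<forall>h\<in>Pi\<^sub>E I D. (\<forall>i\<in>J. h i = f i) \<longrightarrow> h \<in> S" using R by blast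
    have fP: "f \<in> Pi\<^sub>E I D" using f R by blast
    let ?U = "\<lambda>i. if i \<in> J then {f i} else D i"
    have "{i \<in> I. ?U i \<noteq> topspace (discrete_topology (D i))} \<subseteq> J" by auto
    then have "finite {i \<in> I. ?U i \<noteq> topspace (discrete_topology (D i))}"
      using J(1) finite_subset by blast
    moreover have "\<forall>i\<in>I. openin (discrete_topology (D i)) (?U i)" using fP by auto
    moreover have "f \<in> Pi\<^sub>E I ?U" using fP by auto
    moreover have "Pi\<^sub>E I ?U \<subseteq> S"
    proof
      fix h assume h: "h \<in> Pi\<^sub>E I ?U"
      show "h \<in> S"
      proof (rule J(3)[rule_format])
        have "?U i \<subseteq> D i" if "i \<in> I" for i using that fP by auto
        then show "h \<in> Pi\<^sub>E I D" using h PiE_mono by blast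
        show "h i = f i" if "i \<in> J" for i using h that J(2) by (auto simp: PiE_iff split: if_splits)
      qed
    qed
    ultimately show "\<exists>U. finite {i \<in> I. U i \<noteq> topspace (discrete_topology (D i))} \<and>
        (\<forall>i\<in>I. openin (discrete_topology (D i)) (U i)) \<and> f \<in> Pi\<^sub>E I U \<and> Pi\<^sub>E I U \<subseteq> S"
      by (intro exI[of _ ?U] conjI)
  qed
qed

text \<open>In the presence of groups as records, \<open>inv\<close> denotes the inverse in an implicit structure.\<close>

abbreviation pinv :: "('a \<Rightarrow> 'b) \<Rightarrow> 'b \<Rightarrow> 'a" where
  "pinv f \<equiv> inv_into UNIV f"

locale perm_group =
  fixes G :: "(nat \<Rightarrow> nat) monoid" and T :: "(nat \<Rightarrow> nat) topology"
  assumes group: "group G"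
    and bij: "g \<in> carrier G \<Longrightarrow> bij g"
    and mult: "g \<in> carrier G \<Longrightarrow> h \<in> carrier G \<Longrightarrow> g \<otimes>\<^bsub>G\<^esub> h = g \<circ> h"
    and T: "T = subtopology (product_topology (\<lambda>_. discrete_topology UNIV) UNIV) (carrier G)"
begin

lemma one: "\<one>\<^bsub>G\<^esub> = id"
proof -
  have c: "\<one>\<^bsub>G\<^esub> \<in> carrier G" using group by (simp add: group.is_monoid)
  have "\<one>\<^bsub>G\<^esub> \<circ> \<one>\<^bsub>G\<^esub> = \<one>\<^bsub>G\<^esub>" using mult[OF c c] group by (simp add: group.is_monoid)
  then have "\<one>\<^bsub>G\<^esub> (\<one>\<^bsub>G\<^esub> x) = \<one>\<^bsub>G\<^esub> x" for x by (simp add: fun_eq_iff)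
  then show ?thesis using bij[OF c] by (auto simp: bij_def inj_eq)
qed

lemma id_in [simp]: "id \<in> carrier G"
  using monoid.one_closed[OF group.is_monoid[OF group]] one by simp

lemma comp_in [simp]: "g \<in> carrier G \<Longrightarrow> h \<in> carrier G \<Longrightarrow> g \<circ> h \<in> carrier G"
  using monoid.m_closed[OF group.is_monoid[OF group], of g h] mult by simp

lemma inv_in [simp]: "g \<in> carrier G \<Longrightarrow> pinv g \<in> carrier G"
proof -
  assume g: "g \<in> carrier G"
  have i: "inv\<^bsub>G\<^esub> g \<in> carrier G" using g group by simp
  have "g \<circ> inv\<^bsub>G\<^esub> g = id" using group.r_inv[OF group g] mult[OF g i] one by simp
  then have "g ((inv\<^bsub>G\<^esub> g) x) = x" for x by (simp add: fun_eq_iff)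
  then have "(inv\<^bsub>G\<^esub> g) x = pinv g x" for x
    by (metis bij[OF g] bij_inv_eq_iff)
  then have "inv\<^bsub>G\<^esub> g = pinv g" by auto
  then show ?thesis using i by simp
qed

lemma inv_l [simp]: "g \<in> carrier G \<Longrightarrow> pinv g (g x) = x"
  using bij[of g] by (simp add: bij_def)

lemma inv_r [simp]: "g \<in> carrier G \<Longrightarrow> g (pinv g x) = x"
  using bij[of g] by (simp add: bij_def surj_f_inv_f)

lemma inv_inv [simp]: "g \<in> carrier G \<Longrightarrow> pinv (pinv g) = g"
  using bij[of g] by (simp add: inv_inv_eq)

lemma inv_comp_l [simp]: "g \<in> carrier G \<Longrightarrow> pinv g \<circ> g = id"
  and inv_comp_r [simp]: "g \<in> carrier G \<Longrightarrow> g \<circ> pinv g = id"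
  by auto

lemma inv_comp [simp]: "g \<in> carrier G \<Longrightarrow> h \<in> carrier G \<Longrightarrow> pinv (g \<circ> h) = pinv h \<circ> pinv g"
  using bij[of g] bij[of h] by (simp add: o_inv_distrib)

lemma eq_iff [simp]: "g \<in> carrier G \<Longrightarrow> g x = g y \<longleftrightarrow> x = y"
  using bij[of g] by (simp add: bij_def inj_eq)

definition stab :: "nat set \<Rightarrow> (nat \<Rightarrow> nat) set" where
  "stab A = {g \<in> carrier G. \<forall>x\<in>A. g x = x}"

lemma stabD: "g \<in> stab A \<Longrightarrow> g \<in> carrier G" "g \<in> stab A \<Longrightarrow> x \<in> A \<Longrightarrow> g x = x"
  by (auto simp: stab_def)

lemma id_stab [simp]: "id \<in> stab A" by (simp add: stab_def)

lemma inv_stab: "g \<in> stab A \<Longrightarrow> pinv g \<in> stab A"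
proof -
  assume g: "g \<in> stab A"
  then have "pinv g x = x" if "x \<in> A" for x
    using inv_l[of g x] that by (simp add: stab_def)
  with g show "pinv g \<in> stab A" by (simp add: stab_def)
qed

lemma comp_stab: "g \<in> stab A \<Longrightarrow> h \<in> stab A \<Longrightarrow> g \<circ> h \<in> stab A"
  by (auto simp: stab_def)

lemma stab_mono: "A \<subseteq> B \<Longrightarrow> stab B \<subseteq> stab A"
  by (auto simp: stab_def)

lemma conj_stab:
  assumes "g \<in> carrier G" "h \<in> stab (g ` A)" shows "pinv g \<circ> h \<circ> g \<in> stab A"
  using assms by (auto simp: stab_def)

lemma openin_T:
  "openin T U \<longleftrightarrow> U \<subseteq> carrier G \<and>
     (\<forall>g\<in>U. \<exists>A. finite A \<and> (\<forall>h\<in>carrier G. (\<forall>x\<in>A. h x = g x) \<longrightarrow> h \<in> U))"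
proof
  assume "openin T U"
  then obtain S where S: "openin (product_topology (\<lambda>_. discrete_topology UNIV) UNIV) S" "U = S \<inter> carrier G"
    unfolding T openin_subtopology by blast
  then show "U \<subseteq> carrier G \<and>
     (\<forall>g\<in>U. \<exists>A. finite A \<and> (\<forall>h\<in>carrier G. (\<forall>x\<in>A. h x = g x) \<longrightarrow> h \<in> U))"
    unfolding openin_product_discrete by (force simp: PiE_UNIV_domain)
next
  assume U: "U \<subseteq> carrier G \<and>
     (\<forall>g\<in>U. \<exists>A. finite A \<and> (\<forall>h\<in>carrier G. (\<forall>x\<in>A. h x = g x) \<longrightarrow> h \<in> U))"
  let ?S = "{f. \<exists>g\<in>U. \<exists>A. finite A \<and> (\<forall>h\<in>carrier G. (\<forall>x\<in>A. h x = g x) \<longrightarrow> h \<in> U) \<and> (\<forall>x\<in>A. f x = g x)}"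
  have "openin (product_topology (\<lambda>_. discrete_topology UNIV) UNIV) ?S"
    unfolding openin_product_discrete
  proof (intro conjI ballI)
    fix f assume "f \<in> ?S"
    then obtain g A where "g\<in>U" "finite A" "\<forall>h\<in>carrier G. (\<forall>x\<in>A. h x = g x) \<longrightarrow> h \<in> U" "\<forall>x\<in>A. f x = g x"
      by blast
    then show "\<exists>J. finite J \<and> J \<subseteq> UNIV \<and> (\<forall>h\<in>UNIV \<rightarrow>\<^sub>E UNIV. (\<forall>i\<in>J. h i = f i) \<longrightarrow> h \<in> ?S)"
      by (intro exI[of _ A]) auto
  qed auto
  moreover have "U \<subseteq> ?S"
  proof
    fix g assume g: "g \<in> U"
    then obtain A where "finite A" "\<forall>h\<in>carrier G. (\<forall>x\<in>A. h x = g x) \<longrightarrow> h \<in> U" using U by blast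
    then show "g \<in> ?S" using g by blast
  qed
  then have "U = ?S \<inter> carrier G" using U by auto
  ultimately show "openin T U" unfolding T openin_subtopology by blast
qed

lemma topspace_T [simp]: "topspace T = carrier G"
  unfolding T by (simp add: PiE_UNIV_domain)

lemma openin_T_agree_inv: "openin T {h \<in> carrier G. \<forall>x\<in>A. pinv h x = pinv g x}" if "finite A" "g \<in> carrier G"
  unfolding openin_T
proof (intro conjI ballI)
  fix k assume k: "k \<in> {h \<in> carrier G. \<forall>x\<in>A. pinv h x = pinv g x}"
  show "\<exists>B. finite B \<and> (\<forall>h\<in>carrier G. (\<forall>x\<in>B. h x = k x) \<longrightarrow> h \<in> {h \<in> carrier G. \<forall>x\<in>A. pinv h x = pinv g x})"
  proof (intro exI[of _ "pinv g ` A"] conjI ballI impI)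
    fix h assume h: "h \<in> carrier G" "\<forall>x\<in>pinv g ` A. h x = k x"
    have "pinv h x = pinv g x" if "x \<in> A" for x
    proof -
      have "h (pinv g x) = k (pinv g x)" using h that by blast
      also have "\<dots> = k (pinv k x)" using k that by simp
      also have "\<dots> = x" using k by simp
      finally have "pinv h (h (pinv g x)) = pinv h x" by simp
      then show ?thesis using h(1) by simp
    qed
    then show "h \<in> {h \<in> carrier G. \<forall>x\<in>A. pinv h x = pinv g x}" using h by simp
  qed (use that in auto)
qed auto

lemma G_flowI:
  assumes "topspace X \<noteq> {}" "compact_space X" "Hausdorff_space X"
    and ext: "\<And>g. g \<in> carrier G \<Longrightarrow> a g \<in> extensional (topspace X)"
    and into: "\<And>g x. g \<in> carrier G \<Longrightarrow> x \<in> topspace X \<Longrightarrow> a g x \<in> topspace X"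
    and id: "\<And>x. x \<in> topspace X \<Longrightarrow> a id x = x"
    and comp: "\<And>g h x. g \<in> carrier G \<Longrightarrow> h \<in> carrier G \<Longrightarrow> x \<in> topspace X \<Longrightarrow> a (g \<circ> h) x = a g (a h x)"
    and cont: "continuous_map (prod_topology T X) X (\<lambda>(g, x). a g x)"
  shows "G_flow G T X a"
proof -
  have bij_a: "a g \<in> Bij (topspace X)" if g: "g \<in> carrier G" for g
  proof -
    have 1: "a (pinv g) (a g x) = x" if "x \<in> topspace X" for x
      using comp[of "pinv g" g x] g that id by simp
    have 2: "a g (a (pinv g) x) = x" if "x \<in> topspace X" for x
      using comp[of g "pinv g" x] g that id by simp
    have "bij_betw (a g) (topspace X) (topspace X)"
      by (rule bij_betw_byWitness[of _ "a (pinv g)"]) (use g 1 2 into in auto)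
    then show ?thesis using ext[OF g] by (simp add: Bij_def)
  qed
  have "group_action G (topspace X) a"
  proof (intro group_action.intro group_hom.intro group_hom_axioms.intro homI group group_BijGroup)
    fix g assume g: "g \<in> carrier G" then show "a g \<in> carrier (BijGroup (topspace X))"
      using bij_a by (simp add: BijGroup_def)
    fix h assume h: "h \<in> carrier G"
    have "a (g \<circ> h) = compose (topspace X) (a g) (a h)"
    proof (rule extensionalityI[OF ext])
      show "compose (topspace X) (a g) (a h) \<in> extensional (topspace X)" by simp
    qed (use g h comp in \<open>auto simp: compose_def\<close>)
    then show "a (g \<otimes>\<^bsub>G\<^esub> h) = a g \<otimes>\<^bsub>BijGroup (topspace X)\<^esub> a h"
      using bij_a g h by (simp add: BijGroup_def mult)
  qed
  then show ?thesis using assms unfolding G_flow_def by blast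
qed

end

locale flow = perm_group G T for G T +
  fixes X :: "'x topology" and a :: "(nat \<Rightarrow> nat) \<Rightarrow> 'x \<Rightarrow> 'x"
  assumes flow: "G_flow G T X a"
begin

lemma nonempty: "topspace X \<noteq> {}" and compact: "compact_space X" and hausdorff: "Hausdorff_space X"
  and action: "group_action G (topspace X) a"
  and continuous_action: "continuous_map (prod_topology T X) X (\<lambda>(g, x). a g x)"
  using flow by (auto simp: G_flow_def)

lemma act_in [simp]: "g \<in> carrier G \<Longrightarrow> x \<in> topspace X \<Longrightarrow> a g x \<in> topspace X"
  using group_action.element_image[OF action] by blast

lemma act_id [simp]: "x \<in> topspace X \<Longrightarrow> a id x = x"
  using group_action.id_eq_one[OF action] one by (auto simp: fun_eq_iff split: if_splits)

lemma act_comp: "g \<in> carrier G \<Longrightarrow> h \<in> carrier G \<Longrightarrow> x \<in> topspace X \<Longrightarrow> a (g \<circ> h) x = a g (a h x)"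
  using group_action.composition_rule[OF action, of x g h] mult by simp

lemma act_inv_l [simp]: "g \<in> carrier G \<Longrightarrow> x \<in> topspace X \<Longrightarrow> a (pinv g) (a g x) = x"
  using act_comp[of "pinv g" g x] by simp

lemma act_inv_r [simp]: "g \<in> carrier G \<Longrightarrow> x \<in> topspace X \<Longrightarrow> a g (a (pinv g) x) = x"
  using act_comp[of g "pinv g" x] by simp

lemma act_nbhd:
  assumes "openin X U" "g \<in> carrier G" "x \<in> topspace X" "a g x \<in> U"
  obtains A N where "finite A" "openin X N" "x \<in> N"
    "\<And>h y. h \<in> carrier G \<Longrightarrow> \<forall>i\<in>A. h i = g i \<Longrightarrow> y \<in> N \<Longrightarrow> a h y \<in> U"
proof -
  have "openin (prod_topology T X) {p \<in> topspace (prod_topology T X). (case p of (g, x) \<Rightarrow> a g x) \<in> U}"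
    using continuous_action assms(1) openin_continuous_map_preimage by blast
  moreover have "(g, x) \<in> {p \<in> topspace (prod_topology T X). (case p of (g, x) \<Rightarrow> a g x) \<in> U}"
    using assms by simp
  ultimately obtain V N where VN: "openin T V" "openin X N" "g \<in> V" "x \<in> N"
    "V \<times> N \<subseteq> {p \<in> topspace (prod_topology T X). (case p of (g, x) \<Rightarrow> a g x) \<in> U}"
    unfolding openin_prod_topology_alt by meson
  from VN(1,3) obtain A where A: "finite A" "\<forall>h\<in>carrier G. (\<forall>i\<in>A. h i = g i) \<longrightarrow> h \<in> V"
    by (auto simp: openin_T)
  show ?thesis
  proof (rule that[OF A(1) VN(2) VN(4)])
    fix h y assume "h \<in> carrier G" "\<forall>i\<in>A. h i = g i" "y \<in> N"
    then have "(h, y) \<in> V \<times> N" using A(2) by blast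
    then show "a h y \<in> U" using VN(5) by auto
  qed
qed

lemma continuous_act: "g \<in> carrier G \<Longrightarrow> continuous_map X X (a g)"
proof -
  assume g: "g \<in> carrier G"
  have "continuous_map X X ((\<lambda>(g, x). a g x) \<circ> (\<lambda>x. (g, x)))"
    by (rule continuous_map_compose[OF _ continuous_action]) (use g in \<open>simp add: continuous_map_paired\<close>)
  then show ?thesis by (simp add: o_def)
qed

lemma image_act: "g \<in> carrier G \<Longrightarrow> S \<subseteq> topspace X \<Longrightarrow> a g ` S = {x \<in> topspace X. a (pinv g) x \<in> S}"
proof (intro equalityI subsetI)
  fix x assume g: "g \<in> carrier G" "S \<subseteq> topspace X" and "x \<in> {x \<in> topspace X. a (pinv g) x \<in> S}"
  then show "x \<in> a g ` S" by (intro image_eqI[of _ _ "a (pinv g) x"]) auto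
qed auto

lemma image_act_iff: "g \<in> carrier G \<Longrightarrow> S \<subseteq> topspace X \<Longrightarrow> x \<in> topspace X \<Longrightarrow> x \<in> a g ` S \<longleftrightarrow> a (pinv g) x \<in> S"
  by (simp add: image_act)

lemma openin_act: "g \<in> carrier G \<Longrightarrow> openin X U \<Longrightarrow> openin X (a g ` U)"
  using openin_continuous_map_preimage[OF continuous_act[of "pinv g"], of U]
  by (simp add: image_act openin_subset)

lemma closedin_act: "g \<in> carrier G \<Longrightarrow> closedin X U \<Longrightarrow> closedin X (a g ` U)"
  using closedin_continuous_map_preimage[OF continuous_act[of "pinv g"], of U]
  by (simp add: image_act closedin_subset)

end

lemma (in perm_group) flow_on:
  "G_flow G T X a \<Longrightarrow> flow G T X a"
  by unfold_locales

section \<open>Fixed points and sections from colourings\<close>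

text \<open>
  The hypothesis on colourings is the form of extreme amenability of the subgroup \<open>H\<close> that the Ramsey
  property of a class yields. If no point of \<open>Z0\<close> is fixed, then compactness provides finitely many
  open sets covering \<open>Z0\<close>, each of which is moved off itself by some element of \<open>H\<close>; colouring \<open>h\<close>
  by the member of the cover that contains \<open>a h z\<close>, for one fixed \<open>z\<close>, leaves no monochromatic
  translate.
\<close>

lemma (in flow) fixed_point_if_oscillation_stable:
  assumes H: "H \<subseteq> carrier G" "id \<in> H" "\<And>g h. g \<in> H \<Longrightarrow> h \<in> H \<Longrightarrow> g \<circ> h \<in> H"
    and osc: "\<And>A F r col. finite A \<Longrightarrow> finite F \<Longrightarrow> F \<subseteq> H \<Longrightarrow> col \<in> H \<rightarrow> {..<r::nat} \<Longrightarrow>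
        \<exists>k\<in>H. \<exists>i. \<forall>h\<in>F. \<exists>h'\<in>H. col h' = i \<and> (\<forall>x\<in>A. pinv h' x = pinv (h \<circ> k) x)"
    and Z0: "closedin X Z0" "Z0 \<noteq> {}" "\<And>h z. h \<in> H \<Longrightarrow> z \<in> Z0 \<Longrightarrow> a h z \<in> Z0"
  shows "\<exists>z\<in>Z0. \<forall>h\<in>H. a h z = z"
proof (rule ccontr)
  assume no: "\<not> (\<exists>z\<in>Z0. \<forall>h\<in>H. a h z = z)"
  have sub: "Z0 \<subseteq> topspace X" using Z0(1) closedin_subset by blast
  let ?P = "\<lambda>z h A N. h \<in> H \<and> finite A \<and> openin X N \<and> z \<in> N \<and>
     (\<forall>k\<in>stab A. \<forall>k'\<in>stab A. \<forall>y\<in>N. \<forall>y'\<in>N. a (h \<circ> k) y \<noteq> a k' y')"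
  have "\<exists>h A N. ?P z h A N" if z: "z \<in> Z0" for z
  proof -
    obtain h where h: "h \<in> H" "a h z \<noteq> z" using no z by blast
    have hG: "h \<in> carrier G" and zX: "z \<in> topspace X" using h H(1) z sub by auto
    obtain U V where UV: "openin X U" "openin X V" "z \<in> U" "a h z \<in> V" "disjnt U V"
      using hausdorff h(2) zX hG unfolding Hausdorff_space_def by (metis act_in)
    obtain A1 N1 where 1: "finite A1" "openin X N1" "z \<in> N1"
      "\<And>g y. g \<in> carrier G \<Longrightarrow> \<forall>i\<in>A1. g i = id i \<Longrightarrow> y \<in> N1 \<Longrightarrow> a g y \<in> U"
      using act_nbhd[of U id z] UV zX by auto
    obtain A2 N2 where 2: "finite A2" "openin X N2" "z \<in> N2"
      "\<And>g y. g \<in> carrier G \<Longrightarrow> \<forall>i\<in>A2. g i = h i \<Longrightarrow> y \<in> N2 \<Longrightarrow> a g y \<in> V"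
      using act_nbhd[of V h z] UV zX hG by auto
    have "?P z h (A1 \<union> A2) (N1 \<inter> N2)"
    proof (intro conjI ballI)
      fix k k' y y' assume k: "k \<in> stab (A1 \<union> A2)" "k' \<in> stab (A1 \<union> A2)"
        and y: "y \<in> N1 \<inter> N2" "y' \<in> N1 \<inter> N2"
      have "a k' y' \<in> U" by (rule 1(4)) (use k y in \<open>simp_all add: stab_def\<close>)
      moreover have "a (h \<circ> k) y \<in> V"
        by (rule 2(4)) (use k y hG in \<open>simp_all add: stab_def\<close>)
      ultimately show "a (h \<circ> k) y \<noteq> a k' y'" using UV(5) by (auto simp: disjnt_def)
    qed (use 1 2 h in auto)
    then show ?thesis by (intro exI)
  qed
  then have "\<forall>z\<in>Z0. \<exists>p. ?P z (fst p) (fst (snd p)) (snd (snd p))" by (simp add: split_paired_Ex)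
  then have "\<exists>p. \<forall>z\<in>Z0. ?P z (fst (p z)) (fst (snd (p z))) (snd (snd (p z)))"
    by (rule bchoice)
  then obtain p where p: "\<And>z. z \<in> Z0 \<Longrightarrow> ?P z (fst (p z)) (fst (snd (p z))) (snd (snd (p z)))"
    by blast
  define hz Az Nz where "hz z = fst (p z)" and "Az z = fst (snd (p z))" and "Nz z = snd (snd (p z))" for z
  have P: "?P z (hz z) (Az z) (Nz z)" if "z \<in> Z0" for z
    using p[OF that] by (simp add: hz_def Az_def Nz_def)
  have "compactin X Z0" using closedin_compact_space[OF compact Z0(1)] .
  then obtain \<F> where \<F>: "finite \<F>" "\<F> \<subseteq> Nz ` Z0" "Z0 \<subseteq> \<Union>\<F>"
    using P unfolding compactin_def by (smt (verit) UN_iff image_iff subsetI)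
  then obtain J where J: "finite J" "J \<subseteq> Z0" "Z0 \<subseteq> (\<Union>z\<in>J. Nz z)"
    by (metis finite_subset_image)
  obtain e where e: "bij_betw e {0..<card J} J" using ex_bij_betw_nat_finite[OF J(1)] by blast
  have eJ: "e i \<in> Z0" if "i < card J" for i using e that J(2) by (auto simp: bij_betw_def)
  obtain z1 where z1: "z1 \<in> Z0" using Z0(2) by blast
  have z1X: "z1 \<in> topspace X" using z1 sub by blast
  have "\<exists>i<card J. a h z1 \<in> Nz (e i)" if h: "h \<in> H" for h
  proof -
    have "a h z1 \<in> Z0" using Z0(3) z1 h by blast
    then obtain z where "z \<in> J" "a h z1 \<in> Nz z" using J(3) by blast
    then show ?thesis using e by (force simp: bij_betw_def)
  qed
  then obtain col where col: "\<And>h. h \<in> H \<Longrightarrow> col h < card J \<and> a h z1 \<in> Nz (e (col h))" by metis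
  have AJ: "finite (\<Union>z\<in>J. Az z)" using J P by blast
  have FJ: "insert id (hz ` J) \<subseteq> H" using P J(2) H(2) by blast
  obtain k i where k: "k \<in> H"
    "\<And>h. h \<in> insert id (hz ` J) \<Longrightarrow> \<exists>h'\<in>H. col h' = i \<and> (\<forall>x\<in>(\<Union>z\<in>J. Az z). pinv h' x = pinv (h \<circ> k) x)"
    using osc[OF AJ _ FJ, of col "card J"] J(1) col by (metis Pi_I finite_imageI finite_insert lessThan_iff)
  have kG: "k \<in> carrier G" using k H by blast
  obtain h1 where h1: "h1 \<in> H" "col h1 = i" "\<And>x. x \<in> (\<Union>z\<in>J. Az z) \<Longrightarrow> pinv h1 x = pinv k x"
    using k(2)[of id] by auto
  have i: "i < card J" using h1 col by blast
  have ei: "e i \<in> J" using e i by (auto simp: bij_betw_def)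
  define h where "h = hz (e i)"
  have h: "h \<in> H" using P[OF eJ[OF i]] by (simp add: h_def)
  then have hG: "h \<in> carrier G" using H by blast
  obtain h2 where h2: "h2 \<in> H" "col h2 = i" "\<And>x. x \<in> (\<Union>z\<in>J. Az z) \<Longrightarrow> pinv h2 x = pinv (h \<circ> k) x"
    using k(2)[of h] ei by (auto simp: h_def)
  have hG12: "h1 \<in> carrier G" "h2 \<in> carrier G" using h1 h2 H by auto
  have u1: "k \<circ> pinv h1 \<in> stab (Az (e i))"
    using h1(3) kG hG12 ei by (fastforce simp: stab_def)
  have hk: "h \<circ> k \<in> carrier G" using hG kG by simp
  have u2: "(h \<circ> k) \<circ> pinv h2 \<in> stab (Az (e i))"
  proof -
    have "(h \<circ> k) (pinv h2 x) = x" if "x \<in> Az (e i)" for x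
    proof -
      have eq: "pinv h2 x = pinv (h \<circ> k) x" using h2(3)[of x] ei that by blast
      show ?thesis unfolding eq by (rule inv_r[OF hk])
    qed
    then show ?thesis using hk hG12 by (simp add: stab_def)
  qed
  have y: "a h1 z1 \<in> Nz (e i)" "a h2 z1 \<in> Nz (e i)" using col[OF h1(1)] col[OF h2(1)] h1 h2 by auto
  \<comment> \<open>Up to elements fixing the relevant finite set, \<open>h1\<close> is \<open>k\<close> and \<open>h2\<close> is \<open>h \<circ> k\<close>. Both carry \<open>z1\<close>
  into the member of the cover that \<open>h\<close> moves off itself.\<close>
  have ne: "a (h \<circ> (k \<circ> pinv h1)) (a h1 z1) \<noteq> a ((h \<circ> k) \<circ> pinv h2) (a h2 z1)"
    using P[OF eJ[OF i]] u1 u2 y unfolding h_def by blast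
  have "a (h \<circ> (k \<circ> pinv h1)) (a h1 z1) = a (h \<circ> k) z1"
    using hG kG hG12 z1X by (simp add: act_comp)
  moreover have "a ((h \<circ> k) \<circ> pinv h2) (a h2 z1) = a (h \<circ> k) z1"
    using hG kG hG12 z1X by (simp add: act_comp)
  ultimately show False using ne by simp
qed

text \<open>
  Lift \<open>x0\<close> to a point \<open>z0\<close> fixed by the stabilizer of \<open>x0\<close>. The closure of the orbit of
  \<open>(x0, z0)\<close> projects onto \<open>X\<close> by compactness and density, and it is the graph of a function because
  elements of \<open>G\<close> that move \<open>x0\<close> to close points agree, up to the stabilizer, modulo a small
  subgroup. A function with closed graph into a compact space is continuous.
\<close>

lemma (in flow) projective_if_oscillation_stable:
  assumes x0: "x0 \<in> topspace X"
    and dense: "\<And>U. openin X U \<Longrightarrow> U \<noteq> {} \<Longrightarrow> \<exists>g\<in>carrier G. a g x0 \<in> U"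
    and H: "H = {h \<in> carrier G. a h x0 = x0}"
    and cosets: "\<And>A x. finite A \<Longrightarrow> x \<in> topspace X \<Longrightarrow> \<exists>U. openin X U \<and> x \<in> U \<and>
        (\<forall>g\<in>carrier G. \<forall>g'\<in>carrier G. a g x0 \<in> U \<longrightarrow> a g' x0 \<in> U \<longrightarrow>
           (\<exists>h\<in>H. \<forall>y\<in>A. h (pinv g y) = pinv g' y))"
    and osc: "\<And>A F r col. finite A \<Longrightarrow> finite F \<Longrightarrow> F \<subseteq> H \<Longrightarrow> col \<in> H \<rightarrow> {..<r::nat} \<Longrightarrow>
        \<exists>k\<in>H. \<exists>i. \<forall>h\<in>F. \<exists>h'\<in>H. col h' = i \<and> (\<forall>x\<in>A. pinv h' x = pinv (h \<circ> k) x)"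
  shows "G_projective TYPE('u) G T X a"
  unfolding G_projective_def
proof (intro allI impI)
  fix Y :: "'u topology" and b and Z :: "'u topology" and c \<phi> \<pi>
  assume as: "G_flow G T Y b \<and> G_flow G T Z c \<and> G_map G X a Y b \<phi> \<and> G_map G Z c Y b \<pi> \<and>
        \<pi> ` topspace Z = topspace Y"
  interpret Y: flow G T Y b using as by (simp add: flow_on)
  interpret Z: flow G T Z c using as by (simp add: flow_on)
  have \<phi>: "continuous_map X Y \<phi>" "\<And>g x. g \<in> carrier G \<Longrightarrow> x \<in> topspace X \<Longrightarrow> \<phi> (a g x) = b g (\<phi> x)"
    and \<pi>: "continuous_map Z Y \<pi>" "\<And>g x. g \<in> carrier G \<Longrightarrow> x \<in> topspace Z \<Longrightarrow> \<pi> (c g x) = b g (\<pi> x)"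
    and onto: "\<pi> ` topspace Z = topspace Y"
    using as by (auto simp: G_map_def)
  have \<phi>in: "\<phi> x \<in> topspace Y" if "x \<in> topspace X" for x
    using \<phi>(1) that continuous_map_image_subset_topspace by fastforce
  let ?Z0 = "{z \<in> topspace Z. \<pi> z = \<phi> x0}"
  have "\<exists>z\<in>?Z0. \<forall>h\<in>H. c h z = z"
  proof (rule Z.fixed_point_if_oscillation_stable[OF _ _ _ osc])
    show "closedin Z ?Z0"
      by (rule closedin_continuous_maps_eq[OF Y.hausdorff \<pi>(1)]) (simp add: \<phi>in x0)
    obtain z where "z \<in> topspace Z" "\<pi> z = \<phi> x0" using \<phi>in[OF x0] onto by (metis imageE)
    then show "?Z0 \<noteq> {}" by blast
    show "c h z \<in> ?Z0" if "h \<in> H" "z \<in> ?Z0" for h z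
    proof -
      have "\<pi> (c h z) = b h (\<phi> x0)" using \<pi>(2) that H by simp
      also have "\<dots> = \<phi> x0" using \<phi>(2)[of h x0] that H x0 by simp
      finally show ?thesis using that H by simp
    qed
    show "g \<circ> h \<in> H" if "g \<in> H" "h \<in> H" for g h
      using that x0 by (simp add: H act_comp)
  qed (use H x0 in auto)
  then obtain z0 where z0: "z0 \<in> topspace Z" "\<pi> z0 = \<phi> x0" "\<And>h. h \<in> H \<Longrightarrow> c h z0 = z0" by blast
  let ?P = "prod_topology X Z"
  define S where "S = {(a g x0, c g z0) |g. g \<in> carrier G}"
  define R where "R = ?P closure_of S"
  have closR: "closedin ?P R" by (simp add: R_def)
  have Rsub: "R \<subseteq> topspace X \<times> topspace Z" using closedin_subset[OF closR] by simp
  have S_sub: "S \<subseteq> topspace ?P" using x0 z0 by (auto simp: S_def)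
  have SR: "S \<subseteq> R" unfolding R_def using S_sub closure_of_subset by blast
  have R_over: "\<phi> (fst p) = \<pi> (snd p)" if "p \<in> R" for p
  proof -
    have "closedin ?P {p \<in> topspace ?P. (\<phi> \<circ> fst) p = (\<pi> \<circ> snd) p}"
      using closedin_continuous_maps_eq[OF Y.hausdorff continuous_map_compose[OF continuous_map_fst \<phi>(1)]
          continuous_map_compose[OF continuous_map_snd \<pi>(1)]] .
    moreover have "S \<subseteq> {p \<in> topspace ?P. (\<phi> \<circ> fst) p = (\<pi> \<circ> snd) p}"
      using S_sub \<phi>(2) \<pi>(2) x0 z0 by (auto simp: S_def)
    ultimately have "R \<subseteq> {p \<in> topspace ?P. (\<phi> \<circ> fst) p = (\<pi> \<circ> snd) p}"
      unfolding R_def by (simp add: closure_of_minimal)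
    then show ?thesis using that by auto
  qed
  have R_onto: "topspace X \<subseteq> fst ` R"
  proof (rule ccontr)
    assume "\<not> topspace X \<subseteq> fst ` R"
    then have "topspace X - fst ` R \<noteq> {}" by blast
    moreover have "closedin X (fst ` R)"
      using closed_map_fst[OF Z.compact] closR unfolding closed_map_def by blast
    ultimately obtain g where "g \<in> carrier G" "a g x0 \<in> topspace X - fst ` R"
      using dense[of "topspace X - fst ` R"] by (auto simp: closedin_def)
    moreover have "(a g x0, c g z0) \<in> R" using SR \<open>g \<in> carrier G\<close> by (auto simp: S_def)
    ultimately show False by force
  qed
  have R_fun: "p = q" if pq: "(x, p) \<in> R" "(x, q) \<in> R" for x p q
  proof (rule ccontr)
    assume "p \<noteq> q"
    have top: "x \<in> topspace X" "p \<in> topspace Z" "q \<in> topspace Z" using pq Rsub by auto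
    obtain U V where UV: "openin Z U" "openin Z V" "p \<in> U" "q \<in> V" "disjnt U V"
      using Z.hausdorff \<open>p \<noteq> q\<close> top unfolding Hausdorff_space_def by metis
    obtain A N where A: "finite A" "openin Z N" "p \<in> N"
      "\<And>g y. g \<in> carrier G \<Longrightarrow> \<forall>i\<in>A. g i = id i \<Longrightarrow> y \<in> N \<Longrightarrow> c g y \<in> U"
      using Z.act_nbhd[of U id p] UV top by auto
    obtain W where W: "openin X W" "x \<in> W"
      "\<And>g g'. g \<in> carrier G \<Longrightarrow> g' \<in> carrier G \<Longrightarrow> a g x0 \<in> W \<Longrightarrow> a g' x0 \<in> W \<Longrightarrow>
         \<exists>h\<in>H. \<forall>y\<in>A. h (pinv g y) = pinv g' y"
      using cosets[OF A(1) top(1)] by blast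
    have meets: "\<exists>g\<in>carrier G. a g x0 \<in> W \<and> c g z0 \<in> O'" if O': "openin Z O'" "(x, r) \<in> R" "r \<in> O'" for O' r
    proof -
      have "openin ?P (W \<times> O')" using W(1) O'(1) by (simp add: openin_prod_Times_iff)
      moreover have "(x, r) \<in> W \<times> O'" using W(2) O'(3) by simp
      ultimately obtain s where "s \<in> S" "s \<in> W \<times> O'"
        using conjunct2[OF iffD1[OF in_closure_of O'(2)[unfolded R_def]]] by metis
      then obtain g where "g \<in> carrier G" "(a g x0, c g z0) \<in> W \<times> O'" unfolding S_def by auto
      then show ?thesis by (intro bexI[of _ g]) simp_all
    qed
    obtain g1 where g1: "g1 \<in> carrier G" "a g1 x0 \<in> W" "c g1 z0 \<in> N"
      using meets[OF A(2) pq(1) A(3)] by blast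
    obtain g2 where g2: "g2 \<in> carrier G" "a g2 x0 \<in> W" "c g2 z0 \<in> V"
      using meets[OF UV(2) pq(2) UV(4)] by blast
    obtain h where h: "h \<in> H" "\<And>y. y \<in> A \<Longrightarrow> h (pinv g1 y) = pinv g2 y"
      using W(3)[OF g1(1) g2(1) g1(2) g2(2)] by blast
    have hG: "h \<in> carrier G" using h H by simp
    \<comment> \<open>This group element fixes \<open>A\<close>, hence keeps points of \<open>N\<close> in \<open>U\<close>, yet it takes \<open>c g1 z0\<close> to \<open>c g2 z0\<close>.\<close>
    have "c (g2 \<circ> h \<circ> pinv g1) (c g1 z0) \<in> U"
      by (rule A(4)) (use g1 g2 hG h(2) in auto)
    moreover have "c (g2 \<circ> h \<circ> pinv g1) (c g1 z0) = c g2 z0"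
      using g1(1) g2(1) hG z0(1) z0(3)[OF h(1)] by (simp add: Z.act_comp)
    ultimately show False using g2(3) UV(5) by (auto simp: disjnt_def)
  qed
  have R_inv: "(a g x, c g z) \<in> R" if g: "g \<in> carrier G" and xz: "(x, z) \<in> R" for g x z
  proof -
    let ?m = "\<lambda>p. (a g (fst p), c g (snd p))"
    have "continuous_map ?P ?P ?m"
      using continuous_map_compose[OF continuous_map_fst continuous_act[OF g], of Z]
        continuous_map_compose[OF continuous_map_snd Z.continuous_act[OF g], of X]
      by (simp add: continuous_map_pairwise o_def)
    then have "?m ` R \<subseteq> ?P closure_of (?m ` S)"
      unfolding R_def using continuous_map_image_closure_subset by blast
    also have "?m ` S \<subseteq> S"
    proof
      fix p assume "p \<in> ?m ` S"
      then obtain g' where g': "g' \<in> carrier G" "p = (a g (a g' x0), c g (c g' z0))" by (auto simp: S_def)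
      then have "p = (a (g \<circ> g') x0, c (g \<circ> g') z0)" using g x0 z0(1) by (simp add: act_comp Z.act_comp)
      then show "p \<in> S" using g g' comp_in unfolding S_def by blast
    qed
    then have "?P closure_of (?m ` S) \<subseteq> R" unfolding R_def by (rule closure_of_mono)
    finally show ?thesis using xz by force
  qed
  obtain \<psi> where \<psi>: "\<And>x. x \<in> topspace X \<Longrightarrow> (x, \<psi> x) \<in> R"
  proof -
    have "\<forall>x\<in>topspace X. \<exists>z. (x, z) \<in> R" using R_onto by force
    then show ?thesis using that by metis
  qed
  have "continuous_map X Z \<psi>"
    unfolding continuous_map_closedin
  proof (intro conjI allI impI Pi_I)
    show "\<psi> x \<in> topspace Z" if "x \<in> topspace X" for x using \<psi>[OF that] Rsub by auto
    fix C assume C: "closedin Z C"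
    have "closedin ?P (R \<inter> (topspace X \<times> C))"
      using closR C by (intro closedin_Int) (simp_all add: closedin_prod_Times_iff)
    then have "closedin X (fst ` (R \<inter> (topspace X \<times> C)))"
      using closed_map_fst[OF Z.compact] unfolding closed_map_def by blast
    moreover have "fst ` (R \<inter> (topspace X \<times> C)) = {x \<in> topspace X. \<psi> x \<in> C}"
    proof (intro equalityI subsetI)
      fix x assume "x \<in> fst ` (R \<inter> (topspace X \<times> C))"
      then obtain z where z: "(x, z) \<in> R" "x \<in> topspace X" "z \<in> C" by auto
      then have "z = \<psi> x" using R_fun \<psi> by blast
      then show "x \<in> {x \<in> topspace X. \<psi> x \<in> C}" using z by simp
    next
      fix x assume "x \<in> {x \<in> topspace X. \<psi> x \<in> C}"
      then show "x \<in> fst ` (R \<inter> (topspace X \<times> C))" using \<psi> by (intro image_eqI[of _ _ "(x, \<psi> x)"]) auto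
    qed
    ultimately show "closedin X {x \<in> topspace X. \<psi> x \<in> C}" by simp
  qed
  moreover have "\<psi> (a g x) = c g (\<psi> x)" if "g \<in> carrier G" "x \<in> topspace X" for g x
    by (rule R_fun[OF \<psi>[OF act_in[OF that]] R_inv[OF that(1) \<psi>[OF that(2)]]])
  moreover have "\<pi> (\<psi> x) = \<phi> x" if "x \<in> topspace X" for x
    using R_over[OF \<psi>[OF that]] by simp
  ultimately show "\<exists>\<psi>. G_map G X a Z c \<psi> \<and> (\<forall>x\<in>topspace X. \<pi> (\<psi> x) = \<phi> x)"
    unfolding G_map_def by blast
qed

section \<open>Lifting along surjections onto a projective flow\<close>

text \<open>
  Projectivity quantifies over flows on one fixed type. A flow on another type is transported along
  an injection of its points.
\<close>

lemma homeomorphic_copy: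
  assumes "inj_on i (topspace X)"
  shows "\<exists>X'. homeomorphic_maps X X' i (inv_into (topspace X) i)"
proof -
  let ?j = "inv_into (topspace X) i" and ?X' = "pullback_topology (i ` topspace X) (inv_into (topspace X) i) X"
  have "continuous_map X ?X' i"
  proof (rule continuous_map_pullback')
    show "continuous_map X X (?j \<circ> i)"
      by (rule continuous_map_eq[OF continuous_map_id]) (simp add: assms)
  qed auto
  moreover have "continuous_map ?X' X (id \<circ> ?j)"
    by (rule continuous_map_pullback) simp
  ultimately have "homeomorphic_maps X ?X' i ?j"
    using assms by (auto simp: homeomorphic_maps_def topspace_pullback_topology f_inv_into_f)
  then show ?thesis by blast
qed

lemma (in flow) flow_transport:
  assumes "homeomorphic_maps X X' i j"
  shows "G_flow G T X' (\<lambda>g. \<lambda>y\<in>topspace X'. i (a g (j y)))"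
proof -
  have i: "continuous_map X X' i" and j: "continuous_map X' X j"
    and ji: "\<And>x. x \<in> topspace X \<Longrightarrow> j (i x) = x" and ij: "\<And>y. y \<in> topspace X' \<Longrightarrow> i (j y) = y"
    using assms by (auto simp: homeomorphic_maps_def)
  have i_in: "i x \<in> topspace X'" if "x \<in> topspace X" for x
    using continuous_map_image_subset_topspace[OF i] that by auto
  have j_in: "j y \<in> topspace X" if "y \<in> topspace X'" for y
    using continuous_map_image_subset_topspace[OF j] that by auto
  have hs: "X homeomorphic_space X'" using assms homeomorphic_space_def by blast
  show ?thesis
  proof (rule G_flowI)
    show "topspace X' \<noteq> {}" using nonempty i_in by blast
    show "compact_space X'" "Hausdorff_space X'"
      using compact hausdorff homeomorphic_compact_space[OF hs] homeomorphic_Hausdorff_space[OF hs] by auto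
    have "continuous_map (prod_topology T X') (prod_topology T X) (\<lambda>(g, y). (g, j y))"
      using continuous_map_compose[OF continuous_map_snd j, of T]
      by (simp add: continuous_map_pairwise o_def case_prod_unfold continuous_map_fst)
    from continuous_map_compose[OF continuous_map_compose[OF this continuous_action] i]
    show "continuous_map (prod_topology T X') X' (\<lambda>(g, x). (\<lambda>y\<in>topspace X'. i (a g (j y))) x)"
      by (rule continuous_map_eq) auto
  qed (use i_in j_in ij ji in \<open>auto simp: act_comp\<close>)
qed

locale metrizable_projective_flow = flow G T X a
  for G T and X :: "'x topology" and a +
  fixes U :: "'u itself"
  assumes metrizable: "metrizable_space X"
    and projective: "G_projective U G T X a"
    and large: "(UNIV :: nat set set set) \<lesssim> (UNIV :: 'u set)"
begin

text \<open>
  Projectivity is applied to the identity of \<open>X\<close>, after \<open>X\<close> and \<open>Z\<close> have been copied to the type \<open>'u\<close>.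
\<close>

lemma section_exists:
  fixes Z :: "'z topology"
  assumes Z: "G_flow G T Z c" and card: "topspace X \<lesssim> (UNIV :: 'u set)" "topspace Z \<lesssim> (UNIV :: 'u set)"
    and \<pi>: "G_map G Z c X a \<pi>" "\<pi> ` topspace Z = topspace X"
  obtains \<psi> where "G_map G X a Z c \<psi>" "\<And>x. x \<in> topspace X \<Longrightarrow> \<pi> (\<psi> x) = x"
proof -
  interpret Z: flow G T Z c using Z by (rule flow_on)
  obtain i :: "'x \<Rightarrow> 'u" where i: "inj_on i (topspace X)" using card(1) unfolding lepoll_def by blast
  obtain k :: "'z \<Rightarrow> 'u" where k: "inj_on k (topspace Z)" using card(2) unfolding lepoll_def by blast
  obtain X' i' where X': "homeomorphic_maps X X' i i'" using homeomorphic_copy[OF i] by blast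
  obtain Z' k' where Z': "homeomorphic_maps Z Z' k k'" using homeomorphic_copy[OF k] by blast
  define b where "b = (\<lambda>g. \<lambda>y\<in>topspace X'. i (a g (i' y)))"
  define d where "d = (\<lambda>g. \<lambda>y\<in>topspace Z'. k (c g (k' y)))"
  have flows: "G_flow G T X' b" "G_flow G T Z' d"
    unfolding b_def d_def using flow_transport[OF X'] Z.flow_transport[OF Z'] by auto
  have ci: "continuous_map X X' i" and ck: "continuous_map Z Z' k" and ck': "continuous_map Z' Z k'"
    and i'i: "\<And>x. x \<in> topspace X \<Longrightarrow> i' (i x) = x" and kk': "\<And>y. y \<in> topspace Z' \<Longrightarrow> k (k' y) = y"
    and k'k: "\<And>x. x \<in> topspace Z \<Longrightarrow> k' (k x) = x" and ii': "\<And>y. y \<in> topspace X' \<Longrightarrow> i (i' y) = y"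
    and ci': "continuous_map X' X i'"
    using X' Z' by (auto simp: homeomorphic_maps_def)
  have in1: "\<And>x. x \<in> topspace X \<Longrightarrow> i x \<in> topspace X'"
    and in2: "\<And>x. x \<in> topspace Z \<Longrightarrow> k x \<in> topspace Z'"
    and in3: "\<And>x. x \<in> topspace Z' \<Longrightarrow> k' x \<in> topspace Z"
    and in4: "\<And>x. x \<in> topspace X' \<Longrightarrow> i' x \<in> topspace X"
    using continuous_map_image_subset_topspace[OF ci] continuous_map_image_subset_topspace[OF ck]
      continuous_map_image_subset_topspace[OF ck'] continuous_map_image_subset_topspace[OF ci'] by auto
  have c\<pi>: "continuous_map Z X \<pi>" and e\<pi>: "\<And>g z. g \<in> carrier G \<Longrightarrow> z \<in> topspace Z \<Longrightarrow> \<pi> (c g z) = a g (\<pi> z)"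
    using \<pi>(1) by (auto simp: G_map_def)
  have \<pi>_in: "\<And>z. z \<in> topspace Z \<Longrightarrow> \<pi> z \<in> topspace X"
    using \<pi>(2) by blast
  have 1: "G_map G X a X' b i"
    using ci in1 i'i by (auto simp: G_map_def b_def)
  have 2: "G_map G Z' d X' b (i \<circ> \<pi> \<circ> k')"
    unfolding G_map_def
  proof (intro conjI ballI)
    show "continuous_map Z' X' (i \<circ> \<pi> \<circ> k')"
      using continuous_map_compose[OF ck' continuous_map_compose[OF c\<pi> ci]] by (simp add: o_assoc)
    show "(i \<circ> \<pi> \<circ> k') (d g z) = b g ((i \<circ> \<pi> \<circ> k') z)" if "g \<in> carrier G" "z \<in> topspace Z'" for g z
      using that in1 in3 \<pi>_in k'k i'i e\<pi> by (simp add: d_def b_def)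
  qed
  have 3: "(i \<circ> \<pi> \<circ> k') ` topspace Z' = topspace X'"
  proof (intro equalityI subsetI)
    fix y assume "y \<in> topspace X'"
    then obtain z where z: "z \<in> topspace Z" "\<pi> z = i' y" using in4 \<pi>(2) by (metis imageE)
    then show "y \<in> (i \<circ> \<pi> \<circ> k') ` topspace Z'"
      using \<open>y \<in> topspace X'\<close> in2 k'k ii' by (intro image_eqI[of _ _ "k z"]) auto
  qed (use in1 in3 \<pi>_in in auto)
  obtain \<psi> where \<psi>: "G_map G X a Z' d \<psi>" "\<And>x. x \<in> topspace X \<Longrightarrow> (i \<circ> \<pi> \<circ> k') (\<psi> x) = i x"
    using projective[unfolded G_projective_def, rule_format,
        OF conjI[OF flows(1) conjI[OF flows(2) conjI[OF 1 conjI[OF 2 3]]]]] by blast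
  have \<psi>in: "\<psi> x \<in> topspace Z'" if "x \<in> topspace X" for x
    using \<psi>(1) continuous_map_image_subset_topspace[of X Z' \<psi>] that by (auto simp: G_map_def)
  show ?thesis
  proof (rule that[of "k' \<circ> \<psi>"])
    show "G_map G X a Z c (k' \<circ> \<psi>)"
      unfolding G_map_def
    proof (intro conjI ballI)
      show "continuous_map X Z (k' \<circ> \<psi>)"
        using \<psi>(1) ck' continuous_map_compose by (auto simp: G_map_def)
      show "(k' \<circ> \<psi>) (a g x) = c g ((k' \<circ> \<psi>) x)" if "g \<in> carrier G" "x \<in> topspace X" for g x
        using \<psi>(1) that \<psi>in in3 k'k by (simp add: G_map_def d_def)
    qed
    show "\<pi> ((k' \<circ> \<psi>) x) = x" if "x \<in> topspace X" for x
    proof -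
      have "i' (i (\<pi> (k' (\<psi> x)))) = i' (i x)" using \<psi>(2)[OF that] by simp
      then show ?thesis using i'i \<pi>_in in3 \<psi>in that by simp
    qed
  qed
qed

end

text \<open>
  For each \<open>n\<close>, finitely many balls of radius \<open>1 / (n + 1)\<close> cover the space, and a point is determined
  by the balls from these countably many that contain it.
\<close>

lemma compact_metrizable_lepoll:
  assumes "compact_space X" "metrizable_space X"
  shows "topspace X \<lesssim> (UNIV :: nat set set)"
proof -
  obtain M d where M: "Metric_space M d" and X: "X = Metric_space.mtopology M d"
    using assms(2) unfolding metrizable_space_def by blast
  interpret Metric_space M d by (rule M)
  have top: "topspace X = M" by (simp add: X)
  have "\<exists>F. finite F \<and> F \<subseteq> M \<and> M \<subseteq> (\<Union>c\<in>F. mball c (1 / real (Suc n)))" for n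
  proof -
    let ?B = "\<lambda>c. mball c (1 / real (Suc n))"
    have "\<forall>V\<in>?B ` M. openin X V" by (auto simp: X)
    moreover have "topspace X \<subseteq> \<Union>(?B ` M)" 
    proof
      fix x assume "x \<in> topspace X"
      then show "x \<in> \<Union>(?B ` M)" using top by (intro UN_I[of x]) auto
    qed
    ultimately obtain \<F> where \<F>: "finite \<F>" "\<F> \<subseteq> ?B ` M" "topspace X \<subseteq> \<Union>\<F>"
      using assms(1) unfolding compact_space_alt by meson
    then obtain F where "finite F" "F \<subseteq> M" "\<F> = ?B ` F" by (meson finite_subset_image)
    then show ?thesis using \<F>(3) top by auto
  qed
  then obtain F where F: "\<And>n. finite (F n)" "\<And>n. F n \<subseteq> M" "\<And>n. M \<subseteq> (\<Union>c\<in>F n. mball c (1 / real (Suc n)))"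
    by metis
  let ?I = "SIGMA n:UNIV. F n"
  have ct: "countable ?I" using F(1) by (simp add: countable_finite)
  let ?f = "\<lambda>x. to_nat_on ?I ` {(n, c). c \<in> F n \<and> x \<in> mball c (1 / real (Suc n))}"
  have "inj_on ?f M"
  proof (rule inj_onI, rule ccontr)
    fix x y assume xy: "x \<in> M" "y \<in> M" "?f x = ?f y" "x \<noteq> y"
    have "d x y > 0" using xy by simp
    then obtain n where n: "1 / real (Suc n) < d x y / 2"
      using nat_approx_posE[of "d x y / 2"] by auto
    obtain c where c: "c \<in> F n" "x \<in> mball c (1 / real (Suc n))" using F(3)[of n] xy(1) by blast
    have inj: "inj_on (to_nat_on ?I) ?I" using ct by (rule inj_on_to_nat_on)
    have "{(n, c). c \<in> F n \<and> x \<in> mball c (1 / real (Suc n))} = {(n, c). c \<in> F n \<and> y \<in> mball c (1 / real (Suc n))}"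
      by (rule inj_on_image_eq_iff[OF inj, THEN iffD1, OF _ _ xy(3)]) auto
    moreover have "(n, c) \<in> {(n, c). c \<in> F n \<and> x \<in> mball c (1 / real (Suc n))}" using c by simp
    ultimately have "y \<in> mball c (1 / real (Suc n))" by auto
    then have "d x c < d x y / 2" "d c y < d x y / 2" "c \<in> M"
      using c n by (auto simp: commute)
    then show False using triangle[of x c y] xy by simp
  qed
  then have "topspace X \<lesssim> (UNIV :: nat set set)" unfolding lepoll_def top by blast
  then show ?thesis .
qed

lemma lepoll_if_inj: "inj f \<Longrightarrow> (UNIV :: 'a set) \<lesssim> (UNIV :: 'b set)" for f :: "'a \<Rightarrow> 'b"
  unfolding lepoll_def by (intro exI[of _ f]) simp

text \<open>
  A functional \<open>c\<close> is coded by its graph, and the pair of \<open>c f\<close> and \<open>f\<close> by the sequence that starts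
  with \<open>c f\<close> and continues with \<open>f\<close>.
\<close>

lemma lepoll_functionals: "(UNIV :: ((nat \<Rightarrow> nat) \<Rightarrow> nat) set) \<lesssim> (UNIV :: nat set set set)"
proof -
  define gr :: "(nat \<Rightarrow> nat) \<Rightarrow> nat set" where "gr g = range (\<lambda>n. prod_encode (n, g n))" for g
  have gr: "g = h" if "gr g = gr h" for g h
  proof
    fix n
    have "prod_encode (n, g n) \<in> gr h" using that by (auto simp: gr_def)
    then show "g n = h n" by (auto simp: gr_def prod_encode_eq)
  qed
  define cons :: "nat \<Rightarrow> (nat \<Rightarrow> nat) \<Rightarrow> nat \<Rightarrow> nat" where "cons m f n = (case n of 0 \<Rightarrow> m | Suc k \<Rightarrow> f k)" for m f n
  have cons: "m = m' \<and> f = f'" if "cons m f = cons m' f'" for m m' f f'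
  proof
    have *: "cons m f n = cons m' f' n" for n by (simp only: that)
    show "m = m'" using *[of 0] by (simp add: cons_def)
    show "f = f'"
    proof
      show "f n = f' n" for n using *[of "Suc n"] by (simp add: cons_def)
    qed
  qed
  define F where "F c = range (\<lambda>f. gr (cons (c f) f))" for c
  have "inj F"
  proof (rule injI)
    fix c c' assume F: "F c = F c'"
    show "c = c'"
    proof
    fix f
    have "F c = F c'" by (rule F)
    moreover have "gr (cons (c f) f) \<in> F c" by (simp add: F_def)
    ultimately obtain f' where "gr (cons (c f) f) = gr (cons (c' f') f')" unfolding F_def by auto
    note * = cons[OF gr[OF this]]
    have "c f = c' f'" using * by (rule conjunct1)
    also have "\<dots> = c' f" by (simp only: conjunct2[OF *])
    finally show "c f = c' f" .
    qed
  qed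
  then show ?thesis by (rule lepoll_if_inj)
qed

text \<open>
  In the code of a pair, the number \<open>0\<close> marks the sets that come from the second component.
\<close>

lemma lepoll_pairs: "(UNIV :: (nat set \<times> nat set set) set) \<lesssim> (UNIV :: nat set set set)"
proof -
  define sh :: "nat set \<Rightarrow> nat set" where "sh d = insert 0 (Suc ` d)" for d
  define f where "f p = insert (Suc ` fst p) (sh ` snd p)" for p :: "nat set \<times> nat set set"
  have ne: "Suc ` s \<noteq> sh d" for s d
  proof
    assume "Suc ` s = sh d"
    moreover have "0 \<in> sh d" by (simp add: sh_def)
    ultimately show False by (metis imageE nat.distinct(1))
  qed
  have "inj sh"
  proof (rule injI)
    fix d e assume "sh d = sh e"
    then have "{n. Suc n \<in> sh d} = {n. Suc n \<in> sh e}" by simp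
    moreover have "{n. Suc n \<in> sh d} = d" for d by (auto simp: sh_def)
    ultimately show "d = e" by simp
  qed
  have sub: "fst p = fst q \<and> snd p \<subseteq> snd q" if eq: "f p = f q" for p q
  proof
    have "Suc ` fst p \<in> f p" by (simp add: f_def)
    then have "Suc ` fst p \<in> f q" by (simp only: eq)
    then have "Suc ` fst p = Suc ` fst q" unfolding f_def using ne by blast
    then show "fst p = fst q" by (simp add: inj_image_eq_iff)
    show "snd p \<subseteq> snd q"
    proof
      fix d assume "d \<in> snd p"
      then have "sh d \<in> f p" by (simp add: f_def)
      then have "sh d \<in> f q" by (simp only: eq)
      then have "sh d \<in> sh ` snd q" unfolding f_def using ne by (metis insertE)
      then show "d \<in> snd q" using \<open>inj sh\<close> by (simp add: inj_image_mem_iff)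
    qed
  qed
  have "inj f"
  proof (rule injI)
    fix p q assume "f p = f q"
    then show "p = q" using sub[of p q] sub[of q p] by (simp add: prod_eq_iff)
  qed
  then show ?thesis by (rule lepoll_if_inj)
qed

lemma continuous_map_into_discrete:
  assumes "\<And>x. x \<in> topspace X \<Longrightarrow> f x \<in> D"
    and "\<And>x. x \<in> topspace X \<Longrightarrow> \<exists>V. openin X V \<and> x \<in> V \<and> (\<forall>y\<in>V. f y = f x)"
  shows "continuous_map X (discrete_topology D) f"
  unfolding continuous_map_def
proof (intro conjI allI impI)
  fix S
  have "\<exists>T. openin X T \<and> x \<in> T \<and> T \<subseteq> {x \<in> topspace X. f x \<in> S}" if x: "x \<in> {x \<in> topspace X. f x \<in> S}" for x
  proof -
    obtain V where V: "openin X V" "x \<in> V" "\<forall>y\<in>V. f y = f x" using assms(2)[of x] x by auto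
    have "V \<subseteq> {x \<in> topspace X. f x \<in> S}" using V(3) x openin_subset[OF V(1)] by auto
    then show ?thesis using V(1,2) by blast
  qed
  then show "openin X {x \<in> topspace X. f x \<in> S}" by (rule openinI)
qed (use assms(1) in simp)

section \<open>Cells of metrizable projective flows\<close>

text \<open>
  A closed \<open>G\<close>-invariant relation \<open>W\<close> between points of \<open>X\<close> and \<open>r\<close>-colourings of \<open>G / stab A\<close> is a
  flow over \<open>X\<close>, and a section of it is a continuous choice of colourings. By equivariance the choice
  is determined by the colour of the identity coset.
\<close>

lemma (in metrizable_projective_flow) equivariant_selection:
  fixes W :: "('x \<times> ((nat \<Rightarrow> nat) \<Rightarrow> nat)) set"
  assumes A: "finite A"
    and closed: "closedin (prod_topology X (product_topology (\<lambda>_. discrete_topology {..<r}) (carrier G))) W"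
    and invariant: "\<And>x c h. (x, c) \<in> W \<Longrightarrow> h \<in> carrier G \<Longrightarrow> (a h x, \<lambda>g\<in>carrier G. c (pinv h \<circ> g)) \<in> W"
    and cosets: "\<And>p g h. p \<in> W \<Longrightarrow> g \<in> carrier G \<Longrightarrow> h \<in> carrier G \<Longrightarrow> \<forall>y\<in>A. g y = h y \<Longrightarrow> snd p g = snd p h"
    and onto: "\<And>x. x \<in> topspace X \<Longrightarrow> \<exists>c. (x, c) \<in> W"
  obtains \<gamma> where "continuous_map X (discrete_topology {..<r}) \<gamma>"
    "\<And>g x. g \<in> stab A \<Longrightarrow> x \<in> topspace X \<Longrightarrow> \<gamma> (a g x) = \<gamma> x"
    "\<And>x. x \<in> topspace X \<Longrightarrow> (x, \<lambda>g\<in>carrier G. \<gamma> (a (pinv g) x)) \<in> W"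
proof -
  let ?C = "product_topology (\<lambda>_. discrete_topology {..<r}) (carrier G)"
  let ?P = "prod_topology X ?C"
  define Z where "Z = subtopology ?P W"
  define c where "c = (\<lambda>h. \<lambda>p\<in>W. (a h (fst p), \<lambda>g\<in>carrier G. snd p (pinv h \<circ> g)))"
  have Wsub: "W \<subseteq> topspace X \<times> (carrier G \<rightarrow>\<^sub>E {..<r})" using closedin_subset[OF closed] by simp
  have top: "topspace Z = W" using Wsub unfolding Z_def by (simp add: Int_absorb1)
  have inX: "fst p \<in> topspace X" if "p \<in> W" for p using subsetD[OF Wsub that] by (simp add: mem_Times_iff)
  have inC: "snd p \<in> carrier G \<rightarrow>\<^sub>E {..<r}" if "p \<in> W" for p using subsetD[OF Wsub that] by (simp add: mem_Times_iff)
  have cW: "c h p \<in> W" if "h \<in> carrier G" "p \<in> W" for h p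
  proof -
    have "(fst p, snd p) \<in> W" using that by simp
    from invariant[OF this that(1)] show ?thesis using that by (simp add: c_def)
  qed
  have compC: "compact_space ?C" by (simp add: compact_space_product_topology compact_space_discrete_topology)
  have hausC: "Hausdorff_space ?C" by (simp add: Hausdorff_space_product_topology)
  have contfst: "continuous_map Z X fst" and contsnd: "continuous_map Z ?C snd"
    unfolding Z_def
    by (rule continuous_map_from_subtopology[OF continuous_map_fst],
        rule continuous_map_from_subtopology[OF continuous_map_snd])
  have coord: "continuous_map Z (discrete_topology {..<r}) (\<lambda>p. snd p e)" if "e \<in> carrier G" for e
  proof -
    have "continuous_map ?C (discrete_topology {..<r}) (\<lambda>f. f e)"
      by (rule continuous_map_product_projection[OF that])
    from continuous_map_compose[OF contsnd this] show ?thesis by (simp add: o_def)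
  qed
  have flowZ: "G_flow G T Z c"
  proof (rule G_flowI)
    obtain x where "x \<in> topspace X" using nonempty by blast
    then show "topspace Z \<noteq> {}" using onto[of x] top by auto
    show "compact_space Z" unfolding Z_def
      using closedin_compact_space[OF _ closed] compC compact
      by (simp add: compact_space_prod_topology compact_space_subtopology)
    show "Hausdorff_space Z" unfolding Z_def
      by (intro Hausdorff_space_subtopology) (simp add: Hausdorff_space_prod_topology hausdorff hausC)
    show "c g \<in> extensional (topspace Z)" for g by (simp add: c_def top)
    show "c g p \<in> topspace Z" if "g \<in> carrier G" "p \<in> topspace Z" for g p
      using cW that top by simp
    show "c id p = p" if "p \<in> topspace Z" for p
    proof -
      have pW: "p \<in> W" using that top by simp
      have "(\<lambda>g\<in>carrier G. snd p g) = snd p" using inC[OF pW] by (simp add: PiE_def extensional_restrict)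
      then show ?thesis using pW inX[OF pW] by (simp add: c_def prod_eq_iff)
    qed
    show "c (g \<circ> h) p = c g (c h p)" if "g \<in> carrier G" "h \<in> carrier G" "p \<in> topspace Z" for g h p
    proof -
      have pW: "p \<in> W" using that top by simp
      have ch: "c h p = (a h (fst p), \<lambda>g\<in>carrier G. snd p (pinv h \<circ> g))" using pW by (simp add: c_def)
      have "c g (c h p) = (a g (a h (fst p)), \<lambda>k\<in>carrier G. (\<lambda>g\<in>carrier G. snd p (pinv h \<circ> g)) (pinv g \<circ> k))"
        using cW[OF that(2) pW] ch by (simp add: c_def)
      also have "\<dots> = (a (g \<circ> h) (fst p), \<lambda>k\<in>carrier G. snd p (pinv (g \<circ> h) \<circ> k))"
        using that inX[OF pW] by (auto simp: act_comp o_assoc intro!: restrict_ext)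
      also have "\<dots> = c (g \<circ> h) p" using pW by (simp add: c_def)
      finally show ?thesis by simp
    qed
    \<comment> \<open>The coordinate at \<open>g\<close> of a translate by \<open>h\<close> is the coordinate at \<open>pinv h \<circ> g\<close>, which on \<open>W\<close> depends
    only on the values of \<open>pinv h\<close> on the finite set \<open>g ` A\<close>.\<close>
    have "continuous_map (prod_topology T Z) ?P (\<lambda>(g, p). c g p)"
    proof -
      have 1: "continuous_map (prod_topology T Z) X (\<lambda>q. a (fst q) (fst (snd q)))"
      proof -
        have "continuous_map (prod_topology T Z) (prod_topology T X) (\<lambda>q. (fst q, fst (snd q)))"
          using continuous_map_compose[OF continuous_map_snd contfst, of T]
          by (simp add: continuous_map_pairwise o_def continuous_map_fst)
        from continuous_map_compose[OF this continuous_action] show ?thesis by (simp add: o_def)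
      qed
      have 2: "continuous_map (prod_topology T Z) (discrete_topology {..<r}) (\<lambda>q. snd (snd q) (pinv (fst q) \<circ> g))"
        if g: "g \<in> carrier G" for g
      proof (rule continuous_map_into_discrete)
        fix q assume "q \<in> topspace (prod_topology T Z)"
        then have q: "fst q \<in> carrier G" "snd q \<in> W" by (auto simp: top)
        have e: "pinv (fst q) \<circ> g \<in> carrier G" using q g by simp
        show "snd (snd q) (pinv (fst q) \<circ> g) \<in> {..<r}" using inC[OF q(2)] e by auto
        let ?V1 = "{h \<in> carrier G. \<forall>x\<in>g ` A. pinv h x = pinv (fst q) x}"
        let ?V2 = "{p \<in> topspace Z. snd p (pinv (fst q) \<circ> g) \<in> {snd (snd q) (pinv (fst q) \<circ> g)}}"
        have V1: "openin T ?V1" by (rule openin_T_agree_inv) (use A q in auto)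
        have V2: "openin Z ?V2"
          by (rule openin_continuous_map_preimage[OF coord[OF e]])
            (use inC[OF q(2)] e in auto)
        show "\<exists>V. openin (prod_topology T Z) V \<and> q \<in> V \<and>
            (\<forall>y\<in>V. snd (snd y) (pinv (fst y) \<circ> g) = snd (snd q) (pinv (fst q) \<circ> g))"
        proof (intro exI conjI ballI)
          show "openin (prod_topology T Z) (?V1 \<times> ?V2)" using V1 V2 by (simp add: openin_prod_Times_iff)
          show "q \<in> ?V1 \<times> ?V2" using q top by (simp add: mem_Times_iff)
          fix y assume y: "y \<in> ?V1 \<times> ?V2"
          have yW: "snd y \<in> W" using y top by auto
          have "snd (snd y) (pinv (fst y) \<circ> g) = snd (snd y) (pinv (fst q) \<circ> g)"
            by (rule cosets[OF yW]) (use y q g in auto)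
          then show "snd (snd y) (pinv (fst y) \<circ> g) = snd (snd q) (pinv (fst q) \<circ> g)" using y by auto
        qed
      qed
      have 3: "continuous_map (prod_topology T Z) ?C (\<lambda>q. \<lambda>g\<in>carrier G. snd (snd q) (pinv (fst q) \<circ> g))"
        unfolding continuous_map_componentwise using 2 by (auto intro: continuous_map_eq)
      have "continuous_map (prod_topology T Z) ?P (\<lambda>q. (a (fst q) (fst (snd q)), \<lambda>g\<in>carrier G. snd (snd q) (pinv (fst q) \<circ> g)))"
        using 1 3 by (simp add: continuous_map_pairedI)
      then show ?thesis
        by (rule continuous_map_eq) (auto simp: c_def top)
    qed
    then show "continuous_map (prod_topology T Z) Z (\<lambda>(g, p). c g p)"
      unfolding Z_def
      by (rule continuous_map_into_subtopology) (use cW top in \<open>auto simp flip: Z_def\<close>)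
  qed
  have cardX: "topspace X \<lesssim> (UNIV :: nat set set)" using compact_metrizable_lepoll[OF compact metrizable] .
  have "topspace Z \<lesssim> (UNIV :: nat set set set)"
  proof -
    obtain i :: "'x \<Rightarrow> nat set" where i: "inj_on i (topspace X)" using cardX unfolding lepoll_def by blast
    obtain k :: "((nat \<Rightarrow> nat) \<Rightarrow> nat) \<Rightarrow> nat set set" where k: "inj k"
      using lepoll_functionals unfolding lepoll_def by blast
    have "inj_on (map_prod i k) (topspace X \<times> UNIV)" by (rule map_prod_inj_on[OF i k])
    then have "inj_on (map_prod i k) W" by (rule inj_on_subset) (use inX in auto)
    then have "topspace Z \<lesssim> (UNIV :: (nat set \<times> nat set set) set)" unfolding lepoll_def top by blast
    then show ?thesis by (rule lepoll_trans[OF _ lepoll_pairs])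
  qed
  then have cardZ: "topspace Z \<lesssim> (UNIV :: 'u set)" by (rule lepoll_trans[OF _ large])
  have "(UNIV :: nat set set) \<lesssim> (UNIV :: nat set set set)"
    by (rule lepoll_if_inj[of "\<lambda>s. {s}"]) simp
  from lepoll_trans[OF lepoll_trans[OF cardX this] large]
  have cardX': "topspace X \<lesssim> (UNIV :: 'u set)" .
  have mapfst: "G_map G Z c X a fst"
    unfolding G_map_def using contfst by (simp add: c_def top)
  have ontofst: "fst ` topspace Z = topspace X"
    using onto inX by (force simp: top)
  obtain \<psi> where \<psi>: "G_map G X a Z c \<psi>" "\<And>x. x \<in> topspace X \<Longrightarrow> fst (\<psi> x) = x"
    using section_exists[OF flowZ cardX' cardZ mapfst ontofst] by blast
  have \<psi>W: "\<psi> x \<in> W" if "x \<in> topspace X" for x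
    using \<psi>(1) continuous_map_image_subset_topspace[of X Z \<psi>] that top by (auto simp: G_map_def)
  define \<gamma> where "\<gamma> x = snd (\<psi> x) id" for x
  have key: "\<gamma> (a (pinv g) x) = snd (\<psi> x) g" if g: "g \<in> carrier G" and x: "x \<in> topspace X" for g x
  proof -
    have "\<psi> (a (pinv g) x) = c (pinv g) (\<psi> x)" using \<psi>(1) g x by (simp add: G_map_def)
    then show ?thesis using g \<psi>W[OF x] by (simp add: \<gamma>_def c_def)
  qed
  show ?thesis
  proof (rule that[of \<gamma>])
    have "continuous_map X (discrete_topology {..<r}) ((\<lambda>p. snd p id) \<circ> \<psi>)"
      by (rule continuous_map_compose[OF _ coord]) (use \<psi>(1) in \<open>auto simp: G_map_def\<close>)
    then show "continuous_map X (discrete_topology {..<r}) \<gamma>" by (simp add: \<gamma>_def[abs_def] o_def)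
    fix g x assume g: "g \<in> stab A" and x: "x \<in> topspace X"
    show "\<gamma> (a g x) = \<gamma> x"
    proof -
      have gG: "g \<in> carrier G" using g by (simp add: stab_def)
      have "\<gamma> (a (pinv (pinv g)) x) = snd (\<psi> x) (pinv g)" by (rule key) (use gG x in auto)
      moreover have "snd (\<psi> x) (pinv g) = snd (\<psi> x) id"
      proof (rule cosets[of "\<psi> x" "pinv g" id])
        show "\<psi> x \<in> W" using \<psi>W[OF x] .
        show "\<forall>y\<in>A. pinv g y = id y" using inv_stab[OF g] by (simp add: stab_def)
      qed (use gG in auto)
      ultimately show ?thesis using gG by (simp add: \<gamma>_def)
    qed
  next
    fix x assume x: "x \<in> topspace X"
    show "(x, \<lambda>g\<in>carrier G. \<gamma> (a (pinv g) x)) \<in> W"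
    proof -
      have "(\<lambda>g\<in>carrier G. \<gamma> (a (pinv g) x)) = (\<lambda>g\<in>carrier G. snd (\<psi> x) g)"
        using key x by (intro restrict_ext) simp
      also have "\<dots> = snd (\<psi> x)" using inC[OF \<psi>W[OF x]] by (simp add: PiE_def extensional_restrict)
      finally have "(x, \<lambda>g\<in>carrier G. \<gamma> (a (pinv g) x)) = \<psi> x" using \<psi>(2)[OF x] by (simp add: prod_eq_iff)
      then show ?thesis using \<psi>W[OF x] by simp
    qed
  qed
qed

context flow
begin

definition invariant :: "nat set \<Rightarrow> 'x set \<Rightarrow> bool" where
  "invariant A S \<longleftrightarrow> S \<subseteq> topspace X \<and> (\<forall>g\<in>stab A. \<forall>x\<in>S. a g x \<in> S)"

definition saturation :: "nat set \<Rightarrow> 'x set \<Rightarrow> 'x set" where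
  "saturation A S = {a g x |g x. g \<in> stab A \<and> x \<in> S}"

definition clopen :: "nat set \<Rightarrow> 'x set \<Rightarrow> bool" where
  "clopen A C \<longleftrightarrow> openin X C \<and> closedin X C \<and> invariant A C"

lemma invariantD: "invariant A S \<Longrightarrow> g \<in> stab A \<Longrightarrow> x \<in> S \<Longrightarrow> a g x \<in> S"
  by (simp add: invariant_def)

lemma invariant_iff: "invariant A S \<Longrightarrow> g \<in> stab A \<Longrightarrow> x \<in> topspace X \<Longrightarrow> a g x \<in> S \<longleftrightarrow> x \<in> S"
  using invariantD[of A S g x] invariantD[of A S "pinv g" "a g x"] inv_stab[of g A] stabD(1)[of g A] by auto

lemma clopenD: "clopen A C \<Longrightarrow> openin X C" "clopen A C \<Longrightarrow> closedin X C" "clopen A C \<Longrightarrow> invariant A C"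
  by (simp_all add: clopen_def)

lemma clopen_topspace: "clopen A (topspace X)"
  by (auto simp: clopen_def invariant_def stab_def)

lemma clopen_Diff: "clopen A C \<Longrightarrow> clopen A D \<Longrightarrow> clopen A (C - D)"
proof -
  assume C: "clopen A C" and D: "clopen A D"
  have sub: "C \<subseteq> topspace X" using C by (simp add: clopen_def invariant_def)
  have "a g x \<in> C - D" if g: "g \<in> stab A" and x: "x \<in> C - D" for g x
    using invariant_iff[OF clopenD(3)[OF C] g, of x] invariant_iff[OF clopenD(3)[OF D] g, of x] x sub by blast
  then show ?thesis
    using C D sub by (auto simp: clopen_def invariant_def intro: openin_diff closedin_diff)
qed

lemma clopen_mono: "clopen A C \<Longrightarrow> A \<subseteq> B \<Longrightarrow> clopen B C"
  using stab_mono[of A B] by (auto simp: clopen_def invariant_def)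

lemma clopen_act:
  assumes "clopen A C" "g \<in> carrier G"
  shows "clopen (g ` A) (a g ` C)"
proof -
  note that = assms
  have sub: "C \<subseteq> topspace X" using that by (simp add: clopen_def openin_subset)
  have "a h y \<in> a g ` C" if h: "h \<in> stab (g ` A)" and y: "y \<in> a g ` C" for h y
  proof -
    obtain x where x: "x \<in> C" "y = a g x" using y by blast
    have hG: "h \<in> carrier G" using h by (simp add: stab_def)
    have "a (pinv g \<circ> h \<circ> g) x \<in> C"
      by (rule invariantD[OF clopenD(3)[OF assms(1)] conj_stab[OF assms(2) h] x(1)])
    moreover have "a g (a (pinv g \<circ> h \<circ> g) x) = a h y"
      using x hG \<open>g \<in> carrier G\<close> sub by (auto simp: act_comp)
    ultimately show ?thesis by (intro image_eqI[of _ _ "a (pinv g \<circ> h \<circ> g) x"]) simp_all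
  qed
  then show ?thesis
    using that openin_act closedin_act sub by (auto simp: clopen_def invariant_def)
qed

lemma saturation_sub: "S \<subseteq> topspace X \<Longrightarrow> saturation A S \<subseteq> topspace X"
  by (auto simp: saturation_def stab_def)

lemma sub_saturation: "S \<subseteq> topspace X \<Longrightarrow> S \<subseteq> saturation A S"
proof
  fix x assume "S \<subseteq> topspace X" "x \<in> S"
  then have "x = a id x" "id \<in> stab A" by auto
  then show "x \<in> saturation A S" unfolding saturation_def using \<open>x \<in> S\<close> by blast
qed

lemma saturation_invariant: "S \<subseteq> topspace X \<Longrightarrow> invariant A (saturation A S)"
  unfolding invariant_def
proof (intro conjI ballI)
  fix h y assume S: "S \<subseteq> topspace X" and h: "h \<in> stab A" and "y \<in> saturation A S"
  then obtain g x where gx: "g \<in> stab A" "x \<in> S" "y = a g x" unfolding saturation_def by blast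
  then have "a h y = a (h \<circ> g) x" using h S stabD(1) by (auto simp: act_comp)
  then show "a h y \<in> saturation A S" unfolding saturation_def using gx h comp_stab by blast
qed (rule saturation_sub)

lemma saturation_minimal: "S \<subseteq> C \<Longrightarrow> invariant A C \<Longrightarrow> saturation A S \<subseteq> C"
  by (auto simp: saturation_def invariant_def)

lemma saturation_open: "openin X S \<Longrightarrow> openin X (saturation A S)"
proof -
  assume S: "openin X S"
  have "saturation A S = (\<Union>g\<in>stab A. a g ` S)" by (auto simp: saturation_def)
  moreover have "openin X (\<Union>g\<in>stab A. a g ` S)" using S openin_act stabD(1) by blast
  ultimately show ?thesis by simp
qed

lemma closure_invariant: "invariant A S \<Longrightarrow> invariant A (X closure_of S)"
  unfolding invariant_def
proof (intro conjI ballI closure_of_subset_topspace)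
  fix g x assume S: "S \<subseteq> topspace X \<and> (\<forall>g\<in>stab A. \<forall>x\<in>S. a g x \<in> S)" and g: "g \<in> stab A" and x: "x \<in> X closure_of S"
  have "a g ` (X closure_of S) \<subseteq> X closure_of (a g ` S)"
    by (rule continuous_map_image_closure_subset[OF continuous_act[OF stabD(1)[OF g]]])
  also have "\<dots> \<subseteq> X closure_of S" by (rule closure_of_mono) (use S g in auto)
  finally show "a g x \<in> X closure_of S" using x by blast
qed

end

lemma closedin_Collect_conj:
  "closedin X {x \<in> topspace X. P x} \<Longrightarrow> closedin X {x \<in> topspace X. Q x} \<Longrightarrow>
    closedin X {x \<in> topspace X. P x \<and> Q x}"
proof -
  assume "closedin X {x \<in> topspace X. P x}" "closedin X {x \<in> topspace X. Q x}"
  then have "closedin X ({x \<in> topspace X. P x} \<inter> {x \<in> topspace X. Q x})" by (rule closedin_Int)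
  moreover have "{x \<in> topspace X. P x} \<inter> {x \<in> topspace X. Q x} = {x \<in> topspace X. P x \<and> Q x}" by blast
  ultimately show ?thesis by simp
qed

lemma closedin_Collect_ball:
  assumes "\<And>i. i \<in> I \<Longrightarrow> closedin X {x \<in> topspace X. P i x}"
  shows "closedin X {x \<in> topspace X. \<forall>i\<in>I. P i x}"
proof (cases "I = {}")
  case False
  have "{x \<in> topspace X. \<forall>i\<in>I. P i x} = (\<Inter>i\<in>I. {x \<in> topspace X. P i x})" using False by auto
  moreover have "closedin X (\<Inter>i\<in>I. {x \<in> topspace X. P i x})"
    by (intro closedin_INT False assms)
  ultimately show ?thesis by simp
qed simp

lemma closedin_Collect_imp:
  assumes "openin X {x \<in> topspace X. P x}" "closedin X {x \<in> topspace X. Q x}"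
  shows "closedin X {x \<in> topspace X. P x \<longrightarrow> Q x}"
proof -
  have "closedin X ((topspace X - {x \<in> topspace X. P x}) \<union> {x \<in> topspace X. Q x})"
    by (intro closedin_Un closedin_diff assms closedin_topspace)
  moreover have "(topspace X - {x \<in> topspace X. P x}) \<union> {x \<in> topspace X. Q x} = {x \<in> topspace X. P x \<longrightarrow> Q x}" by auto
  ultimately show ?thesis by simp
qed

text \<open>
  Let \<open>V\<close> be the complement of the closure of \<open>S\<close>. Colour the coset of \<open>g\<close> at \<open>x\<close> by 1 only if \<open>x\<close>
  is in the closure of \<open>g S\<close>, and by 0 only if \<open>x\<close> is in the closure of \<open>g V\<close>. In a continuous
  equivariant choice of such colourings, the points at which the identity has colour 1 form a clopen
  set; it contains \<open>S\<close> and is contained in the closure of \<open>S\<close>.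
\<close>

lemma (in metrizable_projective_flow) closure_open:
  assumes A: "finite A" and S: "openin X S" "invariant A S"
  shows "openin X (X closure_of S)"
proof -
  let ?C = "product_topology (\<lambda>_. discrete_topology {..<2::nat}) (carrier G)"
  let ?P = "prod_topology X ?C"
  define V where "V = topspace X - X closure_of S"
  have V: "openin X V" by (simp add: V_def openin_diff)
  have invc: "invariant A (X closure_of S)" by (rule closure_invariant[OF S(2)])
  define R where "R p g \<longleftrightarrow> (snd p g = 1 \<longrightarrow> a (pinv g) (fst p) \<in> X closure_of S) \<and>
      (snd p g = 0 \<longrightarrow> a (pinv g) (fst p) \<in> X closure_of V)"
    for p :: "'x \<times> ((nat \<Rightarrow> nat) \<Rightarrow> nat)" and g
  define W where "W = {p \<in> topspace ?P.
      (\<forall>g\<in>carrier G. \<forall>h\<in>{h \<in> carrier G. \<forall>y\<in>A. g y = h y}. snd p g = snd p h) \<and> (\<forall>g\<in>carrier G. R p g)}"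
  have coord: "continuous_map ?P (discrete_topology {..<2}) (\<lambda>p. snd p g)" if "g \<in> carrier G" for g
    using continuous_map_compose[OF continuous_map_snd continuous_map_product_projection[OF that]]
    by (simp add: o_def)
  have move: "continuous_map ?P X (\<lambda>p. a (pinv g) (fst p))" if "g \<in> carrier G" for g
    using continuous_map_compose[OF continuous_map_fst continuous_act[OF inv_in[OF that]]]
    by (simp add: o_def)
  have op: "openin ?P {p \<in> topspace ?P. snd p g = i}" if "g \<in> carrier G" "i < 2" for g i
    using openin_continuous_map_preimage[OF coord[OF that(1)], of "{i}"] that(2) by simp
  have cl: "closedin ?P {p \<in> topspace ?P. a (pinv g) (fst p) \<in> X closure_of D}" if "g \<in> carrier G" for g D
    by (rule closedin_continuous_map_preimage[OF move[OF that]]) simp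
  have e1: "closedin ?P W"
    unfolding W_def R_def
  proof (intro closedin_Collect_conj closedin_Collect_ball closedin_Collect_imp)
    fix g h assume "g \<in> carrier G" "h \<in> {h \<in> carrier G. \<forall>y\<in>A. g y = h y}"
    then show "closedin ?P {p \<in> topspace ?P. snd p g = snd p h}"
      by (intro closedin_continuous_maps_eq[OF _ coord coord]) simp_all
  next
    fix g assume g: "g \<in> carrier G"
    show "openin ?P {p \<in> topspace ?P. snd p g = 1}" "openin ?P {p \<in> topspace ?P. snd p g = 0}"
      using op[OF g] by simp_all
    show "closedin ?P {p \<in> topspace ?P. a (pinv g) (fst p) \<in> X closure_of S}"
      "closedin ?P {p \<in> topspace ?P. a (pinv g) (fst p) \<in> X closure_of V}" by (rule cl[OF g])+
  qed
  have e2: "(a h x, \<lambda>g\<in>carrier G. c (pinv h \<circ> g)) \<in> W" if xc: "(x, c) \<in> W" and h: "h \<in> carrier G" for x c h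
  proof -
    have x: "x \<in> topspace X" and c: "c \<in> carrier G \<rightarrow>\<^sub>E {..<2}" using xc by (auto simp: W_def)
    let ?c = "\<lambda>g\<in>carrier G. c (pinv h \<circ> g)"
    have m1: "R (a h x, ?c) g" if g: "g \<in> carrier G" for g
    proof -
      have hg: "pinv h \<circ> g \<in> carrier G" using g h by simp
      then have "R (x, c) (pinv h \<circ> g)" using xc by (simp add: W_def)
      moreover have "a (pinv (pinv h \<circ> g)) x = a (pinv g) (a h x)"
        using g h x by (simp add: act_comp)
      ultimately show ?thesis using g by (simp add: R_def)
    qed
    have m2: "c (pinv h \<circ> g) = c (pinv h \<circ> g')"
      if "g \<in> carrier G" "g' \<in> carrier G" "\<forall>y\<in>A. g y = g' y" for g g'
    proof -
      have "pinv h \<circ> g \<in> carrier G" "pinv h \<circ> g' \<in> {k \<in> carrier G. \<forall>y\<in>A. (pinv h \<circ> g) y = k y}"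
        using that h by auto
      then show ?thesis using xc by (simp add: W_def)
    qed
    have m3: "?c \<in> carrier G \<rightarrow>\<^sub>E {..<2}"
    proof (rule restrict_PiE_iff[THEN iffD2], rule ballI)
      fix g assume "g \<in> carrier G"
      then have "pinv h \<circ> g \<in> carrier G" using h by simp
      then show "c (pinv h \<circ> g) \<in> {..<2}" by (rule PiE_mem[OF c])
    qed
    show ?thesis
      unfolding W_def
    proof (intro CollectI conjI ballI)
      show "(a h x, ?c) \<in> topspace ?P" using m3 act_in[OF h x] by simp
      fix g assume g: "g \<in> carrier G"
      show "R (a h x, ?c) g" by (rule m1[OF g])
      fix g' assume "g' \<in> {h \<in> carrier G. \<forall>y\<in>A. g y = h y}"
      then have g': "g' \<in> carrier G" "\<forall>y\<in>A. g y = g' y" by simp_all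
      show "snd (a h x, ?c) g = snd (a h x, ?c) g'"
        using m2[OF g g'] by (simp only: snd_conv restrict_apply' g g')
    qed
  qed
  have e3: "snd p g = snd p h" if p: "p \<in> W" and g: "g \<in> carrier G" and h: "h \<in> carrier G" "\<forall>y\<in>A. g y = h y" for p g h
  proof -
    have "\<forall>g\<in>carrier G. \<forall>h\<in>{h \<in> carrier G. \<forall>y\<in>A. g y = h y}. snd p g = snd p h" using p unfolding W_def by blast
    then show ?thesis using g h by blast
  qed
  have e4: "\<exists>c. (x, c) \<in> W" if x: "x \<in> topspace X" for x
  proof -
    define c where "c = (\<lambda>g\<in>carrier G. if a (pinv g) x \<in> X closure_of S then 1 else 0 :: nat)"
    have m1: "R (x, c) g" if g: "g \<in> carrier G" for g
    proof -
      have "a (pinv g) x \<in> X closure_of V" if "a (pinv g) x \<notin> X closure_of S"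
        using that g x closure_of_subset[of V X] by (auto simp: V_def)
      then show ?thesis using g by (simp add: R_def c_def)
    qed
    have m2: "c g = c h" if gh: "g \<in> carrier G" "h \<in> carrier G" "\<forall>y\<in>A. g y = h y" for g h
    proof -
      have st: "pinv h \<circ> g \<in> stab A" using gh by (simp add: stab_def)
      have "a (pinv h) x = a (pinv h \<circ> g) (a (pinv g) x)" using gh x by (simp add: act_comp)
      then have "a (pinv h) x \<in> X closure_of S \<longleftrightarrow> a (pinv g) x \<in> X closure_of S"
        using invariant_iff[OF invc st, of "a (pinv g) x"] gh x by simp
      then show ?thesis using gh by (simp add: c_def)
    qed
    have m3: "c \<in> carrier G \<rightarrow>\<^sub>E {..<2}" by (simp add: c_def)
    have "(x, c) \<in> W"
      unfolding W_def
    proof (intro CollectI conjI ballI)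
      show "(x, c) \<in> topspace ?P" using m3 x by simp
      fix g assume g: "g \<in> carrier G"
      show "R (x, c) g" by (rule m1[OF g])
      fix g' assume "g' \<in> {h \<in> carrier G. \<forall>y\<in>A. g y = h y}"
      then have g': "g' \<in> carrier G" "\<forall>y\<in>A. g y = g' y" by simp_all
      show "snd (x, c) g = snd (x, c) g'"
        using m2[OF g g'] by (simp only: snd_conv)
    qed
    then show ?thesis by blast
  qed
  obtain \<gamma> where \<gamma>: "continuous_map X (discrete_topology {..<2::nat}) \<gamma>"
    "\<And>x. x \<in> topspace X \<Longrightarrow> (x, \<lambda>g\<in>carrier G. \<gamma> (a (pinv g) x)) \<in> W"
    by (rule equivariant_selection[OF A e1 e2 e3 e4]) blast+
  have R\<gamma>: "(\<gamma> x = 1 \<longrightarrow> x \<in> X closure_of S) \<and> (\<gamma> x = 0 \<longrightarrow> x \<in> X closure_of V)" if "x \<in> topspace X" for x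
  proof -
    have "R (x, \<lambda>g\<in>carrier G. \<gamma> (a (pinv g) x)) id" using \<gamma>(2)[OF that] by (simp add: W_def)
    moreover have "pinv (id :: nat \<Rightarrow> nat) = id" by simp
    ultimately show ?thesis using that by (simp add: R_def del: inv_id)
  qed
  have \<gamma>2: "\<gamma> x < 2" if "x \<in> topspace X" for x
    using continuous_map_image_subset_topspace[OF \<gamma>(1)] that by auto
  have clop: "closedin X {x \<in> topspace X. \<gamma> x \<in> {1}}" "openin X {x \<in> topspace X. \<gamma> x \<in> {1}}"
    using closedin_continuous_map_preimage[OF \<gamma>(1), of "{1}"] openin_continuous_map_preimage[OF \<gamma>(1), of "{1}"] by simp_all
  have "S \<subseteq> {x \<in> topspace X. \<gamma> x \<in> {1}}"
  proof
    fix x assume x: "x \<in> S"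
    then have xX: "x \<in> topspace X" using openin_subset[OF S(1)] by blast
    have "S \<inter> V = {}" using closure_of_subset[OF openin_subset[OF S(1)]] by (auto simp: V_def)
    then have "S \<inter> X closure_of V = {}" using openin_Int_closure_of_eq_empty[OF S(1)] by simp
    then have "\<gamma> x \<noteq> 0" using R\<gamma>[OF xX] x by blast
    then show "x \<in> {x \<in> topspace X. \<gamma> x \<in> {1}}" using \<gamma>2[OF xX] xX by simp
  qed
  then have "X closure_of S \<subseteq> {x \<in> topspace X. \<gamma> x \<in> {1}}" using clop(1) closure_of_minimal by blast
  moreover have "{x \<in> topspace X. \<gamma> x \<in> {1}} \<subseteq> X closure_of S" using R\<gamma> by blast
  ultimately show ?thesis using clop(2) by (simp add: subset_antisym)
qed

context metrizable_projective_flow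
begin

lemma closure_clopen: "finite A \<Longrightarrow> openin X S \<Longrightarrow> invariant A S \<Longrightarrow> clopen A (X closure_of S)"
  using closure_open closure_invariant by (simp add: clopen_def)

definition cell :: "nat set \<Rightarrow> 'x \<Rightarrow> 'x set" where
  "cell A x = \<Inter> {C. clopen A C \<and> x \<in> C}"

lemma cell_self: "x \<in> cell A x"
  by (simp add: cell_def)

lemma cell_minimal: "clopen A C \<Longrightarrow> x \<in> C \<Longrightarrow> cell A x \<subseteq> C"
  by (auto simp: cell_def)

lemma cell_subset: "x \<in> topspace X \<Longrightarrow> cell A x \<subseteq> topspace X"
  using cell_minimal clopen_topspace by blast

text \<open>
  The sets \<open>P n\<close>, the closures of the saturations of balls around \<open>x\<close>, form a decreasing sequence of
  clopen invariant sets. Were it not eventually constant, its differences of even and of odd index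
  would have disjoint open unions, with disjoint closures by extremal disconnectedness; but \<open>x\<close> lies
  in both closures, because each difference meets the ball it belongs to.
\<close>

lemma cell_clopen:
  assumes A: "finite A" and x: "x \<in> topspace X"
  shows "clopen A (cell A x)"
proof -
  obtain M d where M: "Metric_space M d" and X: "X = Metric_space.mtopology M d"
    using metrizable unfolding metrizable_space_def by blast
  interpret MS: Metric_space M d by (rule M)
  have top: "topspace X = M" by (simp add: X)
  define ball where "ball n = MS.mball x (1 / real (Suc n))" for n
  have b_open: "openin X (ball n)" for n by (simp add: ball_def X)
  have b_sub: "ball n \<subseteq> topspace X" for n by (rule openin_subset[OF b_open])
  have b_x: "x \<in> ball n" for n using x top by (simp add: ball_def)
  have b_mono: "ball n \<subseteq> ball m" if "m \<le> n" for m n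
    unfolding ball_def by (rule MS.mball_subset_concentric) (use that in \<open>simp add: frac_le\<close>)
  have b_base: "\<exists>n. ball n \<subseteq> U" if U: "openin X U" "x \<in> U" for U
  proof -
    have "openin MS.mtopology U" using U(1) by (simp only: X)
    then obtain r where r: "r > 0" "MS.mball x r \<subseteq> U" using U(2) MS.openin_mtopology by meson
    obtain n where "1 / real (Suc n) < r" using nat_approx_posE[OF r(1)] by blast
    then have "ball n \<subseteq> MS.mball x r" unfolding ball_def by (intro MS.mball_subset_concentric) simp
    then show ?thesis using r(2) by blast
  qed
  define P where "P n = X closure_of (saturation A (ball n))" for n
  have P_clopen: "clopen A (P n)" for n
    unfolding P_def by (rule closure_clopen[OF A saturation_open[OF b_open] saturation_invariant[OF b_sub]])
  have P_ball: "ball n \<subseteq> P n" for n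
    unfolding P_def using sub_saturation[OF b_sub, of n A] closure_of_subset[OF saturation_sub[OF b_sub]] by blast
  have P_mono: "P n \<subseteq> P m" if "m \<le> n" for m n
    unfolding P_def using b_mono[OF that] by (intro closure_of_mono) (auto simp: saturation_def)
  have "\<exists>n. \<forall>m>n. P m = P n"
  proof (rule ccontr)
    assume "\<not> (\<exists>n. \<forall>m>n. P m = P n)"
    then obtain f where f: "\<And>n. n < f n" "\<And>n. P (f n) \<noteq> P n" by metis
    define s where "s k = (f ^^ k) 0" for k
    have sS: "s (Suc k) = f (s k)" for k by (simp add: s_def)
    have s_mono: "strict_mono s" using f(1) by (simp add: strict_mono_Suc_iff sS)
    define D where "D k = P (s k) - P (s (Suc k))" for k
    have D_clopen: "clopen A (D k)" for k unfolding D_def by (rule clopen_Diff[OF P_clopen P_clopen])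
    have D_ne: "D k \<noteq> {}" for k
    proof -
      have "P (s (Suc k)) \<subseteq> P (s k)" using P_mono strict_mono_less_eq[OF s_mono] by simp
      moreover have "P (s (Suc k)) \<noteq> P (s k)" using f(2) sS by simp
      ultimately show ?thesis unfolding D_def by blast
    qed
    have D_disj: "D j \<inter> D k = {}" if "j < k" for j k
    proof -
      have "P (s k) \<subseteq> P (s (Suc j))" using P_mono strict_mono_less_eq[OF s_mono] that by simp
      then show ?thesis unfolding D_def by blast
    qed
    define E where "E b = \<Union> (D ` {k. even k = b})" for b
    have E_open: "openin X (E b)" for b unfolding E_def using D_clopen clopenD(1) by blast
    have E_inv: "invariant A (E b)" for b
      using D_clopen unfolding E_def clopen_def invariant_def by blast
    have x_E: "x \<in> X closure_of (E b)" for b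
      unfolding in_closure_of
    proof (intro conjI allI impI x)
      fix U assume "x \<in> U \<and> openin X U"
      then obtain n where n: "ball n \<subseteq> U" using b_base by blast
      \<comment> \<open>The index \<open>k\<close> has the parity selected by \<open>b\<close> and is large enough for \<open>ball (s k)\<close> to lie in \<open>U\<close>.\<close>
      define k where "k = (if b then 2 * n else 2 * n + 1)"
      have k: "n \<le> k" "even k = b" by (auto simp: k_def)
      have "D k \<inter> X closure_of (saturation A (ball (s k))) \<noteq> {}"
        using D_ne[of k] unfolding D_def P_def by blast
      then have "D k \<inter> saturation A (ball (s k)) \<noteq> {}"
        using openin_Int_closure_of_eq_empty[OF clopenD(1)[OF D_clopen]] by blast
      then obtain g y where gy: "g \<in> stab A" "y \<in> ball (s k)" "a g y \<in> D k"
        unfolding saturation_def by blast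
      have "y \<in> D k"
        using invariant_iff[OF clopenD(3)[OF D_clopen] gy(1), of y k] gy b_sub by blast
      then have "y \<in> E b" unfolding E_def using k(2) by blast
      moreover have "n \<le> s k" using k(1) strict_mono_imp_increasing[OF s_mono, of k] by simp
      then have "y \<in> U" using gy(2) b_mono n by blast
      ultimately show "\<exists>y. y \<in> E b \<and> y \<in> U" by blast
    qed
    have "openin X (X closure_of (E True))" by (rule closure_open[OF A E_open E_inv])
    moreover have "X closure_of (E True) \<inter> X closure_of (E False) \<noteq> {}" using x_E by blast
    ultimately have "X closure_of (E True) \<inter> E False \<noteq> {}" using openin_Int_closure_of_eq_empty by blast
    then have "E False \<inter> E True \<noteq> {}"
      using openin_Int_closure_of_eq_empty[OF E_open[of False], of "E True"] by blast
    then obtain y j k where "even j" "odd k" "y \<in> D j" "y \<in> D k" unfolding E_def by auto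
    then show False using D_disj[of j k] D_disj[of k j] by (metis IntI empty_iff linorder_neqE_nat)
  qed
  then obtain n where n: "\<And>m. m > n \<Longrightarrow> P m = P n" by blast
  have "P n \<subseteq> C" if C: "clopen A C" "x \<in> C" for C
  proof -
    obtain m where m: "ball m \<subseteq> C" using b_base C clopenD(1) by blast
    have "saturation A (ball (max m (Suc n))) \<subseteq> C"
      by (rule saturation_minimal[OF _ clopenD(3)[OF C(1)]]) (use m b_mono[of m "max m (Suc n)"] in auto)
    then have "P (max m (Suc n)) \<subseteq> C" unfolding P_def using clopenD(2)[OF C(1)] closure_of_minimal by blast
    then show ?thesis using n[of "max m (Suc n)"] by simp
  qed
  moreover have "x \<in> P n" using b_x P_ball by blast
  ultimately have "cell A x = P n" unfolding cell_def using P_clopen by blast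
  then show ?thesis using P_clopen by simp
qed

lemma cell_eq:
  assumes A: "finite A" and x: "x \<in> topspace X" and y: "y \<in> cell A x"
  shows "cell A y = cell A x"
proof
  have yX: "y \<in> topspace X" using cell_subset[OF x] y by blast
  show "cell A y \<subseteq> cell A x" using cell_minimal[OF cell_clopen[OF A x] y] .
  have "x \<in> cell A y"
  proof (rule ccontr)
    assume "x \<notin> cell A y"
    then have "cell A x \<subseteq> cell A x - cell A y"
      using cell_minimal[OF clopen_Diff[OF cell_clopen[OF A x] cell_clopen[OF A yX]]] cell_self by blast
    then show False using y cell_self by blast
  qed
  then show "cell A x \<subseteq> cell A y" using cell_minimal[OF cell_clopen[OF A yX]] by blast
qed

lemma cell_mono: "finite A \<Longrightarrow> x \<in> topspace X \<Longrightarrow> A \<subseteq> B \<Longrightarrow> cell B x \<subseteq> cell A x"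
  using cell_minimal[OF clopen_mono[OF cell_clopen]] cell_self by blast

lemma cell_eq_mono:
  assumes "finite A" "finite B" "A \<subseteq> B" "x \<in> topspace X" "y \<in> topspace X" "cell B x = cell B y"
  shows "cell A x = cell A y"
  using cell_eq[of A y x] cell_mono[of A y B] cell_self[of x B] assms by blast

lemma cell_act:
  assumes A: "finite A" and x: "x \<in> topspace X" and g: "g \<in> carrier G"
  shows "cell (g ` A) (a g x) = a g ` cell A x"
proof
  show "cell (g ` A) (a g x) \<subseteq> a g ` cell A x"
    by (rule cell_minimal[OF clopen_act[OF cell_clopen[OF A x] g]]) (use cell_self in blast)
  have ig: "pinv g \<in> carrier G" using g by simp
  have gx: "a g x \<in> topspace X" using g x by simp
  have "cell A x \<subseteq> a (pinv g) ` cell (g ` A) (a g x)"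
  proof (rule cell_minimal)
    have "clopen (pinv g ` g ` A) (a (pinv g) ` cell (g ` A) (a g x))"
      by (rule clopen_act[OF cell_clopen[OF _ gx] ig]) (use A in simp)
    moreover have "pinv g ` g ` A = A" using g by (simp add: image_image)
    ultimately show "clopen A (a (pinv g) ` cell (g ` A) (a g x))" by simp
    show "x \<in> a (pinv g) ` cell (g ` A) (a g x)"
      by (rule image_eqI[of _ _ "a g x"]) (use g x cell_self in auto)
  qed
  then have "a g ` cell A x \<subseteq> a g ` a (pinv g) ` cell (g ` A) (a g x)" by blast
  also have "\<dots> = (\<lambda>y. y) ` cell (g ` A) (a g x)"
    unfolding image_image
    by (rule image_cong[OF refl], rule act_inv_r[OF g subsetD[OF cell_subset[OF gx]]])
  finally show "a g ` cell A x \<subseteq> cell (g ` A) (a g x)" by simp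
qed

lemma finite_cells: assumes A: "finite A" shows "finite (cell A ` topspace X)"
proof -
  have "\<forall>U\<in>cell A ` topspace X. openin X U" using cell_clopen[OF A] clopenD(1) by blast
  moreover have "topspace X \<subseteq> \<Union>(cell A ` topspace X)" using cell_self by blast
  ultimately obtain \<F> where \<F>: "finite \<F>" "\<F> \<subseteq> cell A ` topspace X" "topspace X \<subseteq> \<Union>\<F>"
    using compact unfolding compact_space_alt by metis
  have "cell A x \<in> \<F>" if x: "x \<in> topspace X" for x
  proof -
    obtain C where C: "C \<in> \<F>" "x \<in> C" using \<F>(3) x by blast
    obtain y where y: "y \<in> topspace X" "C = cell A y" using \<F>(2) C(1) by blast
    have "cell A x = C" using cell_eq[OF A y(1), of x] C(2) y(2) by simp
    then show ?thesis using C(1) by simp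
  qed
  then have "cell A ` topspace X \<subseteq> \<F>" by (rule image_subsetI)
  then show ?thesis by (rule finite_subset[OF _ \<F>(1)])
qed

lemma finite_clopens: assumes A: "finite A" shows "finite {C. clopen A C}"
proof (rule finite_subset)
  show "{C. clopen A C} \<subseteq> Union ` Pow (cell A ` topspace X)"
  proof
    fix C assume "C \<in> {C. clopen A C}"
    then have C: "clopen A C" by simp
    have sub: "C \<subseteq> topspace X" using openin_subset[OF clopenD(1)[OF C]] .
    have "C = \<Union> (cell A ` C)"
    proof
      show "C \<subseteq> \<Union> (cell A ` C)" using cell_self by (intro subsetI UN_I)
      show "\<Union> (cell A ` C) \<subseteq> C" by (intro UN_least cell_minimal[OF C])
    qed
    moreover have "cell A ` C \<in> Pow (cell A ` topspace X)" using sub by (simp add: image_mono)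
    ultimately show "C \<in> Union ` Pow (cell A ` topspace X)" by (rule image_eqI)
  qed
  show "finite (Union ` Pow (cell A ` topspace X))" using finite_cells[OF A] by simp
qed

text \<open>
  If \<open>stab A\<close> moves a neighbourhood of \<open>x\<close> within a set disjoint from a neighbourhood of \<open>y\<close>, then the
  closure of the saturation of the former is a clopen invariant set that omits \<open>y\<close>.
\<close>

lemma cells_separate:
  assumes x: "x \<in> topspace X" and y: "y \<in> topspace X" and ne: "x \<noteq> y"
  shows "\<exists>A. finite A \<and> y \<notin> cell A x"
proof -
  obtain U V where UV: "openin X U" "openin X V" "x \<in> U" "y \<in> V" "disjnt U V"
    using hausdorff x y ne unfolding Hausdorff_space_def by metis
  obtain A N where A: "finite A" "openin X N" "x \<in> N"
    "\<And>g z. g \<in> carrier G \<Longrightarrow> \<forall>i\<in>A. g i = id i \<Longrightarrow> z \<in> N \<Longrightarrow> a g z \<in> U"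
    using act_nbhd[of U id x] UV x by auto
  have N: "N \<subseteq> topspace X" using A(2) openin_subset by blast
  have "saturation A N \<subseteq> U" using A(4) by (auto simp: saturation_def stab_def)
  then have "V \<inter> saturation A N = {}" using UV(5) by (auto simp: disjnt_def)
  then have "V \<inter> X closure_of (saturation A N) = {}" using openin_Int_closure_of_eq_empty[OF UV(2)] by simp
  moreover have "cell A x \<subseteq> X closure_of (saturation A N)"
    by (rule cell_minimal[OF closure_clopen[OF A(1) saturation_open[OF A(2)] saturation_invariant[OF N]]])
      (use sub_saturation[OF N, of A] closure_of_subset[OF saturation_sub[OF N]] A(3) in blast)
  ultimately have "y \<notin> cell A x" using UV(4) by blast
  then show ?thesis using A(1) by blast
qed

lemma dense_in_cell:
  assumes A: "finite A" and x: "x \<in> topspace X" and S: "openin X S" "invariant A S" "S \<noteq> {}" "S \<subseteq> cell A x"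
  shows "X closure_of S = cell A x"
proof
  show "X closure_of S \<subseteq> cell A x" using S(4) clopenD(2)[OF cell_clopen[OF A x]] closure_of_minimal by blast
  obtain y where y: "y \<in> S" using S(3) by blast
  then have "y \<in> X closure_of S" using closure_of_subset[OF openin_subset[OF S(1)]] by blast
  then have "cell A y \<subseteq> X closure_of S" by (rule cell_minimal[OF closure_clopen[OF A S(1,2)]])
  then show "cell A x \<subseteq> X closure_of S" using cell_eq[OF A x] y S(4) by blast
qed

text \<open>
  Each requirement on the generic point holds on a dense open set, since the nonempty invariant
  open subsets of a cell are dense in it; there are countably many requirements, because cells are finite in number.
\<close>

lemma generic_point_exists:
  assumes trans: "topologically_transitive G X a"
  obtains x0 where "x0 \<in> topspace X"
    "\<And>A B y. finite A \<Longrightarrow> finite B \<Longrightarrow> A \<subseteq> B \<Longrightarrow> y \<in> cell A x0 \<Longrightarrow> \<exists>g\<in>stab A. a g x0 \<in> cell B y"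
    "\<And>A y. finite A \<Longrightarrow> y \<in> topspace X \<Longrightarrow> \<exists>g\<in>carrier G. a g x0 \<in> cell A y"
proof -
  define D where "D A p = (topspace X - fst p) \<union> saturation A (snd p)" for A and p :: "'x set \<times> 'x set"
  define \<D> where "\<D> = (\<Union>A\<in>Collect finite. \<Union>B\<in>{B. finite B \<and> A \<subseteq> B}. (\<lambda>y. D A (cell A y, cell B y)) ` topspace X)"
  define \<E> where "\<E> = (\<Union>A\<in>Collect finite. (\<lambda>y. saturation {} (cell A y)) ` topspace X)"
  have cf: "countable (Collect finite :: nat set set)" using countable_Collect_finite .
  have "countable \<D>"
    unfolding \<D>_def
  proof (intro countable_UN cf)
    fix A :: "nat set"
    show "countable {B. finite B \<and> A \<subseteq> B}" by (rule countable_subset[OF _ cf]) auto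
    fix B assume A: "A \<in> Collect finite" and B: "B \<in> {B. finite B \<and> A \<subseteq> B}"
    have "finite (D A ` (cell A ` topspace X \<times> cell B ` topspace X))"
      using finite_cells A B by simp
    then have "finite ((\<lambda>y. D A (cell A y, cell B y)) ` topspace X)"
      by (rule rev_finite_subset) auto
    then show "countable ((\<lambda>y. D A (cell A y, cell B y)) ` topspace X)" by (rule countable_finite)
  qed
  moreover have "countable \<E>"
    unfolding \<E>_def
  proof (intro countable_UN cf)
    fix A :: "nat set" assume A: "A \<in> Collect finite"
    have "finite (saturation {} ` cell A ` topspace X)" using finite_cells A by simp
    then show "countable ((\<lambda>y. saturation {} (cell A y)) ` topspace X)"
      by (simp add: image_image countable_finite)
  qed
  ultimately have count: "countable (\<D> \<union> \<E>)" by simp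
  have D_dense: "openin X (D A (cell A y, cell B y)) \<and> X closure_of (D A (cell A y, cell B y)) = topspace X"
    if AB: "finite A" "finite B" "A \<subseteq> B" and y: "y \<in> topspace X" for A B y
  proof
    have subB: "cell B y \<subseteq> topspace X" using cell_subset[OF y] .
    have so: "openin X (saturation A (cell B y))" using saturation_open[OF clopenD(1)[OF cell_clopen[OF AB(2) y]]] .
    show "openin X (D A (cell A y, cell B y))"
      unfolding D_def using so clopenD(2)[OF cell_clopen[OF AB(1) y]] by (auto simp: closedin_def)
    have "X closure_of (saturation A (cell B y)) = cell A y"
    proof (rule dense_in_cell[OF AB(1) y so saturation_invariant[OF subB]])
      show "saturation A (cell B y) \<noteq> {}" using sub_saturation[OF subB] cell_self by blast
      show "saturation A (cell B y) \<subseteq> cell A y"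
        by (rule saturation_minimal[OF cell_mono[OF AB(1) y AB(3)] clopenD(3)[OF cell_clopen[OF AB(1) y]]])
    qed
    then show "X closure_of (D A (cell A y, cell B y)) = topspace X"
      using closure_of_subset[of "topspace X - cell A y" X] closure_of_subset_topspace[of X]
      by (auto simp: D_def closure_of_Un)
  qed
  have E_dense: "openin X (saturation {} (cell A y)) \<and> X closure_of (saturation {} (cell A y)) = topspace X"
    if A: "finite A" and y: "y \<in> topspace X" for A y
  proof
    have sub: "cell A y \<subseteq> topspace X" using cell_subset[OF y] .
    have opn: "openin X (cell A y)" using clopenD(1)[OF cell_clopen[OF A y]] .
    show "openin X (saturation {} (cell A y))" using saturation_open[OF opn] .
    have "x \<in> X closure_of (saturation {} (cell A y))" if x: "x \<in> topspace X" for x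
      unfolding in_closure_of
    proof (intro conjI allI impI x)
      fix U assume U: "x \<in> U \<and> openin X U"
      then obtain g where g: "g \<in> carrier G" "a g ` cell A y \<inter> U \<noteq> {}"
        using trans[unfolded topologically_transitive_def, rule_format, of "cell A y" U] opn cell_self by blast
      then obtain z where "z \<in> cell A y" "a g z \<in> U" by blast
      moreover have "g \<in> stab {}" using g by (simp add: stab_def)
      ultimately show "\<exists>y'. y' \<in> saturation {} (cell A y) \<and> y' \<in> U" unfolding saturation_def by blast
    qed
    then have "topspace X \<subseteq> X closure_of (saturation {} (cell A y))" by (rule subsetI)
    then show "X closure_of (saturation {} (cell A y)) = topspace X"
      by (rule subset_antisym[OF closure_of_subset_topspace])
  qed
  have all: "openin X S \<and> X closure_of S = topspace X" if S: "S \<in> \<D> \<union> \<E>" for S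
    using S
  proof
    assume "S \<in> \<D>"
    then obtain A B y where "finite A" "finite B" "A \<subseteq> B" "y \<in> topspace X" "S = D A (cell A y, cell B y)"
      unfolding \<D>_def by auto
    then show ?thesis using D_dense by simp
  next
    assume "S \<in> \<E>"
    then obtain A y where "finite A" "y \<in> topspace X" "S = saturation {} (cell A y)"
      unfolding \<E>_def by auto
    then show ?thesis using E_dense by simp
  qed
  have "locally_compact_space X" using compact by (rule compact_imp_locally_compact_space)
  then have dense: "X closure_of \<Inter>(\<D> \<union> \<E>) = topspace X"
    using hausdorff compact_Hausdorff_imp_regular_space[OF compact hausdorff]
    by (intro Baire_category count all) simp_all
  obtain x where "x \<in> X closure_of \<Inter>(\<D> \<union> \<E>)" using nonempty dense by blast
  then obtain x0 where x0in: "x0 \<in> \<Inter>(\<D> \<union> \<E>)" "x0 \<in> topspace X"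
    using openin_topspace[of X] unfolding in_closure_of by blast
  note x0 = x0in(2) InterD[OF x0in(1)]
  have hit: "\<exists>g\<in>stab A. a g x0 \<in> S" if S: "x0 \<in> saturation A S" "S \<subseteq> topspace X" for A S
  proof -
    obtain g z where gz: "g \<in> stab A" "z \<in> S" "x0 = a g z" using S unfolding saturation_def by blast
    then have "a (pinv g) x0 = z" using S(2) stabD(1) by auto
    then show ?thesis using inv_stab[OF gz(1)] gz(2) by blast
  qed
  show ?thesis
  proof (rule that[OF x0(1)])
    fix A B y assume AB: "finite A" "finite B" "A \<subseteq> B" and y: "y \<in> cell A x0"
    have yX: "y \<in> topspace X" using y cell_subset[OF x0(1)] by blast
    have "D A (cell A y, cell B y) \<in> \<D> \<union> \<E>" unfolding \<D>_def using AB yX by auto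
    then have "x0 \<in> D A (cell A y, cell B y)" by (rule x0(2))
    moreover have "x0 \<in> cell A y" using cell_eq[OF AB(1) x0(1) y] cell_self by blast
    ultimately have "x0 \<in> saturation A (cell B y)" by (simp add: D_def)
    then show "\<exists>g\<in>stab A. a g x0 \<in> cell B y" by (rule hit[OF _ cell_subset[OF yX]])
  next
    fix A y assume A: "finite (A :: nat set)" and y: "y \<in> topspace X"
    have "saturation {} (cell A y) \<in> \<D> \<union> \<E>" unfolding \<E>_def using A y by auto
    then have "x0 \<in> saturation {} (cell A y)" by (rule x0(2))
    then obtain g where "g \<in> stab {}" "a g x0 \<in> cell A y" using hit[OF _ cell_subset[OF y]] by blast
    then show "\<exists>g\<in>carrier G. a g x0 \<in> cell A y" using stabD(1) by blast
  qed
qed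

end

section \<open>Structures, embeddings and back-and-forth\<close>

text \<open>
  \<open>I\<close> is a system of finite partial maps, each given by its domain and a function; the limit map is
  the union of an increasing chain of members of \<open>I\<close>.
\<close>

lemma back_and_forth:
  fixes I :: "('a set \<times> ('a \<Rightarrow> 'b)) set"
  assumes U: "countable U" "U \<noteq> {}" and V: "countable V" "V \<noteq> {}"
    and forth: "\<And>p u. p \<in> I \<Longrightarrow> u \<in> U \<Longrightarrow>
      \<exists>q\<in>I. fst p \<subseteq> fst q \<and> u \<in> fst q \<and> (\<forall>x\<in>fst p. snd q x = snd p x)"
    and backward: "\<And>p v. p \<in> I \<Longrightarrow> v \<in> V \<Longrightarrow>
      \<exists>q\<in>I. fst p \<subseteq> fst q \<and> v \<in> snd q ` fst q \<and> (\<forall>x\<in>fst p. snd q x = snd p x)"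
    and start: "p0 \<in> I"
  obtains f where "\<And>x. x \<in> fst p0 \<Longrightarrow> f x = snd p0 x"
    "\<And>S. finite S \<Longrightarrow> S \<subseteq> U \<Longrightarrow> \<exists>q\<in>I. S \<subseteq> fst q \<and> (\<forall>x\<in>fst q. f x = snd q x)"
    "\<And>v. v \<in> V \<Longrightarrow> \<exists>q\<in>I. v \<in> snd q ` fst q \<and> (\<forall>x\<in>fst q. f x = snd q x)"
proof -
  let ?u = "from_nat_into U" and ?v = "from_nat_into V"
  let ?Q = "\<lambda>n p q. fst p \<subseteq> fst q \<and> ?u n \<in> fst q \<and> ?v n \<in> snd q ` fst q \<and> (\<forall>x\<in>fst p. snd q x = snd p x)"
  have "\<exists>s. \<forall>n. (s n \<in> I \<and> (n = 0 \<longrightarrow> s n = p0)) \<and> ?Q n (s n) (s (Suc n))"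
  proof (rule dependent_nat_choice)
    show "\<exists>x. x \<in> I \<and> (0 = 0 \<longrightarrow> x = p0)" using start by blast
    fix p :: "'a set \<times> ('a \<Rightarrow> 'b)" and n :: nat assume "p \<in> I \<and> (n = 0 \<longrightarrow> p = p0)"
    then have p: "p \<in> I" by simp
    obtain q where q: "q \<in> I" "fst p \<subseteq> fst q" "?u n \<in> fst q" "\<forall>x\<in>fst p. snd q x = snd p x"
      using forth[OF p from_nat_into[OF U(2)], of n] by auto
    obtain r where r: "r \<in> I" "fst q \<subseteq> fst r" "?v n \<in> snd r ` fst r" "\<forall>x\<in>fst q. snd r x = snd q x"
      using backward[OF q(1) from_nat_into[OF V(2)], of n] by auto
    have "?Q n p r" using q r by auto
    then show "\<exists>y. (y \<in> I \<and> (Suc n = 0 \<longrightarrow> y = p0)) \<and> ?Q n p y"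
      using r(1) by (intro exI[of _ r]) simp
  qed
  then obtain s where sQ: "\<forall>n. (s n \<in> I \<and> (n = 0 \<longrightarrow> s n = p0)) \<and> ?Q n (s n) (s (Suc n))" by (rule exE)
  then have s: "s n \<in> I" "s 0 = p0" and Q: "?Q n (s n) (s (Suc n))" for n by simp_all
  have mono: "fst (s m) \<subseteq> fst (s n) \<and> (\<forall>x\<in>fst (s m). snd (s n) x = snd (s m) x)" if "m \<le> n" for m n
    using that
  proof (induction rule: dec_induct)
    case (step n)
    then show ?case using Q[of n] by auto
  qed simp
  define f where "f x = snd (s (LEAST n. x \<in> fst (s n))) x" for x
  have f: "f x = snd (s n) x" if x: "x \<in> fst (s n)" for x n
  proof -
    have "(LEAST n. x \<in> fst (s n)) \<le> n" using x by (rule Least_le)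
    moreover have "x \<in> fst (s (LEAST n. x \<in> fst (s n)))" by (rule LeastI[where P = "\<lambda>n. x \<in> fst (s n)", OF x])
    ultimately show ?thesis using mono unfolding f_def by metis
  qed
  show ?thesis
  proof (rule that)
    show "f x = snd p0 x" if "x \<in> fst p0" for x using f[of x 0] that s(2) by simp
  next
    fix S assume "finite S" "S \<subseteq> U"
    then have "\<exists>n. S \<subseteq> fst (s n)"
    proof (induction rule: finite_induct)
      case (insert x S)
      then obtain n where n: "S \<subseteq> fst (s n)" by auto
      obtain k where k: "?u k = x" using from_nat_into_surj[OF U(1)] insert.prems by auto
      have "x \<in> fst (s (Suc k))" using Q[of k] k by auto
      then have "insert x S \<subseteq> fst (s (max n (Suc k)))"
        using n mono[of n "max n (Suc k)"] mono[of "Suc k" "max n (Suc k)"] by auto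
      then show ?case by blast
    qed simp
    then obtain n where "S \<subseteq> fst (s n)" by blast
    then show "\<exists>q\<in>I. S \<subseteq> fst q \<and> (\<forall>x\<in>fst q. f x = snd q x)" using s(1) f by (intro bexI[of _ "s n"]) auto
  next
    fix v assume "v \<in> V"
    then obtain k where k: "?v k = v" using from_nat_into_surj[OF V(1)] by auto
    then have "v \<in> snd (s (Suc k)) ` fst (s (Suc k))" using Q[of k] by auto
    then show "\<exists>q\<in>I. v \<in> snd q ` fst q \<and> (\<forall>x\<in>fst q. f x = snd q x)"
      using s(1) f by (intro bexI[of _ "s (Suc k)"]) auto
  qed
qed

lemma mem_tuples: "xs \<in> tuples A n \<longleftrightarrow> length xs = n \<and> set xs \<subseteq> A"
  by (simp add: tuples_def)

lemma structureD:
  assumes "lang_structure L M"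
  shows "univ M \<noteq> {}"
    and "F \<in> funs L \<Longrightarrow> xs \<in> tuples (univ M) (fun_arity L F) \<Longrightarrow> fun_interp M F xs \<in> univ M"
    and "\<not> (F \<in> funs L \<and> xs \<in> tuples (univ M) (fun_arity L F)) \<Longrightarrow> fun_interp M F xs = undefined"
    and "xs \<in> rel_interp M R \<Longrightarrow> R \<in> rels L \<and> xs \<in> tuples (univ M) (rel_arity L R)"
proof -
  show "univ M \<noteq> {}" using assms by (simp add: lang_structure_def)
  show "F \<in> funs L \<Longrightarrow> xs \<in> tuples (univ M) (fun_arity L F) \<Longrightarrow> fun_interp M F xs \<in> univ M"
    using assms by (simp add: lang_structure_def closed_in_def)
  show "\<not> (F \<in> funs L \<and> xs \<in> tuples (univ M) (fun_arity L F)) \<Longrightarrow> fun_interp M F xs = undefined"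
    using assms unfolding lang_structure_def by metis
  assume xs: "xs \<in> rel_interp M R"
  have "rel_interp M R \<subseteq> (if R \<in> rels L then tuples (univ M) (rel_arity L R) else {})"
    using assms by (simp add: lang_structure_def)
  then show "R \<in> rels L \<and> xs \<in> tuples (univ M) (rel_arity L R)" using xs by (auto split: if_splits)
qed

lemma structureI:
  assumes "univ M \<noteq> {}"
    and "\<And>F xs. F \<in> funs L \<Longrightarrow> xs \<in> tuples (univ M) (fun_arity L F) \<Longrightarrow> fun_interp M F xs \<in> univ M"
    and "\<And>F xs. \<not> (F \<in> funs L \<and> xs \<in> tuples (univ M) (fun_arity L F)) \<Longrightarrow> fun_interp M F xs = undefined"
    and "\<And>R xs. xs \<in> rel_interp M R \<Longrightarrow> R \<in> rels L \<and> xs \<in> tuples (univ M) (rel_arity L R)"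
  shows "lang_structure L M"
  unfolding lang_structure_def closed_in_def
proof (intro conjI allI ballI impI)
  fix R show "rel_interp M R \<subseteq> (if R \<in> rels L then tuples (univ M) (rel_arity L R) else {})"
    using assms(4)[of _ R] by auto
qed (use assms in simp_all)

lemma embeddingsD:
  assumes "f \<in> embeddings L A B"
  shows "x \<in> univ A \<Longrightarrow> f x \<in> univ B" and "f \<in> extensional (univ A)" and "inj_on f (univ A)"
    and "F \<in> funs L \<Longrightarrow> xs \<in> tuples (univ A) (fun_arity L F) \<Longrightarrow> f (fun_interp A F xs) = fun_interp B F (map f xs)"
    and "R \<in> rels L \<Longrightarrow> xs \<in> tuples (univ A) (rel_arity L R) \<Longrightarrow> xs \<in> rel_interp A R \<longleftrightarrow> map f xs \<in> rel_interp B R"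
  using assms by (auto simp: embeddings_def PiE_iff)

lemma embeddingsI:
  assumes "\<And>x. x \<in> univ A \<Longrightarrow> f x \<in> univ B" and "f \<in> extensional (univ A)" and "inj_on f (univ A)"
    and "\<And>F xs. F \<in> funs L \<Longrightarrow> xs \<in> tuples (univ A) (fun_arity L F) \<Longrightarrow>
      f (fun_interp A F xs) = fun_interp B F (map f xs)"
    and "\<And>R xs. R \<in> rels L \<Longrightarrow> xs \<in> tuples (univ A) (rel_arity L R) \<Longrightarrow>
      xs \<in> rel_interp A R \<longleftrightarrow> map f xs \<in> rel_interp B R"
  shows "f \<in> embeddings L A B"
  unfolding embeddings_def using assms by (auto simp: PiE_iff)

lemma tuples_map: "xs \<in> tuples A n \<Longrightarrow> (\<And>x. x \<in> A \<Longrightarrow> f x \<in> B) \<Longrightarrow> map f xs \<in> tuples B n"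
  by (auto simp: tuples_def)

lemma map_restrict_tuple: "set xs \<subseteq> A \<Longrightarrow> map (\<lambda>x\<in>A. f x) xs = map f xs"
  by (induction xs) auto

lemma map_onto_tuple:
  assumes "set xs \<subseteq> f ` A"
  obtains ys where "set ys \<subseteq> A" "xs = map f ys"
proof (rule that[of "map (inv_into A f) xs"])
  show "set (map (inv_into A f) xs) \<subseteq> A" using assms inv_into_into[of _ f A] by auto
  have "f (inv_into A f x) = x" if "x \<in> set xs" for x using assms that f_inv_into_f[of x f A] by blast
  then show "xs = map f (map (inv_into A f) xs)" by (simp add: map_idI)
qed

lemma embeddings_compose:
  assumes A: "lang_structure L A" and f: "f \<in> embeddings L A B" and g: "g \<in> embeddings L B C"
  shows "(\<lambda>x\<in>univ A. g (f x)) \<in> embeddings L A C"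
proof (rule embeddingsI)
  show "(\<lambda>x\<in>univ A. g (f x)) x \<in> univ C" if "x \<in> univ A" for x
    using that embeddingsD(1)[OF f] embeddingsD(1)[OF g] by simp
  show "inj_on (\<lambda>x\<in>univ A. g (f x)) (univ A)"
    using embeddingsD(1)[OF f] embeddingsD(3)[OF f] embeddingsD(3)[OF g]
    by (auto simp: inj_on_def)
  fix F xs assume F: "F \<in> funs L" and xs: "xs \<in> tuples (univ A) (fun_arity L F)"
  have fxs: "map f xs \<in> tuples (univ B) (fun_arity L F)" using tuples_map[OF xs embeddingsD(1)[OF f]] .
  have "(\<lambda>x\<in>univ A. g (f x)) (fun_interp A F xs) = g (f (fun_interp A F xs))"
    using structureD(2)[OF A F xs] by simp
  also have "\<dots> = fun_interp C F (map g (map f xs))"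
    using embeddingsD(4)[OF f F xs] embeddingsD(4)[OF g F fxs] by simp
  also have "map g (map f xs) = map (\<lambda>x\<in>univ A. g (f x)) xs"
    using xs by (simp add: mem_tuples map_restrict_tuple o_def)
  finally show "(\<lambda>x\<in>univ A. g (f x)) (fun_interp A F xs) = fun_interp C F (map (\<lambda>x\<in>univ A. g (f x)) xs)" .
next
  fix R xs assume R: "R \<in> rels L" and xs: "xs \<in> tuples (univ A) (rel_arity L R)"
  have fxs: "map f xs \<in> tuples (univ B) (rel_arity L R)" using tuples_map[OF xs embeddingsD(1)[OF f]] .
  have eq: "map (\<lambda>x\<in>univ A. g (f x)) xs = map g (map f xs)"
    using xs by (simp add: mem_tuples map_restrict_tuple o_def)
  show "xs \<in> rel_interp A R \<longleftrightarrow> map (\<lambda>x\<in>univ A. g (f x)) xs \<in> rel_interp C R"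
    unfolding eq using embeddingsD(5)[OF f R xs] embeddingsD(5)[OF g R fxs] by blast
qed simp

lemma induced_simps [simp]:
  "univ (induced M A) = A"
  "set xs \<subseteq> A \<Longrightarrow> fun_interp (induced M A) F xs = fun_interp M F xs"
  "\<not> set xs \<subseteq> A \<Longrightarrow> fun_interp (induced M A) F xs = undefined"
  "rel_interp (induced M A) R = {xs \<in> rel_interp M R. set xs \<subseteq> A}"
  by (simp_all add: induced_def)

lemma induced_structure:
  assumes M: "lang_structure L M" and A: "closed_in L M A" "A \<noteq> {}"
  shows "lang_structure L (induced M A)"
proof (rule structureI)
  have AM: "A \<subseteq> univ M" using A by (simp add: closed_in_def)
  show "fun_interp (induced M A) F xs \<in> univ (induced M A)"
    if "F \<in> funs L" "xs \<in> tuples (univ (induced M A)) (fun_arity L F)" for F xs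
    using that A(1) by (simp add: closed_in_def mem_tuples)
  show "fun_interp (induced M A) F xs = undefined"
    if "\<not> (F \<in> funs L \<and> xs \<in> tuples (univ (induced M A)) (fun_arity L F))" for F xs
  proof (cases "set xs \<subseteq> A")
    case True
    then have "\<not> (F \<in> funs L \<and> xs \<in> tuples (univ M) (fun_arity L F))" using that by (auto simp: mem_tuples)
    then show ?thesis using structureD(3)[OF M] True by simp
  qed simp
  show "R \<in> rels L \<and> xs \<in> tuples (univ (induced M A)) (rel_arity L R)" if "xs \<in> rel_interp (induced M A) R" for R xs
    using that structureD(4)[OF M, of xs R] by (simp add: mem_tuples)
qed (use A in simp)

lemma embeddings_induced:
  assumes "closed_in L M A"
  shows "(\<lambda>x\<in>A. x) \<in> embeddings L (induced M A) M"
proof (rule embeddingsI)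
  show "(\<lambda>x\<in>A. x) x \<in> univ M" if "x \<in> univ (induced M A)" for x using assms that by (auto simp: closed_in_def)
  show "inj_on (\<lambda>x\<in>A. x) (univ (induced M A))" by (simp add: inj_on_def)
  show "(\<lambda>x\<in>A. x) (fun_interp (induced M A) F xs) = fun_interp M F (map (\<lambda>x\<in>A. x) xs)"
    if "F \<in> funs L" "xs \<in> tuples (univ (induced M A)) (fun_arity L F)" for F xs
    using that assms by (simp add: closed_in_def mem_tuples map_restrict_tuple)
  show "xs \<in> rel_interp (induced M A) R \<longleftrightarrow> map (\<lambda>x\<in>A. x) xs \<in> rel_interp M R"
    if "R \<in> rels L" "xs \<in> tuples (univ (induced M A)) (rel_arity L R)" for R xs
    using that by (simp add: mem_tuples map_restrict_tuple)
qed simp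

lemma embeddings_restrict:
  assumes A: "A \<subseteq> univ M" and f: "f \<in> embeddings L M N"
    and closed: "\<And>F xs. F \<in> funs L \<Longrightarrow> xs \<in> tuples A (fun_arity L F) \<Longrightarrow> fun_interp M F xs \<in> A"
  shows "(\<lambda>x\<in>A. f x) \<in> embeddings L (induced M A) N"
proof (rule embeddingsI)
  have T: "xs \<in> tuples (univ M) n" if "xs \<in> tuples A n" for xs n using that A by (auto simp: mem_tuples)
  show "(\<lambda>x\<in>A. f x) x \<in> univ N" if "x \<in> univ (induced M A)" for x using A embeddingsD(1)[OF f] that by auto
  show "inj_on (\<lambda>x\<in>A. f x) (univ (induced M A))"
    using inj_on_subset[OF embeddingsD(3)[OF f] A] by (simp add: inj_on_def)
  show "(\<lambda>x\<in>A. f x) (fun_interp (induced M A) F xs) = fun_interp N F (map (\<lambda>x\<in>A. f x) xs)"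
    if "F \<in> funs L" "xs \<in> tuples (univ (induced M A)) (fun_arity L F)" for F xs
    using that closed[of F xs] embeddingsD(4)[OF f that(1), of xs] T by (simp add: mem_tuples map_restrict_tuple)
  show "xs \<in> rel_interp (induced M A) R \<longleftrightarrow> map (\<lambda>x\<in>A. f x) xs \<in> rel_interp N R"
    if "R \<in> rels L" "xs \<in> tuples (univ (induced M A)) (rel_arity L R)" for R xs
    using that embeddingsD(5)[OF f that(1), of xs] T by (simp add: mem_tuples map_restrict_tuple)
qed simp

lemma embeddings_into_induced:
  assumes f: "f \<in> embeddings L A M" and sub: "f ` univ A \<subseteq> B"
  shows "f \<in> embeddings L A (induced M B)"
proof (rule embeddingsI)
  show "f x \<in> univ (induced M B)" if "x \<in> univ A" for x using sub that by auto
  show "f \<in> extensional (univ A)" "inj_on f (univ A)" using embeddingsD[OF f] by auto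
  have *: "set (map f xs) \<subseteq> B" if "xs \<in> tuples (univ A) n" for xs n using that sub by (auto simp: mem_tuples)
  show "f (fun_interp A F xs) = fun_interp (induced M B) F (map f xs)"
    if "F \<in> funs L" "xs \<in> tuples (univ A) (fun_arity L F)" for F xs
    using embeddingsD(4)[OF f that] *[OF that(2)] by simp
  show "xs \<in> rel_interp A R \<longleftrightarrow> map f xs \<in> rel_interp (induced M B) R"
    if "R \<in> rels L" "xs \<in> tuples (univ A) (rel_arity L R)" for R xs
    using embeddingsD(5)[OF f that] *[OF that(2)] by simp
qed

lemma closed_image:
  assumes A: "lang_structure L A" and f: "f \<in> embeddings L A M"
  shows "closed_in L M (f ` univ A)"
  unfolding closed_in_def
proof (intro conjI ballI)
  show "f ` univ A \<subseteq> univ M" using embeddingsD(1)[OF f] by blast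
  fix F xs assume F: "F \<in> funs L" and xs: "xs \<in> tuples (f ` univ A) (fun_arity L F)"
  obtain ys where ys: "set ys \<subseteq> univ A" "xs = map f ys"
    using map_onto_tuple[of xs f "univ A"] xs by (auto simp: mem_tuples)
  have yt: "ys \<in> tuples (univ A) (fun_arity L F)" using xs ys by (simp add: mem_tuples)
  show "fun_interp M F xs \<in> f ` univ A"
    using embeddingsD(4)[OF f F yt] structureD(2)[OF A F yt] ys(2) by (metis image_eqI)
qed

lemma isomorphism_transfer:
  assumes A: "lang_structure L A" and e: "e \<in> embeddings L A M" and e': "e' \<in> embeddings L A N"
  shows "(\<lambda>y\<in>e ` univ A. e' (inv_into (univ A) e y))
    \<in> isomorphisms L (induced M (e ` univ A)) (induced N (e' ` univ A))" (is "?\<phi> \<in> _")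
proof -
  have \<phi>: "?\<phi> (e x) = e' x" if "x \<in> univ A" for x
    using that inv_into_f_f[OF embeddingsD(3)[OF e] that] by simp
  have m\<phi>: "map ?\<phi> (map e ys) = map e' ys" if "set ys \<subseteq> univ A" for ys
    using that \<phi> by (induction ys) auto
  have "?\<phi> \<in> embeddings L (induced M (e ` univ A)) (induced N (e' ` univ A))"
  proof (rule embeddingsI)
    show "?\<phi> y \<in> univ (induced N (e' ` univ A))" if "y \<in> univ (induced M (e ` univ A))" for y
      using that \<phi> by auto
    show "inj_on ?\<phi> (univ (induced M (e ` univ A)))"
    proof (rule inj_onI)
      fix y z assume "y \<in> univ (induced M (e ` univ A))" "z \<in> univ (induced M (e ` univ A))" and eq: "?\<phi> y = ?\<phi> z"
      then obtain u v where u: "u \<in> univ A" "y = e u" and v: "v \<in> univ A" "z = e v" by auto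
      then have "e' u = e' v" using eq \<phi> by simp
      then show "y = z" using inj_onD[OF embeddingsD(3)[OF e']] u v by blast
    qed
  next
    fix F xs assume F: "F \<in> funs L" and xs: "xs \<in> tuples (univ (induced M (e ` univ A))) (fun_arity L F)"
    then obtain ys where ys: "set ys \<subseteq> univ A" "xs = map e ys"
      using map_onto_tuple[of xs e "univ A"] by (auto simp: mem_tuples)
    have yt: "ys \<in> tuples (univ A) (fun_arity L F)" using xs ys by (simp add: mem_tuples)
    have in1: "set (map e ys) \<subseteq> e ` univ A" and in2: "set (map e' ys) \<subseteq> e' ` univ A" using ys(1) by auto
    have "?\<phi> (fun_interp (induced M (e ` univ A)) F xs) = ?\<phi> (fun_interp M F (map e ys))"
      using in1 ys(2) by simp
    also have "\<dots> = ?\<phi> (e (fun_interp A F ys))" using embeddingsD(4)[OF e F yt] by simp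
    also have "\<dots> = e' (fun_interp A F ys)" by (rule \<phi>[OF structureD(2)[OF A F yt]])
    also have "\<dots> = fun_interp N F (map e' ys)" by (rule embeddingsD(4)[OF e' F yt])
    also have "\<dots> = fun_interp (induced N (e' ` univ A)) F (map ?\<phi> xs)"
      unfolding ys(2) m\<phi>[OF ys(1)] using in2 by simp
    finally show "?\<phi> (fun_interp (induced M (e ` univ A)) F xs) = fun_interp (induced N (e' ` univ A)) F (map ?\<phi> xs)" .
  next
    fix R xs assume R: "R \<in> rels L" and xs: "xs \<in> tuples (univ (induced M (e ` univ A))) (rel_arity L R)"
    then obtain ys where ys: "set ys \<subseteq> univ A" "xs = map e ys"
      using map_onto_tuple[of xs e "univ A"] by (auto simp: mem_tuples)
    have yt: "ys \<in> tuples (univ A) (rel_arity L R)" using xs ys by (simp add: mem_tuples)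
    have in1: "set (map e ys) \<subseteq> e ` univ A" and in2: "set (map e' ys) \<subseteq> e' ` univ A" using ys(1) by auto
    show "xs \<in> rel_interp (induced M (e ` univ A)) R \<longleftrightarrow> map ?\<phi> xs \<in> rel_interp (induced N (e' ` univ A)) R"
      unfolding ys(2) m\<phi>[OF ys(1)]
      using in1 in2 embeddingsD(5)[OF e R yt] embeddingsD(5)[OF e' R yt] by simp
  qed simp
  moreover have "?\<phi> ` univ (induced M (e ` univ A)) = univ (induced N (e' ` univ A))"
    using \<phi> by (simp add: image_image)
  ultimately show ?thesis by (simp add: isomorphisms_def)
qed

text \<open>
  Ultrahomogeneity speaks about finite substructures; here it is restated for two embeddings of one
  abstract finite structure, the form in which it is used below.
\<close>

lemma homogeneous_extension:
  assumes M: "ultrahomogeneous L M" and A: "lang_structure L A" "finite (univ A)"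
    and e: "e \<in> embeddings L A M" and e': "e' \<in> embeddings L A M"
  obtains g where "g \<in> isomorphisms L M M" "\<And>x. x \<in> univ A \<Longrightarrow> g (e x) = e' x"
proof -
  let ?\<phi> = "\<lambda>y\<in>e ` univ A. e' (inv_into (univ A) e y)"
  have "induced M (e ` univ A) \<in> Fin L M" "induced M (e' ` univ A) \<in> Fin L M"
    unfolding Fin_def using A closed_image[OF A(1) e] closed_image[OF A(1) e'] structureD(1)[OF A(1)] by auto
  then obtain g where g: "g \<in> isomorphisms L M M" "\<forall>y\<in>univ (induced M (e ` univ A)). g y = ?\<phi> y"
    using M isomorphism_transfer[OF A(1) e e'] unfolding ultrahomogeneous_def by metis
  have "g (e x) = e' x" if "x \<in> univ A" for x
    using g(2) that inv_into_f_f[OF embeddingsD(3)[OF e] that] by simp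
  then show ?thesis using that g(1) by blast
qed

lemma isomorphismsD:
  assumes "f \<in> isomorphisms L A B"
  shows "f \<in> embeddings L A B" "f ` univ A = univ B"
  using assms by (auto simp: isomorphisms_def)

lemma isomorphism_inverse:
  assumes A: "lang_structure L A" and f: "f \<in> isomorphisms L A B" and B: "lang_structure L B"
  shows "(\<lambda>y\<in>univ B. inv_into (univ A) f y) \<in> isomorphisms L B A" (is "?g \<in> _")
proof -
  note e = isomorphismsD(1)[OF f] and onto = isomorphismsD(2)[OF f]
  have g: "?g y \<in> univ A" "f (?g y) = y" if "y \<in> univ B" for y
    using that onto inv_into_into[of y f "univ A"] f_inv_into_f[of y f "univ A"] by simp_all
  have gf: "?g (f x) = x" if "x \<in> univ A" for x
    using that onto inv_into_f_f[OF embeddingsD(3)[OF e] that] by auto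
  have mg: "map f (map ?g xs) = xs" if "set xs \<subseteq> univ B" for xs
    using that g(2) by (induction xs) auto
  have "?g \<in> embeddings L B A"
  proof (rule embeddingsI)
    show "?g y \<in> univ A" if "y \<in> univ B" for y by (rule g(1)[OF that])
    show "inj_on ?g (univ B)" using g(2) by (rule inj_on_inverseI)
  next
    fix F xs assume F: "F \<in> funs L" and xs: "xs \<in> tuples (univ B) (fun_arity L F)"
    have ys: "map ?g xs \<in> tuples (univ A) (fun_arity L F)" by (rule tuples_map[OF xs g(1)])
    have "?g (fun_interp B F xs) = ?g (fun_interp B F (map f (map ?g xs)))" using mg xs by (simp add: mem_tuples)
    also have "\<dots> = ?g (f (fun_interp A F (map ?g xs)))" using embeddingsD(4)[OF e F ys] by simp
    also have "\<dots> = fun_interp A F (map ?g xs)" by (rule gf[OF structureD(2)[OF A F ys]])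
    finally show "?g (fun_interp B F xs) = fun_interp A F (map ?g xs)" .
  next
    fix R xs assume R: "R \<in> rels L" and xs: "xs \<in> tuples (univ B) (rel_arity L R)"
    have ys: "map ?g xs \<in> tuples (univ A) (rel_arity L R)" by (rule tuples_map[OF xs g(1)])
    show "xs \<in> rel_interp B R \<longleftrightarrow> map ?g xs \<in> rel_interp A R"
      using embeddingsD(5)[OF e R ys] mg xs by (simp add: mem_tuples)
  qed simp
  moreover have "?g ` univ B = univ A"
  proof
    show "?g ` univ B \<subseteq> univ A" using g(1) by blast
    show "univ A \<subseteq> ?g ` univ B" using gf onto by (metis image_eqI subsetI)
  qed
  ultimately show ?thesis by (simp add: isomorphisms_def)
qed

lemma ageI:
  assumes "lang_structure L A" "finite (univ A)" "f \<in> embeddings L A M"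
  shows "A \<in> age L M"
  using assms by (auto simp: age_def)

lemma age_hereditary:
  assumes "B \<in> age L M" "lang_structure L A" "finite (univ A)" "f \<in> embeddings L A B"
  shows "A \<in> age L M"
proof -
  obtain j where "j \<in> embeddings L B M" using assms(1) by (auto simp: age_def)
  from ageI[OF assms(2,3) embeddings_compose[OF assms(2,4) this]] show ?thesis .
qed

lemma finite_hull:
  assumes M: "lang_structure L M" "locally_finite L M" and S: "finite S" "S \<subseteq> univ M" "S \<noteq> {}"
  obtains A where "finite A" "S \<subseteq> A" "closed_in L M A" "A \<noteq> {}"
proof (rule that[of "closed_in L M hull S"])
  show "finite (closed_in L M hull S)" using M S by (simp add: locally_finite_def)
  show sub: "S \<subseteq> closed_in L M hull S" by (rule hull_subset)
  then show "closed_in L M hull S \<noteq> {}" using S(3) by blast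
  have U: "closed_in L M (univ M)" using M(1) by (simp add: lang_structure_def)
  show "closed_in L M (closed_in L M hull S)"
    unfolding closed_in_def[of L M "closed_in L M hull S"]
  proof (intro conjI ballI)
    show "closed_in L M hull S \<subseteq> univ M" by (rule hull_minimal[where S = "closed_in L M", OF S(2) U])
    fix F xs assume F: "F \<in> funs L" and xs: "xs \<in> tuples (closed_in L M hull S) (fun_arity L F)"
    show "fun_interp M F xs \<in> closed_in L M hull S"
      unfolding hull_def
    proof (rule InterI)
      fix B assume "B \<in> {B. closed_in L M B \<and> S \<subseteq> B}"
      then have B: "closed_in L M B" "S \<subseteq> B" by simp_all
      have "closed_in L M hull S \<subseteq> B" by (rule hull_minimal[where S = "closed_in L M", OF B(2,1)])
      then have "xs \<in> tuples B (fun_arity L F)" using xs by (auto simp: mem_tuples)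
      then show "fun_interp M F xs \<in> B" using B(1) F by (simp add: closed_in_def)
    qed
  qed
qed

section \<open>Reducts and expansions\<close>

lemma reduct_simps [simp]:
  "univ (reduct M) = univ M" "fun_interp (reduct M) = fun_interp M"
  "rel_interp (reduct M) R = rel_interp M (Inl R)"
  by (simp_all add: reduct_def)

lemma relational_extensionD:
  assumes "relational_extension L L'"
  shows "funs L' = funs L" "F \<in> funs L \<Longrightarrow> fun_arity L' F = fun_arity L F"
    "Inl R \<in> rels L' \<longleftrightarrow> R \<in> rels L" "R \<in> rels L \<Longrightarrow> rel_arity L' (Inl R) = rel_arity L R"
  using assms by (auto simp: relational_extension_def)

lemma struc_eqI:
  fixes M N :: "('f, 'r + 's, 'a) struc"
  assumes "reduct M = reduct N" "\<And>R. rel_interp M (Inr R) = rel_interp N (Inr R)"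
  shows "M = N"
proof (rule struc.equality)
  have eq: "univ (reduct M) = univ (reduct N)" "fun_interp (reduct M) = fun_interp (reduct N)"
    "rel_interp (reduct M) R = rel_interp (reduct N) R" for R
    using assms(1) by simp_all
  show "univ M = univ N" "fun_interp M = fun_interp N" using eq by simp_all
  show "rel_interp M = rel_interp N"
  proof
    show "rel_interp M S = rel_interp N S" for S using eq(3) assms(2) by (cases S) simp_all
  qed
qed simp

lemma reduct_induced: "reduct (induced M A) = induced (reduct M) A"
  by (rule struc.equality) (simp_all add: induced_def fun_eq_iff)

lemma induced_induced: "A \<subseteq> B \<Longrightarrow> induced (induced M B) A = induced M A"
  unfolding induced_def by (auto simp: fun_eq_iff)

context
  fixes L :: "('f, 'r) lang" and L' :: "('f, 'r + 's) lang"
  assumes ext: "relational_extension L L'"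
begin

lemma closed_in_reduct: "closed_in L' M A \<longleftrightarrow> closed_in L (reduct M) A"
  unfolding closed_in_def using relational_extensionD[OF ext] by simp

lemma reduct_structure: "lang_structure L (reduct M)" if M: "lang_structure L' M"
proof (rule structureI)
  show "R \<in> rels L \<and> xs \<in> tuples (univ (reduct M)) (rel_arity L R)" if "xs \<in> rel_interp (reduct M) R" for R xs
    using structureD(4)[OF M, of xs "Inl R"] that relational_extensionD[OF ext] by auto
  show "fun_interp (reduct M) F xs = undefined"
    if "\<not> (F \<in> funs L \<and> xs \<in> tuples (univ (reduct M)) (fun_arity L F))" for F xs
    using structureD(3)[OF M, of F xs] that relational_extensionD[OF ext] by auto
  show "fun_interp (reduct M) F xs \<in> univ (reduct M)"
    if "F \<in> funs L" "xs \<in> tuples (univ (reduct M)) (fun_arity L F)" for F xs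
    using structureD(2)[OF M, of F xs] that relational_extensionD[OF ext] by auto
qed (use structureD(1)[OF M] in simp)

lemma expansion_structure:
  assumes "lang_structure L (reduct M)"
    and "\<And>R xs. xs \<in> rel_interp M (Inr R) \<Longrightarrow> Inr R \<in> rels L' \<and> xs \<in> tuples (univ M) (rel_arity L' (Inr R))"
  shows "lang_structure L' M"
proof (rule structureI)
  show "R \<in> rels L' \<and> xs \<in> tuples (univ M) (rel_arity L' R)" if "xs \<in> rel_interp M R" for R xs
    using structureD(4)[OF assms(1)] that assms(2) relational_extensionD[OF ext] by (cases R) auto
  show "fun_interp M F xs = undefined"
    if "\<not> (F \<in> funs L' \<and> xs \<in> tuples (univ M) (fun_arity L' F))" for F xs
    using structureD(3)[OF assms(1), of F xs] that relational_extensionD[OF ext] by auto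
  show "fun_interp M F xs \<in> univ M"
    if "F \<in> funs L'" "xs \<in> tuples (univ M) (fun_arity L' F)" for F xs
    using structureD(2)[OF assms(1), of F xs] that relational_extensionD[OF ext] by auto
qed (use structureD(1)[OF assms(1)] in simp)

lemma embeddings_reduct: "f \<in> embeddings L (reduct A) (reduct B)" if f: "f \<in> embeddings L' A B"
proof (rule embeddingsI)
  show "f (fun_interp (reduct A) F xs) = fun_interp (reduct B) F (map f xs)"
    if "F \<in> funs L" "xs \<in> tuples (univ (reduct A)) (fun_arity L F)" for F xs
    using embeddingsD(4)[OF f, of F xs] that relational_extensionD[OF ext] by simp
  show "xs \<in> rel_interp (reduct A) R \<longleftrightarrow> map f xs \<in> rel_interp (reduct B) R"
    if "R \<in> rels L" "xs \<in> tuples (univ (reduct A)) (rel_arity L R)" for R xs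
    using embeddingsD(5)[OF f, of "Inl R" xs] that relational_extensionD[OF ext] by simp
qed (use embeddingsD(1-3)[OF f] in auto)

lemma embeddings_expansion:
  assumes f: "f \<in> embeddings L (reduct A) (reduct B)"
    and "\<And>R xs. Inr R \<in> rels L' \<Longrightarrow> xs \<in> tuples (univ A) (rel_arity L' (Inr R)) \<Longrightarrow>
      xs \<in> rel_interp A (Inr R) \<longleftrightarrow> map f xs \<in> rel_interp B (Inr R)"
  shows "f \<in> embeddings L' A B"
proof (rule embeddingsI)
  show "f (fun_interp A F xs) = fun_interp B F (map f xs)"
    if "F \<in> funs L'" "xs \<in> tuples (univ A) (fun_arity L' F)" for F xs
    using embeddingsD(4)[OF f, of F xs] that relational_extensionD[OF ext] by simp
  show "xs \<in> rel_interp A R \<longleftrightarrow> map f xs \<in> rel_interp B R"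
    if "R \<in> rels L'" "xs \<in> tuples (univ A) (rel_arity L' R)" for R xs
  proof (cases R)
    case (Inl S)
    then show ?thesis using embeddingsD(5)[OF f, of S xs] that relational_extensionD[OF ext] by simp
  qed (use assms(2) that in simp)
qed (use embeddingsD(1-3)[OF f] in auto)

end

text \<open>
  This is the unique expansion of \<open>A\<close> that makes \<open>e\<close> an embedding into \<open>M\<close>. The condition on the
  language makes the new relations empty outside it, as required of structures.
\<close>

definition pullback ::
    "('f, 'r + 's) lang \<Rightarrow> ('f, 'r + 's, 'b) struc \<Rightarrow> ('a \<Rightarrow> 'b) \<Rightarrow> ('f, 'r, 'a) struc \<Rightarrow> ('f, 'r + 's, 'a) struc" where
  "pullback L' M e A = \<lparr>univ = univ A, fun_interp = fun_interp A,
     rel_interp = case_sum (rel_interp A)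
       (\<lambda>R. {xs \<in> tuples (univ A) (rel_arity L' (Inr R)). Inr R \<in> rels L' \<and> map e xs \<in> rel_interp M (Inr R)})\<rparr>"

lemma reduct_pullback [simp]: "reduct (pullback L' M e A) = A"
  by (simp add: reduct_def pullback_def)

lemma pullback_simps [simp]:
  "univ (pullback L' M e A) = univ A"
  "rel_interp (pullback L' M e A) (Inr R) =
     {xs \<in> tuples (univ A) (rel_arity L' (Inr R)). Inr R \<in> rels L' \<and> map e xs \<in> rel_interp M (Inr R)}"
  by (simp_all add: pullback_def)

lemma pullback_structure:
  "relational_extension L L' \<Longrightarrow> lang_structure L A \<Longrightarrow> lang_structure L' (pullback L' M e A)"
  by (rule expansion_structure) auto

lemma pullback_embedding:
  "relational_extension L L' \<Longrightarrow> e \<in> embeddings L A (reduct M) \<Longrightarrow> e \<in> embeddings L' (pullback L' M e A) M"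
  by (rule embeddings_expansion) auto

lemma pullback_unique:
  assumes "lang_structure L' A" "e \<in> embeddings L' A M"
  shows "A = pullback L' M e (reduct A)"
proof (rule struc_eqI)
  fix R
  show "rel_interp A (Inr R) = rel_interp (pullback L' M e (reduct A)) (Inr R)"
    using structureD(4)[OF assms(1), of _ "Inr R"] embeddingsD(5)[OF assms(2), of "Inr R"] by auto
qed simp

section \<open>The automorphism group of a Fraisse structure\<close>

locale fraisse_limit =
  fixes L :: "('f, 'r) lang" and K :: "('f, 'r, nat) struc"
  assumes fraisse: "fraisse_structure L K"
    and univ_K [simp]: "univ K = UNIV"
begin

abbreviation "G \<equiv> aut_group L K"
abbreviation "T \<equiv> aut_topology L K"

lemma K_structure: "lang_structure L K"
  and K_homogeneous: "ultrahomogeneous L K"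
  and K_locally_finite: "locally_finite L K"
  using fraisse by (auto simp: fraisse_structure_def)

lemma carrier_G: "carrier G = isomorphisms L K K"
  by (simp add: aut_group_def)

lemma G_bij: "g \<in> isomorphisms L K K \<Longrightarrow> bij g"
  using isomorphismsD[of g L K K] embeddingsD(3)[of g L K K] by (simp add: bij_def)

lemma perm_group_G: "perm_group G T"
proof (rule perm_group.intro)
  let ?H = "isomorphisms L K K"
  have inBij: "g \<in> Bij UNIV" if "g \<in> ?H" for g using G_bij[OF that] by (simp add: Bij_def)
  have "subgroup ?H (BijGroup UNIV)"
  proof (rule subgroup.intro)
    show "?H \<subseteq> carrier (BijGroup UNIV)" using inBij by (auto simp: BijGroup_def)
    show "g \<otimes>\<^bsub>BijGroup UNIV\<^esub> h \<in> ?H" if g: "g \<in> ?H" and h: "h \<in> ?H" for g h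
    proof -
      have "(\<lambda>x\<in>univ K. g (h x)) \<in> embeddings L K K"
        by (rule embeddings_compose[OF K_structure isomorphismsD(1)[OF h] isomorphismsD(1)[OF g]])
      moreover have "range (\<lambda>x. g (h x)) = UNIV"
        using bij_is_surj[OF bij_comp[OF G_bij[OF h] G_bij[OF g]]] by (simp add: o_def)
      moreover have "g \<otimes>\<^bsub>BijGroup UNIV\<^esub> h = (\<lambda>x. g (h x))"
        using inBij[OF g] inBij[OF h] by (simp add: BijGroup_def compose_def restrict_UNIV)
      ultimately show ?thesis by (simp add: isomorphisms_def restrict_UNIV)
    qed
    have "(\<lambda>x. x) \<in> embeddings L K K" by (rule embeddingsI) auto
    then show "\<one>\<^bsub>BijGroup UNIV\<^esub> \<in> ?H" by (simp add: BijGroup_def isomorphisms_def restrict_UNIV)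
    show "inv\<^bsub>BijGroup UNIV\<^esub> g \<in> ?H" if g: "g \<in> ?H" for g
      using isomorphism_inverse[OF K_structure g K_structure] inv_BijGroup[OF inBij[OF g]] by simp
  qed
  then show "group G"
    unfolding aut_group_def univ_K by (rule group.subgroup_imp_group[OF group_BijGroup])
  show "bij g" if "g \<in> carrier G" for g using that G_bij by (simp add: carrier_G)
  show "g \<otimes>\<^bsub>G\<^esub> h = g \<circ> h" if "g \<in> carrier G" "h \<in> carrier G" for g h
    using inBij[of g] inBij[of h] that by (simp add: carrier_G aut_group_def BijGroup_def compose_def o_def restrict_UNIV)
  show "T = subtopology (product_topology (\<lambda>_. discrete_topology UNIV) UNIV) (carrier G)"
    by (simp add: aut_topology_def carrier_G)
qed

sublocale perm_group G T by (rule perm_group_G)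

lemma aut_embedding: "g \<in> carrier G \<Longrightarrow> g \<in> embeddings L K K"
  by (simp add: carrier_G isomorphismsD)

lemma embedding_shift:
  "g \<in> carrier G \<Longrightarrow> lang_structure L A \<Longrightarrow> e \<in> embeddings L A K \<Longrightarrow> (\<lambda>x\<in>univ A. g (e x)) \<in> embeddings L A K"
  by (rule embeddings_compose[OF _ _ aut_embedding])

lemma embedding_extends:
  assumes "lang_structure L A" "finite (univ A)" "e \<in> embeddings L A K" "e' \<in> embeddings L A K"
  obtains g where "g \<in> carrier G" "\<And>x. x \<in> univ A \<Longrightarrow> g (e x) = e' x"
  using homogeneous_extension[OF K_homogeneous assms] unfolding carrier_G by blast

text \<open>
  These are the universes of the finite substructures of \<open>K\<close>.
\<close>

definition fin_closed :: "nat set set" where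
  "fin_closed = {A. finite A \<and> A \<noteq> {} \<and> closed_in L K A}"

lemma fin_closed_D: "A \<in> fin_closed \<Longrightarrow> finite A" "A \<in> fin_closed \<Longrightarrow> A \<noteq> {}" "A \<in> fin_closed \<Longrightarrow> closed_in L K A"
  by (simp_all add: fin_closed_def)

lemma Fin_fin_closed: "Fin L K = induced K ` fin_closed"
  by (auto simp: Fin_def fin_closed_def)

lemma fin_closed_covers: assumes "finite S" obtains A where "A \<in> fin_closed" "S \<subseteq> A"
proof -
  have "finite (insert 0 S)" "insert 0 S \<subseteq> univ K" "insert 0 S \<noteq> {}" using assms by simp_all
  then obtain A where "finite A" "insert 0 S \<subseteq> A" "closed_in L K A" "A \<noteq> {}"
    by (rule finite_hull[OF K_structure K_locally_finite])
  then show ?thesis using that[of A] by (simp add: fin_closed_def)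
qed

lemma countable_fin_closed: "countable fin_closed"
  by (rule countable_subset[OF _ countable_Collect_finite]) (auto simp: fin_closed_def)

lemma induced_K_structure: "A \<in> fin_closed \<Longrightarrow> lang_structure L (induced K A)"
  by (rule induced_structure[OF K_structure fin_closed_D(3,2)])

lemma induced_K_embedding: "A \<in> fin_closed \<Longrightarrow> (\<lambda>x\<in>A. x) \<in> embeddings L (induced K A) K"
  by (rule embeddings_induced[OF fin_closed_D(3)])

lemma induced_K_age: "A \<in> fin_closed \<Longrightarrow> induced K A \<in> age L K"
  by (rule ageI[OF induced_K_structure _ induced_K_embedding]) (simp_all add: fin_closed_D)

lemma fin_closed_embedding_image:
  assumes "lang_structure L A" "finite (univ A)" "e \<in> embeddings L A K"
  shows "e ` univ A \<in> fin_closed"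
  using assms closed_image[OF assms(1,3)] structureD(1)[OF assms(1)] by (simp add: fin_closed_def)

lemma aut_induced_embedding:
  assumes A: "A \<in> fin_closed" and g: "g \<in> carrier G"
  shows "(\<lambda>x\<in>A. g x) \<in> embeddings L (induced K A) (induced K (g ` A))"
proof -
  have "(\<lambda>x\<in>A. g x) \<in> embeddings L (induced K A) K"
    by (rule embeddings_restrict[OF _ aut_embedding[OF g]]) (use fin_closed_D(3)[OF A] in \<open>simp_all add: closed_in_def\<close>)
  then show ?thesis by (rule embeddings_into_induced) simp
qed

lemma fin_closed_image:
  assumes A: "A \<in> fin_closed" and g: "g \<in> carrier G"
  shows "g ` A \<in> fin_closed"
proof -
  have "(\<lambda>x\<in>univ (induced K A). g ((\<lambda>x\<in>A. x) x)) \<in> embeddings L (induced K A) K"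
    by (rule embedding_shift[OF g induced_K_structure[OF A] induced_K_embedding[OF A]])
  from fin_closed_embedding_image[OF induced_K_structure[OF A] _ this] show ?thesis
    using fin_closed_D(1)[OF A] by simp
qed

end

section \<open>The flow of expansions\<close>

text \<open>
  Between expansions of one structure this is equality of the induced structures; it also makes sense
  for sets that are not closed under the functions of the language.
\<close>

definition agree :: "'a set \<Rightarrow> ('f, 'r + 's, 'a) struc \<Rightarrow> ('f, 'r + 's, 'a) struc \<Rightarrow> bool" where
  "agree A M N \<longleftrightarrow> (\<forall>R xs. set xs \<subseteq> A \<longrightarrow> (xs \<in> rel_interp M (Inr R) \<longleftrightarrow> xs \<in> rel_interp N (Inr R)))"

lemma agree_mono: "agree B M N \<Longrightarrow> A \<subseteq> B \<Longrightarrow> agree A M N"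
  unfolding agree_def by (meson subset_trans)

lemma agree_refl: "agree A M M" by (simp add: agree_def)

lemma agree_sym: "agree A M N \<Longrightarrow> agree A N M" by (simp add: agree_def)

lemma agree_trans: "agree A M N \<Longrightarrow> agree A N P \<Longrightarrow> agree A M P" by (simp add: agree_def)

lemma induced_eq_iff_agree:
  fixes M N :: "('f, 'r + 's, 'a) struc"
  assumes "reduct M = reduct N"
  shows "induced M A = induced N A \<longleftrightarrow> agree A M N"
proof
  assume eq: "induced M A = induced N A"
  have "rel_interp (induced M A) (Inr R) = rel_interp (induced N A) (Inr R)" for R by (simp only: eq)
  then have *: "{xs \<in> rel_interp M (Inr R). set xs \<subseteq> A} = {xs \<in> rel_interp N (Inr R). set xs \<subseteq> A}" for R by simp
  show "agree A M N" unfolding agree_def using * by blast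
next
  assume "agree A M N"
  then have "rel_interp (induced M A) (Inr R) = rel_interp (induced N A) (Inr R)" for R
    by (auto simp: agree_def)
  then show "induced M A = induced N A"
    by (intro struc_eqI) (simp_all only: reduct_induced assms)
qed

text \<open>
  The expansions form a flow as soon as the class is closed under embeddings, precompact, and realized
  by some expansion of \<open>K\<close>.
\<close>

locale expansion_space = fraisse_limit L K
  for L :: "('f, 'r) lang" and K +
  fixes L' :: "('f, 'r + 's) lang" and \<K>' :: "('f, 'r + 's, nat) struc set"
  assumes ext: "relational_extension L L'"
    and precompact: "precompact_expansion (age L K) \<K>'"
    and members: "A \<in> \<K>' \<Longrightarrow> lang_structure L' A"
    and hereditary: "B \<in> \<K>' \<Longrightarrow> lang_structure L' A \<Longrightarrow> finite (univ A) \<Longrightarrow> f \<in> embeddings L' A B \<Longrightarrow> A \<in> \<K>'"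
    and inhabited: "expansions L K L' \<K>' \<noteq> {}"
begin

abbreviation "E \<equiv> expansions L K L' \<K>'"
abbreviation "X \<equiv> expansions_topology L K L' \<K>'"
abbreviation "act \<equiv> logic_action L K L' \<K>'"

lemma E_iff: "N \<in> E \<longleftrightarrow> lang_structure L' N \<and> reduct N = K \<and> (\<forall>A\<in>fin_closed. induced N A \<in> \<K>')"
  unfolding expansions_def Fin_fin_closed by simp

lemma E_D:
  assumes "N \<in> E"
  shows "lang_structure L' N" "reduct N = K" "A \<in> fin_closed \<Longrightarrow> induced N A \<in> \<K>'" "univ N = UNIV"
    "rel_interp N (Inl R) = rel_interp K R" "fun_interp N = fun_interp K"
proof -
  show "lang_structure L' N" "A \<in> fin_closed \<Longrightarrow> induced N A \<in> \<K>'" using assms by (simp_all add: E_iff)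
  show r: "reduct N = K" using assms by (simp add: E_iff)
  have "univ (reduct N) = UNIV" "rel_interp (reduct N) R = rel_interp K R" "fun_interp (reduct N) = fun_interp K"
    by (simp_all only: r univ_K)
  then show "univ N = UNIV" "rel_interp N (Inl R) = rel_interp K R" "fun_interp N = fun_interp K" by simp_all
qed

lemma E_eqI: "M \<in> E \<Longrightarrow> N \<in> E \<Longrightarrow> (\<And>A. finite A \<Longrightarrow> agree A M N) \<Longrightarrow> M = N"
proof (rule struc_eqI)
  assume MN: "M \<in> E" "N \<in> E" and ag: "\<And>A. finite A \<Longrightarrow> agree A M N"
  show "reduct M = reduct N" using E_D(2) MN by simp
  fix R show "rel_interp M (Inr R) = rel_interp N (Inr R)"
  proof (intro Set.set_eqI)
    fix xs show "xs \<in> rel_interp M (Inr R) \<longleftrightarrow> xs \<in> rel_interp N (Inr R)"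
      using ag[of "set xs"] by (simp add: agree_def)
  qed
qed

lemma induced_E_iff: "M \<in> E \<Longrightarrow> N \<in> E \<Longrightarrow> induced M A = induced N A \<longleftrightarrow> agree A M N"
  by (rule induced_eq_iff_agree) (simp add: E_D(2))

lemma openin_basic: "A \<in> fin_closed \<Longrightarrow> N \<in> E \<Longrightarrow> openin X {N' \<in> E. induced N' A = induced N A}"
proof -
  assume A: "A \<in> fin_closed" and N: "N \<in> E"
  have 1: "reduct (induced N A) = induced K A" using E_D(2)[OF N] by (simp add: reduct_induced)
  show ?thesis
    unfolding expansions_topology_def
    by (rule topology_generated_by_Basis)
      (use A 1 E_D(3)[OF N A] in \<open>auto simp: Fin_fin_closed intro!: exI[of _ "induced K A"] exI[of _ "induced N A"]\<close>)
qed

text \<open>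
  A basic open set prescribes the new relations on one finite substructure, so neighbourhoods are
  described by agreement on finite sets.
\<close>

lemma openin_X:
  "openin X U \<longleftrightarrow> U \<subseteq> E \<and> (\<forall>N\<in>U. \<exists>A. finite A \<and> (\<forall>N'\<in>E. agree A N N' \<longrightarrow> N' \<in> U))"
proof
  let ?B = "{{N \<in> E. induced N (univ A) = A'} | A A'. A \<in> Fin L K \<and> A' \<in> \<K>' \<and> reduct A' = A}"
  assume "openin X U"
  then have "generate_topology_on ?B U"
    unfolding expansions_topology_def by (simp add: openin_topology_generated_by_iff)
  then show "U \<subseteq> E \<and> (\<forall>N\<in>U. \<exists>A. finite A \<and> (\<forall>N'\<in>E. agree A N N' \<longrightarrow> N' \<in> U))"
  proof induction
    case (Int U V)
    show ?case
    proof (intro conjI ballI)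
      show "U \<inter> V \<subseteq> E" using Int.IH by blast
      fix N assume "N \<in> U \<inter> V"
      then obtain A B where "finite A" "\<forall>N'\<in>E. agree A N N' \<longrightarrow> N' \<in> U" "finite B" "\<forall>N'\<in>E. agree B N N' \<longrightarrow> N' \<in> V"
        using Int.IH by blast
      then show "\<exists>A. finite A \<and> (\<forall>N'\<in>E. agree A N N' \<longrightarrow> N' \<in> U \<inter> V)"
        using agree_mono[of "A \<union> B" N] by (intro exI[of _ "A \<union> B"]) auto
    qed
  next
    case (UN \<U>)
    show ?case
    proof (intro conjI ballI)
      show "\<Union>\<U> \<subseteq> E" using UN.IH by blast
      fix N assume "N \<in> \<Union>\<U>"
      then obtain U where U: "U \<in> \<U>" "N \<in> U" by blast
      then obtain A where "finite A" "\<forall>N'\<in>E. agree A N N' \<longrightarrow> N' \<in> U" using UN.IH by blast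
      then show "\<exists>A. finite A \<and> (\<forall>N'\<in>E. agree A N N' \<longrightarrow> N' \<in> \<Union>\<U>)" using U(1) by blast
    qed
  next
    case (Basis U)
    then obtain B A' where B: "U = {N \<in> E. induced N (univ B) = A'}" "B \<in> Fin L K" by blast
    then obtain A where "A \<in> fin_closed" "B = induced K A" unfolding Fin_fin_closed by blast
    then have A: "A \<in> fin_closed" "U = {N \<in> E. induced N A = A'}" using B(1) by simp_all
    show ?case
    proof (intro conjI ballI)
      show "U \<subseteq> E" using A by blast
      fix N assume "N \<in> U"
      then have N: "N \<in> E" "induced N A = A'" using A by auto
      have "N' \<in> U" if "N' \<in> E" "agree A N N'" for N'
        using induced_E_iff[OF N(1) that(1), of A] that N A(2) by simp
      then show "\<exists>A. finite A \<and> (\<forall>N'\<in>E. agree A N N' \<longrightarrow> N' \<in> U)" using fin_closed_D(1)[OF A(1)] by blast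
    qed
  qed simp
next
  assume U: "U \<subseteq> E \<and> (\<forall>N\<in>U. \<exists>A. finite A \<and> (\<forall>N'\<in>E. agree A N N' \<longrightarrow> N' \<in> U))"
  have "\<exists>V. openin X V \<and> N \<in> V \<and> V \<subseteq> U" if N: "N \<in> U" for N
  proof -
    obtain A where A: "finite A" "\<And>N'. N'\<in>E \<Longrightarrow> agree A N N' \<Longrightarrow> N' \<in> U" using U N by blast
    obtain B where B: "B \<in> fin_closed" "A \<subseteq> B" using fin_closed_covers[OF A(1)] by blast
    have NE: "N \<in> E" using U N by blast
    have "{N' \<in> E. induced N' B = induced N B} \<subseteq> U"
    proof
      fix N' assume "N' \<in> {N' \<in> E. induced N' B = induced N B}"
      then have N': "N' \<in> E" "induced N B = induced N' B" by simp_all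
      then have "agree B N N'" using induced_E_iff[OF NE N'(1)] by blast
      then show "N' \<in> U" using A(2)[OF N'(1)] agree_mono[OF _ B(2)] by blast
    qed
    then show ?thesis using openin_basic[OF B(1) NE] NE by blast
  qed
  then show "openin X U" by (rule openinI)
qed

lemma topspace_X [simp]: "topspace X = E"
proof
  show "topspace X \<subseteq> E" using openin_topspace[of X] unfolding openin_X by blast
  have "openin X E" unfolding openin_X by blast
  then show "E \<subseteq> topspace X" by (rule openin_subset)
qed

lemma openin_agree: "finite A \<Longrightarrow> openin X {N' \<in> E. agree A N N'}"
  unfolding openin_X using agree_trans by blast

definition coherent :: "(nat set \<Rightarrow> ('f, 'r + 's, nat) struc) set" where
  "coherent = {p \<in> (\<Pi>\<^sub>E A\<in>fin_closed. {A' \<in> \<K>'. reduct A' = induced K A}).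
     \<forall>A\<in>fin_closed. \<forall>B\<in>{B \<in> fin_closed. A \<subseteq> B}. p A = induced (p B) A}"

definition glue :: "(nat set \<Rightarrow> ('f, 'r + 's, nat) struc) \<Rightarrow> ('f, 'r + 's, nat) struc" where
  "glue p = \<lparr>univ = UNIV, fun_interp = fun_interp K,
     rel_interp = case_sum (rel_interp K) (\<lambda>R. {xs. \<exists>A\<in>fin_closed. xs \<in> rel_interp (p A) (Inr R)})\<rparr>"

lemma reduct_glue: "reduct (glue p) = K"
  using univ_K by (simp add: reduct_def glue_def)

lemma glue_rel: "xs \<in> rel_interp (glue p) (Inr R) \<longleftrightarrow> (\<exists>A\<in>fin_closed. xs \<in> rel_interp (p A) (Inr R))"
  by (simp add: glue_def)

lemma coherentD:
  assumes "p \<in> coherent"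
  shows "A \<in> fin_closed \<Longrightarrow> p A \<in> \<K>'" "A \<in> fin_closed \<Longrightarrow> reduct (p A) = induced K A"
    "A \<in> fin_closed \<Longrightarrow> B \<in> fin_closed \<Longrightarrow> A \<subseteq> B \<Longrightarrow> p A = induced (p B) A" "p \<in> extensional fin_closed"
  using assms by (auto simp: coherent_def PiE_iff)

lemma induced_glue:
  assumes p: "p \<in> coherent" and A: "A \<in> fin_closed"
  shows "induced (glue p) A = p A"
proof (rule struc_eqI)
  show "reduct (induced (glue p) A) = reduct (p A)"
    using coherentD(2)[OF p A] by (simp add: reduct_induced reduct_glue)
  fix R
  show "rel_interp (induced (glue p) A) (Inr R) = rel_interp (p A) (Inr R)"
  proof (intro Set.set_eqI iffI)
    fix xs assume "xs \<in> rel_interp (p A) (Inr R)"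
    moreover have "univ (reduct (p A)) = A" unfolding coherentD(2)[OF p A] by simp
    ultimately show "xs \<in> rel_interp (induced (glue p) A) (Inr R)"
      using A structureD(4)[OF members[OF coherentD(1)[OF p A]], of xs "Inr R"]
      by (auto simp: glue_rel mem_tuples)
  next
    fix xs assume "xs \<in> rel_interp (induced (glue p) A) (Inr R)"
    then obtain B where B: "B \<in> fin_closed" "xs \<in> rel_interp (p B) (Inr R)" "set xs \<subseteq> A" by (auto simp: glue_rel)
    obtain C where C: "C \<in> fin_closed" "A \<union> B \<subseteq> C" using fin_closed_covers[of "A \<union> B"] fin_closed_D(1) A B by auto
    have "xs \<in> rel_interp (p C) (Inr R)"
      using B(2) unfolding coherentD(3)[OF p B(1) C(1)] using C(2) by (subst (asm) coherentD(3)[OF p B(1) C(1)]) auto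
    then show "xs \<in> rel_interp (p A) (Inr R)"
      using B(3) C(2) by (subst coherentD(3)[OF p A C(1)]) auto
  qed
qed

lemma glue_in_E: assumes p: "p \<in> coherent" shows "glue p \<in> E"
  unfolding E_iff
proof (intro conjI ballI)
  show "reduct (glue p) = K" by (rule reduct_glue)
  show "induced (glue p) A \<in> \<K>'" if "A \<in> fin_closed" for A
    using that coherentD(1)[OF p] induced_glue[OF p] by simp
  show "lang_structure L' (glue p)"
  proof (rule expansion_structure[OF ext])
    show "lang_structure L (reduct (glue p))" by (simp add: reduct_glue K_structure)
    fix R xs assume "xs \<in> rel_interp (glue p) (Inr R)"
    then obtain A where A: "A \<in> fin_closed" "xs \<in> rel_interp (p A) (Inr R)" by (auto simp: glue_rel)
    then show "Inr R \<in> rels L' \<and> xs \<in> tuples (univ (glue p)) (rel_arity L' (Inr R))"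
      using structureD(4)[OF members[OF coherentD(1)[OF p A(1)]] A(2)] by (simp add: glue_def mem_tuples)
  qed
qed

text \<open>
  An expansion is a coherent family of expansions of the finite substructures. By precompactness the
  coherent families form a closed subspace of a countable product of finite discrete spaces.
\<close>

lemma X_compact_metrizable: "compact_space X" "Hausdorff_space X" "metrizable_space X"
proof -
  let ?D = "\<lambda>A. {A' \<in> \<K>'. reduct A' = induced K A}"
  let ?P = "product_topology (\<lambda>A. discrete_topology (?D A)) fin_closed"
  let ?C = "subtopology ?P coherent"
  have top: "topspace ?C = coherent" by (auto simp: coherent_def)
  have coord: "continuous_map ?P (discrete_topology UNIV) (\<lambda>p. p A)" if "A \<in> fin_closed" for A
  proof -
    have 1: "continuous_map ?P (discrete_topology (?D A)) (\<lambda>p. p A)"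
      by (rule continuous_map_product_projection[OF that])
    have 2: "continuous_map (discrete_topology (?D A)) (discrete_topology UNIV) id" by simp
    from continuous_map_compose[OF 1 2] show ?thesis by (simp add: o_def)
  qed
  have closed: "closedin ?P coherent"
  proof -
    have "closedin ?P {p \<in> topspace ?P. \<forall>A\<in>fin_closed. \<forall>B\<in>{B \<in> fin_closed. A \<subseteq> B}. p A = induced (p B) A}"
    proof (intro closedin_Collect_ball closedin_continuous_maps_eq[OF _ coord])
      fix A B assume B: "B \<in> {B \<in> fin_closed. A \<subseteq> B}"
      have "continuous_map ?P (discrete_topology UNIV) ((\<lambda>M. induced M A) \<circ> (\<lambda>p. p B))"
        by (rule continuous_map_compose[OF coord]) (use B in simp_all)
      then show "continuous_map ?P (discrete_topology UNIV) (\<lambda>p. induced (p B) A)" by (simp add: o_def)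
    qed simp_all
    then show ?thesis by (simp add: coherent_def)
  qed
  have fwd: "continuous_map X ?C (\<lambda>N. \<lambda>A\<in>fin_closed. induced N A)"
  proof (rule continuous_map_into_subtopology)
    show "continuous_map X ?P (\<lambda>N. \<lambda>A\<in>fin_closed. induced N A)"
      unfolding continuous_map_componentwise
    proof (intro conjI ballI)
      fix A assume A: "A \<in> fin_closed"
      have "continuous_map X (discrete_topology (?D A)) (\<lambda>N. induced N A)"
      proof (rule continuous_map_into_discrete)
        fix N assume "N \<in> topspace X"
        then have N: "N \<in> E" by simp
        show "induced N A \<in> ?D A" using E_D(2,3)[OF N] A by (simp add: reduct_induced)
        show "\<exists>V. openin X V \<and> N \<in> V \<and> (\<forall>y\<in>V. induced y A = induced N A)"
          using openin_basic[OF A N] N by blast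
      qed
      then show "continuous_map X (discrete_topology (?D A)) (\<lambda>N. (\<lambda>A\<in>fin_closed. induced N A) A)" using A by simp
    qed auto
    show "(\<lambda>N. \<lambda>A\<in>fin_closed. induced N A) \<in> topspace X \<rightarrow> coherent"
    proof
      fix N assume "N \<in> topspace X"
      then have N: "N \<in> E" by simp
      show "(\<lambda>A\<in>fin_closed. induced N A) \<in> coherent"
        using E_D(2,3)[OF N] by (auto simp: coherent_def reduct_induced induced_induced)
    qed
  qed
  have bwd: "continuous_map ?C X glue"
    unfolding continuous_map_def
  proof (intro conjI allI impI)
    show "glue \<in> topspace ?C \<rightarrow> topspace X" using glue_in_E top by simp
    fix U assume U: "openin X U"
    have "\<exists>V. openin ?C V \<and> p \<in> V \<and> V \<subseteq> {p \<in> topspace ?C. glue p \<in> U}" if pin: "p \<in> {p \<in> topspace ?C. glue p \<in> U}" for p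
    proof -
      have p: "p \<in> coherent" "glue p \<in> U" using pin top by auto
      obtain A where A: "finite A" "\<And>N'. N' \<in> E \<Longrightarrow> agree A (glue p) N' \<Longrightarrow> N' \<in> U"
        using U p(2) unfolding openin_X by blast
      obtain B where B: "B \<in> fin_closed" "A \<subseteq> B" using fin_closed_covers[OF A(1)] by blast
      let ?V = "{q \<in> topspace ?P. q B \<in> {p B}}"
      have "openin ?P ?V" by (rule openin_continuous_map_preimage[OF coord[OF B(1)]]) simp
      then have "openin ?C (?V \<inter> coherent)" by (auto simp: openin_subtopology)
      moreover have "p \<in> ?V \<inter> coherent" using p(1) by (auto simp: coherent_def)
      moreover have "?V \<inter> coherent \<subseteq> {p \<in> topspace ?C. glue p \<in> U}"
      proof
        fix q assume "q \<in> ?V \<inter> coherent"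
        then have q: "q \<in> coherent" "q B = p B" by auto
        have "induced (glue p) B = induced (glue q) B"
          using induced_glue[OF p(1) B(1)] induced_glue[OF q(1) B(1)] q(2) by simp
        then have "agree B (glue p) (glue q)"
          using induced_E_iff[OF glue_in_E[OF p(1)] glue_in_E[OF q(1)]] by blast
        then have "glue q \<in> U" using A(2)[OF glue_in_E[OF q(1)]] agree_mono[OF _ B(2)] by blast
        then show "q \<in> {p \<in> topspace ?C. glue p \<in> U}" using q(1) top by simp
      qed
      ultimately show ?thesis by blast
    qed
    then show "openin ?C {p \<in> topspace ?C. glue p \<in> U}" by (rule openinI)
  qed
  have "homeomorphic_maps X ?C (\<lambda>N. \<lambda>A\<in>fin_closed. induced N A) glue"
    unfolding homeomorphic_maps_def
  proof (intro conjI ballI fwd bwd)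
    show "(\<lambda>A\<in>fin_closed. induced (glue p) A) = p" if "p \<in> topspace ?C" for p
    proof (rule extensionalityI[of _ fin_closed])
      have p: "p \<in> coherent" using that top by simp
      show "p \<in> extensional fin_closed" by (rule coherentD(4)[OF p])
      show "(\<lambda>A\<in>fin_closed. induced (glue p) A) A = p A" if "A \<in> fin_closed" for A using induced_glue[OF p that] that by simp
    qed simp
    show "glue (\<lambda>A\<in>fin_closed. induced N A) = N" if "N \<in> topspace X" for N
    proof (rule struc_eqI)
      have N: "N \<in> E" using that by simp
      show "reduct (glue (\<lambda>A\<in>fin_closed. induced N A)) = reduct N" using E_D(2)[OF N] by (simp add: reduct_glue)
      show "rel_interp (glue (\<lambda>A\<in>fin_closed. induced N A)) (Inr R) = rel_interp N (Inr R)" for R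
      proof (intro Set.set_eqI)
        fix xs obtain A where "A \<in> fin_closed" "set xs \<subseteq> A" using fin_closed_covers[of "set xs"] by auto
        then show "xs \<in> rel_interp (glue (\<lambda>A\<in>fin_closed. induced N A)) (Inr R) \<longleftrightarrow> xs \<in> rel_interp N (Inr R)"
          by (auto simp: glue_rel)
      qed
    qed
  qed
  then have hom: "X homeomorphic_space ?C" unfolding homeomorphic_space_def by blast
  have fin: "finite (?D A)" if "A \<in> fin_closed" for A
    using precompact induced_K_age[OF that] unfolding precompact_expansion_def by blast
  have "compact_space ?P"
    using fin by (simp add: compact_space_product_topology compact_space_discrete_topology)
  then have "compact_space ?C" using closedin_compact_space[OF _ closed] by (simp add: compact_space_subtopology)
  then show "compact_space X" using homeomorphic_compact_space[OF hom] by simp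
  have "Hausdorff_space ?C" by (intro Hausdorff_space_subtopology) (simp add: Hausdorff_space_product_topology)
  then show "Hausdorff_space X" using homeomorphic_Hausdorff_space[OF hom] by simp
  have "countable {A \<in> fin_closed. \<not> (\<exists>a. topspace (discrete_topology (?D A)) \<subseteq> {a})}"
    by (rule countable_subset[OF _ countable_fin_closed]) auto
  then have "metrizable_space ?P"
    by (auto simp: metrizable_space_product_topology metrizable_space_discrete_topology)
  then have "metrizable_space ?C" by (rule metrizable_space_subtopology)
  then show "metrizable_space X" using homeomorphic_metrizable_space[OF hom] by simp
qed

lemma act_simps:
  assumes g: "g \<in> carrier G" and N: "N \<in> E"
  shows "reduct (act g N) = K"
    and "xs \<in> rel_interp (act g N) (Inr R) \<longleftrightarrow> map (pinv g) xs \<in> rel_interp N (Inr R)"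
proof -
  show "reduct (act g N) = K"
    using N E_D(2)[OF N] by (simp add: logic_action_def reduct_def)
  show "xs \<in> rel_interp (act g N) (Inr R) \<longleftrightarrow> map (pinv g) xs \<in> rel_interp N (Inr R)"
    using N structureD(4)[OF E_D(1)[OF N], of "map (pinv g) xs" "Inr R"]
    by (auto simp: logic_action_def mem_tuples)
qed

lemma act_agree:
  assumes "g \<in> carrier G" "h \<in> carrier G" "M \<in> E" "N \<in> E"
    and A: "\<And>x. x \<in> A \<Longrightarrow> pinv h x = pinv g x" and ag: "agree (pinv g ` A) M N"
  shows "agree A (act g M) (act h N)"
  unfolding agree_def
proof (intro allI impI)
  fix R xs assume xs: "set xs \<subseteq> A"
  have eq: "map (pinv h) xs = map (pinv g) xs" using A xs by (auto intro: map_cong)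
  have "set (map (pinv g) xs) \<subseteq> pinv g ` A" using xs by (simp add: image_mono)
  then have "map (pinv g) xs \<in> rel_interp M (Inr R) \<longleftrightarrow> map (pinv g) xs \<in> rel_interp N (Inr R)"
    using ag unfolding agree_def by blast
  then show "xs \<in> rel_interp (act g M) (Inr R) \<longleftrightarrow> xs \<in> rel_interp (act h N) (Inr R)"
    unfolding act_simps(2)[OF assms(1,3)] act_simps(2)[OF assms(2,4)] eq .
qed

lemma act_in_E: assumes g: "g \<in> carrier G" and N: "N \<in> E" shows "act g N \<in> E"
  unfolding E_iff
proof (intro conjI ballI)
  show red: "reduct (act g N) = K" by (rule act_simps(1)[OF g N])
  have u: "univ (act g N) = UNIV"
  proof -
    have "univ (reduct (act g N)) = UNIV" unfolding red by simp
    then show ?thesis by simp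
  qed
  show str: "lang_structure L' (act g N)"
  proof (rule expansion_structure[OF ext])
    show "lang_structure L (reduct (act g N))" by (simp add: red K_structure)
    show "Inr R \<in> rels L' \<and> xs \<in> tuples (univ (act g N)) (rel_arity L' (Inr R))"
      if "xs \<in> rel_interp (act g N) (Inr R)" for R xs
      using that structureD(4)[OF E_D(1)[OF N], of "map (pinv g) xs" "Inr R"] act_simps(2)[OF g N] u
      by (simp add: mem_tuples)
  qed
  fix A assume A: "A \<in> fin_closed"
  have ig: "pinv g \<in> carrier G" using g by simp
  show "induced (act g N) A \<in> \<K>'"
  proof (rule hereditary[OF E_D(3)[OF N fin_closed_image[OF A ig]]])
    show "lang_structure L' (induced (act g N) A)"
      by (rule induced_structure[OF str _ fin_closed_D(2)[OF A]]) (simp add: closed_in_reduct[OF ext] red fin_closed_D(3)[OF A])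
    show "finite (univ (induced (act g N) A))" using fin_closed_D(1)[OF A] by simp
    show "(\<lambda>x\<in>A. pinv g x) \<in> embeddings L' (induced (act g N) A) (induced N (pinv g ` A))"
    proof (rule embeddings_expansion[OF ext])
      show "(\<lambda>x\<in>A. pinv g x) \<in> embeddings L (reduct (induced (act g N) A)) (reduct (induced N (pinv g ` A)))"
        using aut_induced_embedding[OF A ig] by (simp add: reduct_induced red E_D(2)[OF N])
      fix R xs assume "xs \<in> tuples (univ (induced (act g N) A)) (rel_arity L' (Inr R))"
      then show "xs \<in> rel_interp (induced (act g N) A) (Inr R) \<longleftrightarrow>
          map (\<lambda>x\<in>A. pinv g x) xs \<in> rel_interp (induced N (pinv g ` A)) (Inr R)"
        using act_simps(2)[OF g N] by (auto simp: mem_tuples map_restrict_tuple)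
    qed
  qed
qed

lemma X_flow: "G_flow G T X act"
proof (rule G_flowI)
  show "topspace X \<noteq> {}" using inhabited by simp
  show "compact_space X" "Hausdorff_space X" by (rule X_compact_metrizable)+
  show "act g \<in> extensional (topspace X)" for g by (simp add: logic_action_def)
  show "act g N \<in> topspace X" if "g \<in> carrier G" "N \<in> topspace X" for g N using act_in_E that by simp
  show "act id N = N" if "N \<in> topspace X" for N
  proof (rule struc_eqI)
    have N: "N \<in> E" using that by simp
    show "reduct (act id N) = reduct N" using act_simps(1)[OF id_in N] E_D(2)[OF N] by simp
    show "rel_interp (act id N) (Inr R) = rel_interp N (Inr R)" for R
      using act_simps(2)[OF id_in N] by auto
  qed
  show "act (g \<circ> h) N = act g (act h N)" if g: "g \<in> carrier G" and h: "h \<in> carrier G" and "N \<in> topspace X" for g h N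
  proof (rule struc_eqI)
    have N: "N \<in> E" using that by simp
    show "reduct (act (g \<circ> h) N) = reduct (act g (act h N))"
      using act_simps(1)[OF comp_in[OF g h] N] act_simps(1)[OF g act_in_E[OF h N]] by simp
    show "rel_interp (act (g \<circ> h) N) (Inr R) = rel_interp (act g (act h N)) (Inr R)" for R
      using act_simps(2)[OF comp_in[OF g h] N] act_simps(2)[OF g act_in_E[OF h N]] act_simps(2)[OF h N] inv_comp[OF g h]
      by (auto simp: o_def)
  qed
  show "continuous_map (prod_topology T X) X (\<lambda>(g, N). act g N)"
    unfolding continuous_map_def
  proof (intro conjI allI impI)
    show "(\<lambda>(g, N). act g N) \<in> topspace (prod_topology T X) \<rightarrow> topspace X" using act_in_E by auto
    fix U assume U: "openin X U"
    let ?S = "{q \<in> topspace (prod_topology T X). (case q of (g, N) \<Rightarrow> act g N) \<in> U}"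
    have "\<exists>V. openin (prod_topology T X) V \<and> q \<in> V \<and> V \<subseteq> ?S" if qin: "q \<in> ?S" for q
    proof -
      obtain g N where q: "q = (g, N)" "g \<in> carrier G" "N \<in> E" "act g N \<in> U" using qin by auto
      obtain A where A: "finite A" "\<And>N'. N' \<in> E \<Longrightarrow> agree A (act g N) N' \<Longrightarrow> N' \<in> U"
        using U q(4) unfolding openin_X by blast
      let ?V1 = "{h \<in> carrier G. \<forall>x\<in>A. pinv h x = pinv g x}" and ?V2 = "{N' \<in> E. agree (pinv g ` A) N N'}"
      have "openin T ?V1" by (rule openin_T_agree_inv[OF A(1) q(2)])
      moreover have "openin X ?V2" by (rule openin_agree) (use A(1) in simp)
      ultimately have "openin (prod_topology T X) (?V1 \<times> ?V2)" by (simp add: openin_prod_Times_iff)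
      moreover have "q \<in> ?V1 \<times> ?V2" using q agree_refl by simp
      moreover have "?V1 \<times> ?V2 \<subseteq> ?S"
      proof
        fix r assume "r \<in> ?V1 \<times> ?V2"
        then obtain h N' where r: "r = (h, N')" "h \<in> carrier G" "\<And>x. x \<in> A \<Longrightarrow> pinv h x = pinv g x"
          "N' \<in> E" "agree (pinv g ` A) N N'" by auto
        have "act h N' \<in> U" by (rule A(2)[OF act_in_E[OF r(2,4)] act_agree[OF q(2) r(2) q(3) r(4) r(3) r(5)]])
        then show "r \<in> ?S" using r by simp
      qed
      ultimately show ?thesis by (intro exI[of _ "?V1 \<times> ?V2"] conjI)
    qed
    then show "openin (prod_topology T X) ?S" by (rule openinI)
  qed
qed

sublocale flow G T X act by unfold_locales (rule X_flow)

end

section \<open>Ramsey expansions give projective flows\<close>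

lemma isomorphisms_compose:
  assumes "lang_structure L A" "f \<in> isomorphisms L A B" "g \<in> isomorphisms L B C"
  shows "(\<lambda>x\<in>univ A. g (f x)) \<in> isomorphisms L A C"
proof -
  have "(\<lambda>x\<in>univ A. g (f x)) \<in> embeddings L A C"
    by (rule embeddings_compose[OF assms(1) isomorphismsD(1)[OF assms(2)] isomorphismsD(1)[OF assms(3)]])
  moreover have "(\<lambda>x\<in>univ A. g (f x)) ` univ A = univ C"
    using isomorphismsD(2)[OF assms(2)] isomorphismsD(2)[OF assms(3)] by (simp add: image_image[symmetric])
  ultimately show ?thesis by (simp add: isomorphisms_def)
qed

lemma embeddings_from_induced:
  assumes f: "f \<in> embeddings L A (induced M B)" and B: "B \<subseteq> univ M"
  shows "f \<in> embeddings L A M"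
proof (rule embeddingsI)
  have in_B: "set (map f xs) \<subseteq> B" if "xs \<in> tuples (univ A) n" for xs n
    using that embeddingsD(1)[OF f] by (auto simp: mem_tuples)
  show "f x \<in> univ M" if "x \<in> univ A" for x using embeddingsD(1)[OF f that] B by auto
  show "f (fun_interp A F xs) = fun_interp M F (map f xs)"
    if "F \<in> funs L" "xs \<in> tuples (univ A) (fun_arity L F)" for F xs
    using embeddingsD(4)[OF f that] in_B[OF that(2)] by simp
  show "xs \<in> rel_interp A R \<longleftrightarrow> map f xs \<in> rel_interp M R"
    if "R \<in> rels L" "xs \<in> tuples (univ A) (rel_arity L R)" for R xs
    using embeddingsD(5)[OF f that] in_B[OF that(2)] by simp
qed (use embeddingsD(2,3)[OF f] in auto)

lemma embeddings_rel:
  assumes A: "lang_structure L A" and B: "lang_structure L B" and f: "f \<in> embeddings L A B" and xs: "set xs \<subseteq> univ A"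
  shows "xs \<in> rel_interp A R \<longleftrightarrow> map f xs \<in> rel_interp B R"
proof (cases "R \<in> rels L \<and> length xs = rel_arity L R")
  case True
  then show ?thesis using embeddingsD(5)[OF f, of R xs] xs by (simp add: mem_tuples)
next
  case False
  then show ?thesis using structureD(4)[OF A, of xs R] structureD(4)[OF B, of "map f xs" R] by (auto simp: mem_tuples)
qed

text \<open>
  The limit of a back-and-forth construction is a function that agrees on each finite set with a member
  of the system; preservation of functions and relations concerns finitely many points at a time.
\<close>

lemma embeddings_local:
  assumes R: "lang_structure L R"
    and loc: "\<And>S. finite S \<Longrightarrow> S \<subseteq> univ R \<Longrightarrow>
      \<exists>A e. S \<subseteq> A \<and> e \<in> embeddings L (induced R A) N \<and> (\<forall>x\<in>A. \<theta> x = e x)"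
  shows "(\<lambda>x\<in>univ R. \<theta> x) \<in> embeddings L R N"
proof (rule embeddingsI)
  show "(\<lambda>x\<in>univ R. \<theta> x) x \<in> univ N" if x: "x \<in> univ R" for x
  proof -
    obtain A e where "x \<in> A" "e \<in> embeddings L (induced R A) N" "\<theta> x = e x" using loc[of "{x}"] x by auto
    then show ?thesis using embeddingsD(1)[of e L "induced R A" N x] x by simp
  qed
  show "inj_on (\<lambda>x\<in>univ R. \<theta> x) (univ R)"
  proof (rule inj_onI)
    fix x y assume xy: "x \<in> univ R" "y \<in> univ R" and eq: "(\<lambda>x\<in>univ R. \<theta> x) x = (\<lambda>x\<in>univ R. \<theta> x) y"
    obtain A e where A: "{x, y} \<subseteq> A" "e \<in> embeddings L (induced R A) N" "\<forall>x\<in>A. \<theta> x = e x"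
      using loc[of "{x, y}"] xy by auto
    then have "e x = e y" using eq xy by simp
    then show "x = y" using inj_onD[OF embeddingsD(3)[OF A(2)], of x y] A(1) by simp
  qed
next
  fix F xs assume F: "F \<in> funs L" and xs: "xs \<in> tuples (univ R) (fun_arity L F)"
  have v: "fun_interp R F xs \<in> univ R" by (rule structureD(2)[OF R F xs])
  obtain A e where A: "insert (fun_interp R F xs) (set xs) \<subseteq> A" "e \<in> embeddings L (induced R A) N" "\<forall>x\<in>A. \<theta> x = e x"
    using loc[of "insert (fun_interp R F xs) (set xs)"] v xs by (auto simp: mem_tuples)
  have "xs \<in> tuples (univ (induced R A)) (fun_arity L F)" using A xs by (simp add: mem_tuples)
  from embeddingsD(4)[OF A(2) F this] have "e (fun_interp R F xs) = fun_interp N F (map e xs)"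
    using A(1) by simp
  moreover have "map e xs = map (\<lambda>x\<in>univ R. \<theta> x) xs" using A(1,3) xs by (auto simp: mem_tuples)
  ultimately show "(\<lambda>x\<in>univ R. \<theta> x) (fun_interp R F xs) = fun_interp N F (map (\<lambda>x\<in>univ R. \<theta> x) xs)"
    using v A(1,3) by simp
next
  fix S xs assume S: "S \<in> rels L" and xs: "xs \<in> tuples (univ R) (rel_arity L S)"
  obtain A e where A: "set xs \<subseteq> A" "e \<in> embeddings L (induced R A) N" "\<forall>x\<in>A. \<theta> x = e x"
    using loc[of "set xs"] xs by (auto simp: mem_tuples)
  have "xs \<in> tuples (univ (induced R A)) (rel_arity L S)" using A xs by (simp add: mem_tuples)
  from embeddingsD(5)[OF A(2) S this] have "xs \<in> rel_interp R S \<longleftrightarrow> map e xs \<in> rel_interp N S"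
    using A(1) by simp
  moreover have "map e xs = map (\<lambda>x\<in>univ R. \<theta> x) xs" using A(1,3) xs by (auto simp: mem_tuples)
  ultimately show "xs \<in> rel_interp R S \<longleftrightarrow> map (\<lambda>x\<in>univ R. \<theta> x) xs \<in> rel_interp N S" by simp
qed simp

text \<open>
  In the back-and-forth, extending a finite partial isomorphism on the side of \<open>M\<close> uses the homogeneity
  of \<open>K\<close>; on the side of \<open>K\<close>, reasonableness expands the larger structure compatibly, and the
  homogeneity of \<open>M\<close> applies.
\<close>

lemma (in fraisse_limit) reduct_of_limit_isomorphic:
  fixes L' :: "('f, 'r + 's) lang" and M :: "('f, 'r + 's, nat) struc"
  assumes ext: "relational_extension L L'" and M: "fraisse_structure L' M"
    and red: "reduct ` age L' M = age L K"
    and reas: "reasonable_expansion L (age L K) L' (age L' M)"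
  shows "isomorphisms L (reduct M) K \<noteq> {}"
proof -
  let ?R = "reduct M"
  have Ms: "lang_structure L' M" and Mlf: "locally_finite L' M" and Mh: "ultrahomogeneous L' M"
    and Mc: "countable (univ M)" using M by (simp_all add: fraisse_structure_def)
  have Rs: "lang_structure L ?R" by (rule reduct_structure[OF ext Ms])
  define I where "I = {p. finite (fst p) \<and> fst p \<noteq> {} \<and> closed_in L' M (fst p) \<and>
      snd p \<in> embeddings L (induced ?R (fst p)) K}"
  have I_D: "finite (fst p)" "fst p \<noteq> {}" "closed_in L' M (fst p)" "closed_in L ?R (fst p)" "fst p \<subseteq> univ M"
    "snd p \<in> embeddings L (induced ?R (fst p)) K" "lang_structure L (induced ?R (fst p))"
    "lang_structure L' (induced M (fst p))" if "p \<in> I" for p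
  proof -
    show 1: "finite (fst p)" "fst p \<noteq> {}" "closed_in L' M (fst p)" "snd p \<in> embeddings L (induced ?R (fst p)) K"
      using that by (simp_all add: I_def)
    show 2: "closed_in L ?R (fst p)" using 1 closed_in_reduct[OF ext] by blast
    show "fst p \<subseteq> univ M" using 1 by (simp add: closed_in_def)
    show "lang_structure L (induced ?R (fst p))" by (rule induced_structure[OF Rs 2 1(2)])
    show "lang_structure L' (induced M (fst p))" by (rule induced_structure[OF Ms 1(3,2)])
  qed
  have in_age: "induced M B \<in> age L' M" if B: "finite B" "closed_in L' M B" "B \<noteq> {}" for B
    by (rule ageI[OF induced_structure[OF Ms B(2,3)] _ embeddings_induced[OF B(2)]]) (use B in simp)
  have emb_K: "embeddings L (induced ?R B) K \<noteq> {}" if B: "finite B" "closed_in L' M B" "B \<noteq> {}" for B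
  proof -
    have "reduct (induced M B) \<in> age L K" using in_age[OF B] red by blast
    then show ?thesis by (simp add: reduct_induced age_def)
  qed
  obtain m where m: "m \<in> univ M" using structureD(1)[OF Ms] by blast
  obtain A0 where A0: "finite A0" "{m} \<subseteq> A0" "closed_in L' M A0" "A0 \<noteq> {}"
    using finite_hull[OF Ms Mlf, of "{m}"] m by auto
  obtain e0 where e0: "e0 \<in> embeddings L (induced ?R A0) K" using emb_K[OF A0(1,3,4)] by blast
  have start: "(A0, e0) \<in> I" using A0 e0 by (simp add: I_def)
  have forth: "\<exists>q\<in>I. fst p \<subseteq> fst q \<and> u \<in> fst q \<and> (\<forall>x\<in>fst p. snd q x = snd p x)"
    if p: "p \<in> I" and u: "u \<in> univ M" for p u
  proof -
    let ?A = "fst p" and ?e = "snd p"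
    have "finite (insert u ?A)" "insert u ?A \<subseteq> univ M" using I_D[OF p] u by auto
    then obtain B where B: "finite B" "insert u ?A \<subseteq> B" "closed_in L' M B" "B \<noteq> {}"
      using finite_hull[OF Ms Mlf, of "insert u ?A"] by auto
    have B': "closed_in L ?R B" using B(3) closed_in_reduct[OF ext] by blast
    have RB: "lang_structure L (induced ?R B)" by (rule induced_structure[OF Rs B' B(4)])
    obtain j where j: "j \<in> embeddings L (induced ?R B) K" using emb_K[OF B(1,3,4)] by blast
    have "(\<lambda>x\<in>?A. j x) \<in> embeddings L (induced (induced ?R B) ?A) K"
    proof (rule embeddings_restrict[OF _ j])
      show "?A \<subseteq> univ (induced ?R B)" using B(2) by simp
      show "fun_interp (induced ?R B) F xs \<in> ?A" if "F \<in> funs L" "xs \<in> tuples ?A (fun_arity L F)" for F xs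
        using that I_D(4)[OF p] B(2) by (auto simp: closed_in_def mem_tuples induced_def)
    qed
    then have jA: "(\<lambda>x\<in>?A. j x) \<in> embeddings L (induced ?R ?A) K"
      using induced_induced[of ?A B ?R] B(2) by simp
    have "finite (univ (induced ?R ?A))" using I_D(1)[OF p] by simp
    then obtain g where g: "g \<in> carrier G" "\<And>x. x \<in> ?A \<Longrightarrow> g (j x) = ?e x"
      using embedding_extends[OF I_D(7)[OF p] _ jA I_D(6)[OF p]] by auto
    have "(B, \<lambda>x\<in>B. g (j x)) \<in> I"
      using B embedding_shift[OF g(1) RB j] by (simp add: I_def)
    then show ?thesis using B(2) g(2) by (intro bexI[of _ "(B, \<lambda>x\<in>B. g (j x))"]) auto
  qed
  have bak: "\<exists>q\<in>I. fst p \<subseteq> fst q \<and> v \<in> snd q ` fst q \<and> (\<forall>x\<in>fst p. snd q x = snd p x)"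
    if p: "p \<in> I" for p v
  proof -
    let ?A = "fst p" and ?e = "snd p"
    obtain C where C: "C \<in> fin_closed" "insert v (?e ` ?A) \<subseteq> C" using fin_closed_covers[of "insert v (?e ` ?A)"] I_D(1)[OF p] by auto
    have eC: "?e \<in> embeddings L (induced ?R ?A) (induced K C)"
      by (rule embeddings_into_induced[OF I_D(6)[OF p]]) (use C in simp)
    have A_age: "induced ?R ?A \<in> age L K"
      by (rule ageI[OF I_D(7)[OF p] _ I_D(6)[OF p]]) (simp add: I_D(1)[OF p])
    have "reduct (induced M ?A) = induced ?R ?A" by (rule reduct_induced)
    then obtain C' where C': "C' \<in> age L' M" "reduct C' = induced K C" "?e \<in> embeddings L' (induced M ?A) C'"
      using reas[unfolded reasonable_expansion_def, rule_format, OF A_age induced_K_age[OF C(1)] eC in_age[OF I_D(1,3,2)[OF p]]]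
      by blast
    have uC: "univ C' = C"
    proof -
      have "univ (reduct C') = C" unfolding C'(2) by simp
      then show ?thesis by simp
    qed
    obtain j where j: "j \<in> embeddings L' C' M" and C's: "lang_structure L' C'" using C'(1) by (auto simp: age_def)
    have je: "(\<lambda>x\<in>univ (induced M ?A). j (?e x)) \<in> embeddings L' (induced M ?A) M"
      by (rule embeddings_compose[OF I_D(8)[OF p] C'(3) j])
    have "finite (univ (induced M ?A))" using I_D(1)[OF p] by simp
    then obtain g where g: "g \<in> isomorphisms L' M M" "\<And>x. x \<in> ?A \<Longrightarrow> g (j (?e x)) = x"
      using homogeneous_extension[OF Mh I_D(8)[OF p] _ je embeddings_induced[OF I_D(3)[OF p]]] by auto
    define k where "k = (\<lambda>c\<in>C. g (j c))"
    have k: "k \<in> embeddings L' C' M"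
      using embeddings_compose[OF C's j isomorphismsD(1)[OF g(1)]] by (simp add: k_def uC)
    have kL: "k \<in> embeddings L (induced K C) ?R" using embeddings_reduct[OF ext k] by (simp add: C'(2))
    let ?i = "\<lambda>x\<in>C. x" and ?f = "\<lambda>y\<in>k ` C. (\<lambda>x\<in>C. x) (inv_into C k y)"
    have iC: "?i \<in> embeddings L (induced K C) K" by (rule induced_K_embedding[OF C(1)])
    have "?f \<in> isomorphisms L (induced ?R (k ` C)) (induced K (?i ` C))"
      using isomorphism_transfer[OF induced_K_structure[OF C(1)] kL iC] by simp
    then have f: "?f \<in> embeddings L (induced ?R (k ` C)) K"
      by (intro embeddings_from_induced[OF isomorphismsD(1)]) simp_all
    have fk: "?f (k c) = c" if "c \<in> C" for c
      using that inv_into_f_f[OF embeddingsD(3)[OF k], of c] by (simp add: uC)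
    have "closed_in L' M (k ` C)" using closed_image[OF C's k] by (simp add: uC)
    then have inI: "(k ` C, ?f) \<in> I" using f fin_closed_D(1,2)[OF C(1)] by (simp add: I_def)
    have ek: "?e x \<in> C \<and> k (?e x) = x" if "x \<in> ?A" for x
      using that C(2) g(2)[OF that] by (auto simp: k_def)
    have sub: "?A \<subseteq> k ` C" using ek by (metis image_eqI subsetI)
    have "?f x = ?e x" if "x \<in> ?A" for x
      using fk[of "?e x"] ek[OF that] by simp
    moreover have "v \<in> ?f ` (k ` C)"
    proof (rule image_eqI[of _ _ "k v"])
      show "v = ?f (k v)" using fk[of v] C(2) by simp
    qed (use C(2) in simp)
    ultimately show ?thesis using sub inI by (intro bexI[of _ "(k ` C, ?f)"]) auto
  qed
  have Une: "univ M \<noteq> {}" using m by blast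
  obtain \<theta> where \<theta>: "\<And>S. finite S \<Longrightarrow> S \<subseteq> univ M \<Longrightarrow> \<exists>q\<in>I. S \<subseteq> fst q \<and> (\<forall>x\<in>fst q. \<theta> x = snd q x)"
    "\<And>v::nat. v \<in> UNIV \<Longrightarrow> \<exists>q\<in>I. v \<in> snd q ` fst q \<and> (\<forall>x\<in>fst q. \<theta> x = snd q x)"
    by (rule back_and_forth[OF Mc Une _ _ forth bak start, where V = "UNIV :: nat set"]) auto
  let ?\<theta> = "\<lambda>x\<in>univ ?R. \<theta> x"
  have "?\<theta> \<in> embeddings L ?R K"
  proof (rule embeddings_local[OF Rs])
    fix S assume "finite S" "S \<subseteq> univ ?R"
    then obtain q where "q \<in> I" "S \<subseteq> fst q" "\<forall>x\<in>fst q. \<theta> x = snd q x" using \<theta>(1)[of S] by auto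
    then show "\<exists>A e. S \<subseteq> A \<and> e \<in> embeddings L (induced ?R A) K \<and> (\<forall>x\<in>A. \<theta> x = e x)"
      using I_D(6) by blast
  qed
  moreover have "?\<theta> ` univ ?R = UNIV"
  proof (intro equalityI subsetI)
    fix v :: nat
    obtain q where q: "q \<in> I" "v \<in> snd q ` fst q" "\<forall>x\<in>fst q. \<theta> x = snd q x" using \<theta>(2)[of v] by auto
    then obtain x where "x \<in> fst q" "v = \<theta> x" by auto
    then show "v \<in> ?\<theta> ` univ ?R" using I_D(5)[OF q(1)] by (intro image_eqI[of _ _ x]) auto
  qed simp
  ultimately have "?\<theta> \<in> isomorphisms L ?R K" by (simp add: isomorphisms_def)
  then show ?thesis by blast
qed

text \<open>
  The limit of the expanded class is transported to the universe of \<open>K\<close> along the isomorphism of its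
  reduct with \<open>K\<close>.
\<close>

lemma (in fraisse_limit) generic_expansion_exists:
  fixes L' :: "('f, 'r + 's) lang" and M :: "('f, 'r + 's, nat) struc"
  assumes ext: "relational_extension L L'" and M: "fraisse_structure L' M"
    and red: "reduct ` age L' M = age L K"
    and reas: "reasonable_expansion L (age L K) L' (age L' M)"
  obtains N where "lang_structure L' N" "reduct N = K"
    "\<forall>A\<in>age L' M. embeddings L' A N \<noteq> {}"
    "\<forall>A. lang_structure L' A \<and> finite (univ A) \<and> embeddings L' A N \<noteq> {} \<longrightarrow> A \<in> age L' M"
    "\<forall>A\<in>age L' M. \<forall>e\<in>embeddings L' A N. \<forall>e'\<in>embeddings L' A N.
      \<exists>g\<in>isomorphisms L' N N. \<forall>x\<in>univ A. g (e x) = e' x"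
proof -
  have Ms: "lang_structure L' M" and Mh: "ultrahomogeneous L' M"
    using M by (simp_all add: fraisse_structure_def)
  have Rs: "lang_structure L (reduct M)" by (rule reduct_structure[OF ext Ms])
  obtain \<theta> where "\<theta> \<in> isomorphisms L (reduct M) K"
    using reduct_of_limit_isomorphic[OF assms] by blast
  then obtain \<iota> where \<iota>: "\<iota> \<in> isomorphisms L K (reduct M)"
    using isomorphism_inverse[OF Rs _ K_structure] by blast
  define N where "N = pullback L' M \<iota> K"
  have Ns: "lang_structure L' N" unfolding N_def by (rule pullback_structure[OF ext K_structure])
  have "\<iota> \<in> embeddings L' N M" unfolding N_def by (rule pullback_embedding[OF ext isomorphismsD(1)[OF \<iota>]])
  then have \<iota>N: "\<iota> \<in> isomorphisms L' N M" using isomorphismsD(2)[OF \<iota>] by (simp add: isomorphisms_def N_def)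
  define \<kappa> where "\<kappa> = (\<lambda>y\<in>univ M. inv_into (univ N) \<iota> y)"
  have \<kappa>: "\<kappa> \<in> isomorphisms L' M N" unfolding \<kappa>_def by (rule isomorphism_inverse[OF Ns \<iota>N Ms])
  have \<kappa>\<iota>: "\<kappa> (\<iota> x) = x" if "x \<in> univ N" for x
    using that inv_into_f_f[OF embeddingsD(3)[OF isomorphismsD(1)[OF \<iota>N]] that]
      embeddingsD(1)[OF isomorphismsD(1)[OF \<iota>N] that] by (simp add: \<kappa>_def)
  show ?thesis
  proof (rule that[of N])
    show "lang_structure L' N" by (rule Ns)
    show "reduct N = K" by (simp add: N_def)
    show "\<forall>A\<in>age L' M. embeddings L' A N \<noteq> {}"
    proof
      fix A assume "A \<in> age L' M"
      then obtain j where "j \<in> embeddings L' A M" "lang_structure L' A" by (auto simp: age_def)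
      then show "embeddings L' A N \<noteq> {}" using embeddings_compose[OF _ _ isomorphismsD(1)[OF \<kappa>]] by blast
    qed
    show "\<forall>A. lang_structure L' A \<and> finite (univ A) \<and> embeddings L' A N \<noteq> {} \<longrightarrow> A \<in> age L' M"
    proof (intro allI impI)
      fix A :: "('f, 'r + 's, nat) struc"
      assume A: "lang_structure L' A \<and> finite (univ A) \<and> embeddings L' A N \<noteq> {}"
      then obtain f where "f \<in> embeddings L' A N" by blast
      with A show "A \<in> age L' M"
        using ageI[of L' A] embeddings_compose[of L' A f N \<iota> M] isomorphismsD(1)[OF \<iota>N] by blast
    qed
    show "\<forall>A\<in>age L' M. \<forall>e\<in>embeddings L' A N. \<forall>e'\<in>embeddings L' A N.
      \<exists>g\<in>isomorphisms L' N N. \<forall>x\<in>univ A. g (e x) = e' x"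
    proof (intro ballI)
    fix A e e'
    assume "A \<in> age L' M" and e: "e \<in> embeddings L' A N" "e' \<in> embeddings L' A N"
    then have A: "lang_structure L' A" "finite (univ A)" by (simp_all add: age_def)
    obtain g where g: "g \<in> isomorphisms L' M M"
      "\<And>x. x \<in> univ A \<Longrightarrow> g ((\<lambda>x\<in>univ A. \<iota> (e x)) x) = (\<lambda>x\<in>univ A. \<iota> (e' x)) x"
      using homogeneous_extension[OF Mh A embeddings_compose[OF A(1) e(1) isomorphismsD(1)[OF \<iota>N]]
          embeddings_compose[OF A(1) e(2) isomorphismsD(1)[OF \<iota>N]]] by metis
    let ?h = "\<lambda>x\<in>univ N. \<kappa> ((\<lambda>x\<in>univ N. g (\<iota> x)) x)"
    have h: "?h \<in> isomorphisms L' N N"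
      by (rule isomorphisms_compose[OF Ns isomorphisms_compose[OF Ns \<iota>N g(1)] \<kappa>])
    have "?h (e x) = e' x" if "x \<in> univ A" for x
      using g(2)[OF that] that \<kappa>\<iota> embeddingsD(1)[OF e(1) that] embeddingsD(1)[OF e(2) that] by simp
    then show "\<exists>g\<in>isomorphisms L' N N. \<forall>x\<in>univ A. g (e x) = e' x" using h by blast
    qed
  qed
qed

text \<open>A generic expansion is a point of the flow whose stabilizer is the automorphism group of a Fraisse structure.\<close>

locale generic_expansion = expansion_space L K L' \<K>'
  for L :: "('f, 'r) lang" and K and L' :: "('f, 'r + 's) lang" and \<K>' +
  fixes N :: "('f, 'r + 's, nat) struc"
  assumes N_in: "N \<in> expansions L K L' \<K>'"
    and universal: "A \<in> \<K>' \<Longrightarrow> embeddings L' A N \<noteq> {}"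
    and homogeneous: "A \<in> \<K>' \<Longrightarrow> e \<in> embeddings L' A N \<Longrightarrow> e' \<in> embeddings L' A N \<Longrightarrow>
      \<exists>g\<in>isomorphisms L' N N. \<forall>x\<in>univ A. g (e x) = e' x"
begin

lemma N_structure: "lang_structure L' N" by (rule E_D(1)[OF N_in])

definition H :: "(nat \<Rightarrow> nat) set" where
  "H = {h \<in> carrier G. act h N = N}"

lemma act_inverse_embedding:
  assumes g: "g \<in> carrier G" and M: "M \<in> E" and A: "A \<in> fin_closed"
  shows "(\<lambda>x\<in>A. pinv g x) \<in> embeddings L' (induced (act g M) A) M"
proof (rule embeddings_expansion[OF ext])
  have "(\<lambda>x\<in>univ (induced K A). pinv g ((\<lambda>x\<in>A. x) x)) \<in> embeddings L (induced K A) K"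
    by (rule embedding_shift[OF inv_in[OF g] induced_K_structure[OF A] induced_K_embedding[OF A]])
  moreover have "(\<lambda>x\<in>univ (induced K A). pinv g ((\<lambda>x\<in>A. x) x)) = (\<lambda>x\<in>A. pinv g x)" by auto
  ultimately show "(\<lambda>x\<in>A. pinv g x) \<in> embeddings L (reduct (induced (act g M) A)) (reduct M)"
    by (simp only: reduct_induced act_simps(1)[OF g M] E_D(2)[OF M])
  fix R xs assume "xs \<in> tuples (univ (induced (act g M) A)) (rel_arity L' (Inr R))"
  then show "xs \<in> rel_interp (induced (act g M) A) (Inr R) \<longleftrightarrow> map (\<lambda>x\<in>A. pinv g x) xs \<in> rel_interp M (Inr R)"
    using act_simps(2)[OF g M] by (simp add: mem_tuples map_restrict_tuple)
qed

lemma isomorphism_in_H: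
  assumes h: "h \<in> isomorphisms L' N N"
  shows "h \<in> H"
proof -
  have "h \<in> embeddings L K K" using embeddings_reduct[OF ext isomorphismsD(1)[OF h]] by (simp add: E_D(2)[OF N_in])
  then have hG: "h \<in> carrier G"
    using isomorphismsD(2)[OF h] by (simp add: carrier_G isomorphisms_def E_D(4)[OF N_in])
  have "act h N = N"
  proof (rule struc_eqI)
    show "reduct (act h N) = reduct N" using act_simps(1)[OF hG N_in] E_D(2)[OF N_in] by simp
    fix R
    show "rel_interp (act h N) (Inr R) = rel_interp N (Inr R)"
    proof (intro Set.set_eqI)
      fix xs
      have "map h (map (pinv h) xs) = xs" using hG by (simp add: map_idI)
      then show "xs \<in> rel_interp (act h N) (Inr R) \<longleftrightarrow> xs \<in> rel_interp N (Inr R)"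
        using embeddings_rel[OF N_structure N_structure isomorphismsD(1)[OF h], of "map (pinv h) xs" "Inr R"]
        by (simp only: act_simps(2)[OF hG N_in]) (simp add: E_D(4)[OF N_in])
    qed
  qed
  then show ?thesis using hG by (simp add: H_def)
qed

lemma homogeneous_H:
  assumes "A \<in> \<K>'" "e \<in> embeddings L' A N" "e' \<in> embeddings L' A N"
  obtains h where "h \<in> H" "\<forall>x\<in>univ A. h (e x) = e' x"
  using homogeneous[OF assms] isomorphism_in_H by blast

text \<open>
  The restriction of an expansion to a finite substructure \<open>B\<close> embeds into \<open>N\<close>, and this embedding
  extends to an automorphism of \<open>K\<close> by homogeneity; its inverse takes \<open>N\<close> to an expansion with the given
  restriction to \<open>B\<close>.
\<close>

lemma orbit_dense:
  assumes "openin X U" "U \<noteq> {}"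
  shows "\<exists>g\<in>carrier G. act g N \<in> U"
proof -
  obtain M where M: "M \<in> U" using assms(2) by blast
  obtain A where A: "finite A" "\<And>N'. N' \<in> E \<Longrightarrow> agree A M N' \<Longrightarrow> N' \<in> U"
    using assms(1) M unfolding openin_X by blast
  have ME: "M \<in> E" using assms(1) M unfolding openin_X by blast
  obtain B where B: "B \<in> fin_closed" "A \<subseteq> B" using fin_closed_covers[OF A(1)] by blast
  have BK: "induced M B \<in> \<K>'" by (rule E_D(3)[OF ME B(1)])
  obtain e where e: "e \<in> embeddings L' (induced M B) N" using universal[OF BK] by blast
  have eL: "e \<in> embeddings L (induced K B) K"
    using embeddings_reduct[OF ext e] by (simp add: reduct_induced E_D(2)[OF ME] E_D(2)[OF N_in])
  obtain g where g: "g \<in> carrier G" "\<And>x. x \<in> B \<Longrightarrow> g (e x) = x"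
    using embedding_extends[OF induced_K_structure[OF B(1)] _ eL induced_K_embedding[OF B(1)]] fin_closed_D(1)[OF B(1)] by auto
  have inv: "pinv g x = e x" if "x \<in> B" for x
    using inv_l[OF g(1), of "e x"] g(2)[OF that] by simp
  have "agree B M (act g N)"
    unfolding agree_def
  proof (intro allI impI)
    fix R xs assume xs: "set xs \<subseteq> B"
    have eq: "map (pinv g) xs = map e xs" using inv xs by auto
    show "xs \<in> rel_interp M (Inr R) \<longleftrightarrow> xs \<in> rel_interp (act g N) (Inr R)"
      unfolding act_simps(2)[OF g(1) N_in] eq
      using embeddings_rel[OF members[OF BK] N_structure e, of xs "Inr R"] xs by simp
  qed
  then have "act g N \<in> U" using A(2)[OF act_in_E[OF g(1) N_in]] agree_mono[OF _ B(2)] by blast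
  then show ?thesis using g(1) by blast
qed

lemma X_transitive: "topologically_transitive G X act"
  unfolding topologically_transitive_def
proof (intro allI impI)
  fix U V assume UV: "openin X U \<and> openin X V \<and> U \<noteq> {} \<and> V \<noteq> {}"
  obtain g where g: "g \<in> carrier G" "act g N \<in> U" using orbit_dense UV by blast
  obtain h where h: "h \<in> carrier G" "act h N \<in> V" using orbit_dense UV by blast
  have NX: "N \<in> topspace X" using N_in by simp
  have "act (h \<circ> pinv g) (act g N) = act h N"
    using g(1) h(1) NX by (simp add: act_comp del: topspace_X)
  then have "act h N \<in> act (h \<circ> pinv g) ` U" using g(2) by (metis image_eqI)
  then show "\<exists>g\<in>carrier G. act g ` U \<inter> V \<noteq> {}" using g(1) h by (intro bexI[of _ "h \<circ> pinv g"]) auto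
qed

text \<open>
  Embeddings of \<open>A\<close> into \<open>N\<close> are the restrictions of inverses of elements of \<open>H\<close>, so a colouring of
  \<open>H\<close> induces one of embeddings, and the Ramsey property of the age becomes a property of \<open>H\<close>.
\<close>

lemma oscillation_stable:
  assumes ramsey: "ramsey_property L' \<K>'"
    and A: "finite A" and F: "finite F" "F \<subseteq> H" and col: "col \<in> H \<rightarrow> {..<r::nat}"
  shows "\<exists>k\<in>H. \<exists>i. \<forall>h\<in>F. \<exists>h'\<in>H. col h' = i \<and> (\<forall>x\<in>A. pinv h' x = pinv (h \<circ> k) x)"
proof -
  have HG: "h \<in> carrier G" "act h N = N" if "h \<in> H" for h using that by (simp_all add: H_def)
  obtain A0 where A0: "A0 \<in> fin_closed" "A \<subseteq> A0" using fin_closed_covers[OF A] by blast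
  have "finite (A0 \<union> (\<Union>h\<in>F. pinv h ` A0))" using fin_closed_D(1)[OF A0(1)] F(1) by simp
  then obtain B0 where B0: "B0 \<in> fin_closed" "A0 \<union> (\<Union>h\<in>F. pinv h ` A0) \<subseteq> B0" by (rule fin_closed_covers)
  let ?A = "induced N A0" and ?B = "induced N B0"
  have AK: "?A \<in> \<K>'" and BK: "?B \<in> \<K>'" using E_D(3)[OF N_in] A0(1) B0(1) by simp_all
  have clA: "closed_in L' N A0" and clB: "closed_in L' N B0"
    using fin_closed_D(3)[OF A0(1)] fin_closed_D(3)[OF B0(1)] by (simp_all add: closed_in_reduct[OF ext] E_D(2)[OF N_in])
  have iA: "(\<lambda>x\<in>A0. x) \<in> embeddings L' ?A N" and iB: "(\<lambda>x\<in>B0. x) \<in> embeddings L' ?B N"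
    by (rule embeddings_induced[OF clA], rule embeddings_induced[OF clB])
  have "(\<lambda>x\<in>A0. x) \<in> embeddings L' ?A ?B"
    by (rule embeddings_into_induced[OF iA]) (use B0 in auto)
  then have AB: "embeddings L' ?A ?B \<noteq> {}" by blast
  have "id \<in> H" using X_flow act_id[of N] N_in by (simp add: H_def)
  then have "r \<ge> 1" using col by fastforce
  then obtain C where C: "C \<in> \<K>'" and mono: "\<And>c. c \<in> embeddings L' ?A C \<rightarrow> {..<r} \<Longrightarrow>
      \<exists>f\<in>embeddings L' ?B C. \<exists>k. \<forall>e\<in>embeddings L' ?A ?B. c (compose (univ ?A) f e) = k"
    using ramsey[unfolded ramsey_property_def, rule_format, OF AK BK AB, of r] by blast
  obtain j where j: "j \<in> embeddings L' C N" using universal[OF C] by blast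
  \<comment> \<open>Each embedding \<open>e\<close> of \<open>A\<close> into \<open>C\<close> is realized by an element of \<open>H\<close>, whose colour is given to \<open>e\<close>.\<close>
  have "\<exists>h\<in>H. \<forall>x\<in>A0. pinv h x = j (e x)" if e: "e \<in> embeddings L' ?A C" for e
  proof -
    have "(\<lambda>x\<in>univ ?A. j (e x)) \<in> embeddings L' ?A N" by (rule embeddings_compose[OF members[OF AK] e j])
    then obtain h where h: "h \<in> H" "\<forall>x\<in>univ ?A. h ((\<lambda>x\<in>univ ?A. j (e x)) x) = (\<lambda>x\<in>A0. x) x"
      by (rule homogeneous_H[OF AK _ iA])
    have "pinv h x = j (e x)" if "x \<in> A0" for x
      using inv_l[OF HG(1)[OF h(1)], of "j (e x)"] bspec[OF h(2), of x] that by simp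
    then show ?thesis using h(1) by blast
  qed
  then obtain hh where hh: "\<And>e. e \<in> embeddings L' ?A C \<Longrightarrow> hh e \<in> H \<and> (\<forall>x\<in>A0. pinv (hh e) x = j (e x))" by metis
  have "(\<lambda>e. col (hh e)) \<in> embeddings L' ?A C \<rightarrow> {..<r}" using hh col by blast
  from mono[OF this] obtain f i where f: "f \<in> embeddings L' ?B C"
    and i: "\<And>e. e \<in> embeddings L' ?A ?B \<Longrightarrow> col (hh (compose (univ ?A) f e)) = i" by blast
  have "(\<lambda>x\<in>univ ?B. j (f x)) \<in> embeddings L' ?B N" by (rule embeddings_compose[OF members[OF BK] f j])
  then obtain k where k: "k \<in> H" "\<forall>x\<in>univ ?B. k ((\<lambda>x\<in>univ ?B. j (f x)) x) = (\<lambda>x\<in>B0. x) x"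
    by (rule homogeneous_H[OF BK _ iB])
  have kinv: "pinv k x = j (f x)" if "x \<in> B0" for x
    using inv_l[OF HG(1)[OF k(1)], of "j (f x)"] bspec[OF k(2), of x] that by simp
  have "\<exists>h'\<in>H. col h' = i \<and> (\<forall>x\<in>A. pinv h' x = pinv (h \<circ> k) x)" if h: "h \<in> F" for h
  proof -
    have hH: "h \<in> H" using h F by blast
    define e where "e = (\<lambda>x\<in>A0. pinv h x)"
    have "e \<in> embeddings L' ?A N"
      using act_inverse_embedding[OF HG(1)[OF hH] N_in A0(1)] HG(2)[OF hH] by (simp add: e_def)
    then have e: "e \<in> embeddings L' ?A ?B"
      by (rule embeddings_into_induced) (use B0(2) h in \<open>auto simp: e_def\<close>)
    have ce: "compose (univ ?A) f e = (\<lambda>x\<in>univ ?A. f (e x))" by (simp add: compose_def)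
    have fe: "compose (univ ?A) f e \<in> embeddings L' ?A C"
      unfolding ce by (rule embeddings_compose[OF members[OF AK] e f])
    have "pinv (hh (compose (univ ?A) f e)) x = pinv (h \<circ> k) x" if x: "x \<in> A" for x
    proof -
      have xA: "x \<in> A0" using x A0 by blast
      have "pinv (hh (compose (univ ?A) f e)) x = j (compose (univ ?A) f e x)"
        using hh[OF fe] xA by blast
      also have "compose (univ ?A) f e x = f (pinv h x)" using xA by (simp add: compose_def e_def)
      also have "j (f (pinv h x)) = pinv k (pinv h x)"
        using kinv[of "pinv h x", symmetric] B0(2) xA h by blast
      also have "\<dots> = pinv (h \<circ> k) x" using HG(1)[OF hH] HG(1)[OF k(1)] by simp
      finally show ?thesis .
    qed
    then show ?thesis using hh[OF fe] i[OF e] by (intro bexI[of _ "hh (compose (univ ?A) f e)"]) simp_all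
  qed
  then show ?thesis using k(1) by blast
qed

lemma X_projective:
  assumes "ramsey_property L' \<K>'"
  shows "G_projective TYPE('u) G T X act"
proof (rule projective_if_oscillation_stable[where ?x0.0 = N and H = H])
  show "N \<in> topspace X" using N_in by simp
  show "\<exists>g\<in>carrier G. act g N \<in> U" if "openin X U" "U \<noteq> {}" for U by (rule orbit_dense[OF that])
  show "H = {h \<in> carrier G. act h N = N}" by (rule H_def)
  show "\<exists>k\<in>H. \<exists>i. \<forall>h\<in>F. \<exists>h'\<in>H. col h' = i \<and> (\<forall>x\<in>A. pinv h' x = pinv (h \<circ> k) x)"
    if "finite A" "finite F" "F \<subseteq> H" "col \<in> H \<rightarrow> {..<r}" for A F col and r :: nat
    by (rule oscillation_stable[OF assms that])
  fix A :: "nat set" and M assume A: "finite A" and "M \<in> topspace X"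
  then have M: "M \<in> E" by simp
  obtain B where B: "B \<in> fin_closed" "A \<subseteq> B" using fin_closed_covers[OF A] by blast
  let ?U = "{N' \<in> E. induced N' B = induced M B}"
  have "\<exists>h\<in>H. \<forall>y\<in>A. h (pinv g y) = pinv g' y"
    if g: "g \<in> carrier G" "act g N \<in> ?U" and g': "g' \<in> carrier G" "act g' N \<in> ?U" for g g'
  proof -
    have e: "(\<lambda>x\<in>B. pinv g x) \<in> embeddings L' (induced M B) N" "(\<lambda>x\<in>B. pinv g' x) \<in> embeddings L' (induced M B) N"
      using act_inverse_embedding[OF g(1) N_in B(1)] act_inverse_embedding[OF g'(1) N_in B(1)] g(2) g'(2) by simp_all
    obtain h where "h \<in> H" "\<forall>x\<in>univ (induced M B). h ((\<lambda>x\<in>B. pinv g x) x) = (\<lambda>x\<in>B. pinv g' x) x"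
      by (rule homogeneous_H[OF E_D(3)[OF M B(1)] e])
    then show ?thesis using B(2) by (intro bexI[of _ h]) (auto simp: subset_iff)
  qed
  then show "\<exists>U. openin X U \<and> M \<in> U \<and> (\<forall>g\<in>carrier G. \<forall>g'\<in>carrier G. act g N \<in> U \<longrightarrow> act g' N \<in> U \<longrightarrow>
      (\<exists>h\<in>H. \<forall>y\<in>A. h (pinv g y) = pinv g' y))"
    using openin_basic[OF B(1) M] M by (intro exI[of _ ?U]) blast
qed

end

lemma (in fraisse_limit) expansion_flow_properties:
  fixes L' :: "('f, 'r + 's) lang" and \<K>' :: "('f, 'r + 's, nat) struc set"
  assumes exp: "fraisse_expansion L (age L K) L' \<K>'"
    and reas: "reasonable_expansion L (age L K) L' \<K>'"
    and prec: "precompact_expansion (age L K) \<K>'"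
    and ramsey: "ramsey_property L' \<K>'"
  shows "G_flow G T (expansions_topology L K L' \<K>') (logic_action L K L' \<K>') \<and>
    metrizable_space (expansions_topology L K L' \<K>') \<and>
    topologically_transitive G (expansions_topology L K L' \<K>') (logic_action L K L' \<K>') \<and>
    G_projective TYPE('u) G T (expansions_topology L K L' \<K>') (logic_action L K L' \<K>')"
proof -
  have ext: "relational_extension L L'" and red: "reduct ` \<K>' = age L K"
    using exp by (simp_all add: fraisse_expansion_def)
  obtain M :: "('f, 'r + 's, nat) struc" where M: "fraisse_structure L' M" "\<K>' = age L' M"
    using exp by (auto simp: fraisse_expansion_def fraisse_class_def)
  obtain N where N: "lang_structure L' N" "reduct N = K"
    "\<forall>A\<in>age L' M. embeddings L' A N \<noteq> {}"
    "\<forall>A. lang_structure L' A \<and> finite (univ A) \<and> embeddings L' A N \<noteq> {} \<longrightarrow> A \<in> age L' M"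
    "\<forall>A\<in>age L' M. \<forall>e\<in>embeddings L' A N. \<forall>e'\<in>embeddings L' A N.
      \<exists>g\<in>isomorphisms L' N N. \<forall>x\<in>univ A. g (e x) = e' x"
    by (rule generic_expansion_exists[OF ext M(1) red[unfolded M(2)] reas[unfolded M(2)]])
  have NE: "N \<in> expansions L K L' \<K>'"
    unfolding expansions_def Fin_fin_closed
  proof (intro CollectI conjI ballI N(1,2))
    fix A assume "A \<in> induced K ` fin_closed"
    then obtain B where B: "B \<in> fin_closed" "univ A = B" by auto
    have cl: "closed_in L' N B" using fin_closed_D(3)[OF B(1)] by (simp add: closed_in_reduct[OF ext] N(2))
    show "induced N (univ A) \<in> \<K>'"
      unfolding B(2) M(2)
      using N(4) induced_structure[OF N(1) cl fin_closed_D(2)[OF B(1)]] embeddings_induced[OF cl] fin_closed_D(1)[OF B(1)] by auto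
  qed
  interpret generic_expansion L K L' \<K>' N
  proof unfold_locales
    show "relational_extension L L'" by (rule ext)
    show "precompact_expansion (age L K) \<K>'" by (rule prec)
    show "lang_structure L' A" if "A \<in> \<K>'" for A using that by (simp add: M(2) age_def)
    show "A \<in> \<K>'" if "B \<in> \<K>'" "lang_structure L' A" "finite (univ A)" "f \<in> embeddings L' A B" for A B f
      using age_hereditary that unfolding M(2) by blast
    show "expansions L K L' \<K>' \<noteq> {}" using NE by blast
    show "N \<in> expansions L K L' \<K>'" by (rule NE)
    show "embeddings L' A N \<noteq> {}" if "A \<in> \<K>'" for A using N(3) that by (simp add: M(2))
    show "\<exists>g\<in>isomorphisms L' N N. \<forall>x\<in>univ A. g (e x) = e' x"
      if "A \<in> \<K>'" "e \<in> embeddings L' A N" "e' \<in> embeddings L' A N" for A e e'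
      using N(5) that unfolding M(2) by blast
  qed
  show ?thesis using X_flow X_compact_metrizable(3) X_transitive X_projective[OF ramsey] by blast
qed

section \<open>Every metrizable transitive projective flow is a flow of expansions\<close>

lemma finite_image_factor:
  assumes fin: "finite (g ` S)" and fac: "\<And>x y. x \<in> S \<Longrightarrow> y \<in> S \<Longrightarrow> g x = g y \<Longrightarrow> f x = f y"
  shows "finite (f ` S)"
proof -
  let ?r = "\<lambda>c. SOME x. x \<in> S \<and> g x = c"
  have "f x \<in> (\<lambda>c. f (?r c)) ` g ` S" if x: "x \<in> S" for x
  proof -
    have r: "?r (g x) \<in> S \<and> g (?r (g x)) = g x" by (rule someI[of _ x]) (use x in simp)
    then have "f x = f (?r (g x))" using fac[of x "?r (g x)"] x by simp
    then show ?thesis using x by (intro image_eqI[of _ _ "g x"]) auto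
  qed
  then have "f ` S \<subseteq> (\<lambda>c. f (?r c)) ` g ` S" by (rule image_subsetI)
  then show ?thesis by (rule finite_subset) (use fin in simp)
qed

locale projective_expansion = fraisse_limit L K +
  metrizable_projective_flow "aut_group L K" "aut_topology L K" X a U
  for L :: "('f, 'r) lang" and K and X :: "'x topology" and a and U :: "'u itself" +
  fixes x0 :: 'x
  assumes x0: "x0 \<in> topspace X"
    and generic: "finite A \<Longrightarrow> finite B \<Longrightarrow> A \<subseteq> B \<Longrightarrow> y \<in> cell A x0 \<Longrightarrow> \<exists>g\<in>stab A. a g x0 \<in> cell B y"
    and dense: "finite A \<Longrightarrow> y \<in> topspace X \<Longrightarrow> \<exists>g\<in>carrier (aut_group L K). a g x0 \<in> cell A y"
begin

definition symbols :: "(nat list \<times> 'x set) set" where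
  "symbols = (SIGMA as:UNIV. {C. clopen (set as) C})"

definition symbol :: "nat \<Rightarrow> nat list \<times> 'x set" where
  "symbol = from_nat_into symbols"

lemma countable_symbols: "countable symbols"
  unfolding symbols_def by (intro countable_SIGMA) (simp_all add: countable_finite finite_clopens)

lemma symbols_nonempty: "symbols \<noteq> {}"
  using clopen_topspace by (auto simp: symbols_def)

lemma symbol_clopen: "clopen (set (fst (symbol n))) (snd (symbol n))"
  using from_nat_into[OF symbols_nonempty, of n] by (auto simp: symbol_def symbols_def)

lemma symbol_onto: "clopen (set as) C \<Longrightarrow> \<exists>n. symbol n = (as, C)"
  using from_nat_into_surj[OF countable_symbols, of "(as, C)"] by (auto simp: symbol_def symbols_def)

text \<open>
  Every finite tuple together with a clopen set invariant under its stabilizer gives a new relation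
  symbol. At \<open>x\<close> it holds of the translates \<open>g as\<close> of the tuple for which \<open>x\<close> lies in \<open>g C\<close>.
\<close>

definition L' :: "('f, 'r + nat) lang" where
  "L' = \<lparr>funs = funs L, rels = Inl ` rels L \<union> range Inr, fun_arity = fun_arity L,
     rel_arity = case_sum (rel_arity L) (\<lambda>n. length (fst (symbol n)))\<rparr>"

definition KX :: "'x \<Rightarrow> ('f, 'r + nat, nat) struc" where
  "KX x = \<lparr>univ = UNIV, fun_interp = fun_interp K,
     rel_interp = case_sum (rel_interp K)
       (\<lambda>n. {map g (fst (symbol n)) |g. g \<in> carrier G \<and> a (pinv g) x \<in> snd (symbol n)})\<rparr>"

lemma ext: "relational_extension L L'"
  by (auto simp: relational_extension_def L'_def)

lemma countable_L': "countable_lang L \<Longrightarrow> countable_lang L'"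
  by (simp add: countable_lang_def L'_def)

lemma reduct_KX [simp]: "reduct (KX x) = K"
  using univ_K by (simp add: reduct_def KX_def)

lemma univ_KX [simp]: "univ (KX x) = UNIV"
  by (simp add: KX_def)

lemma KX_rel: "xs \<in> rel_interp (KX x) (Inr n) \<longleftrightarrow>
    (\<exists>g\<in>carrier G. xs = map g (fst (symbol n)) \<and> a (pinv g) x \<in> snd (symbol n))"
  by (auto simp: KX_def)

lemma KX_structure: "lang_structure L' (KX x)"
proof (rule expansion_structure[OF ext])
  show "lang_structure L (reduct (KX x))" by (simp add: K_structure)
  show "Inr R \<in> rels L' \<and> xs \<in> tuples (univ (KX x)) (rel_arity L' (Inr R))"
    if "xs \<in> rel_interp (KX x) (Inr R)" for R xs
    using that by (auto simp: KX_rel L'_def mem_tuples)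
qed

lemma KX_shift:
  assumes g: "g \<in> carrier G" and x: "x \<in> topspace X"
  shows "xs \<in> rel_interp (KX (a g x)) (Inr n) \<longleftrightarrow> map (pinv g) xs \<in> rel_interp (KX x) (Inr n)"
proof
  assume "xs \<in> rel_interp (KX (a g x)) (Inr n)"
  then obtain h where h: "h \<in> carrier G" "xs = map h (fst (symbol n))" "a (pinv h) (a g x) \<in> snd (symbol n)"
    unfolding KX_rel by blast
  have "a (pinv (pinv g \<circ> h)) x = a (pinv h) (a g x)" using g h(1) x by (simp add: act_comp)
  moreover have "map (pinv g) xs = map (pinv g \<circ> h) (fst (symbol n))" by (simp add: h(2))
  moreover have "pinv g \<circ> h \<in> carrier G" using g h(1) by simp
  ultimately show "map (pinv g) xs \<in> rel_interp (KX x) (Inr n)" unfolding KX_rel using h(3) by metis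
next
  assume "map (pinv g) xs \<in> rel_interp (KX x) (Inr n)"
  then obtain h where h: "h \<in> carrier G" "map (pinv g) xs = map h (fst (symbol n))" "a (pinv h) x \<in> snd (symbol n)"
    unfolding KX_rel by blast
  have "a (pinv (g \<circ> h)) (a g x) = a (pinv h) x" using g h(1) x by (simp add: act_comp)
  moreover have "xs = map (g \<circ> h) (fst (symbol n))"
  proof -
    have "map g (map (pinv g) xs) = xs" using g by (simp add: map_idI)
    then show ?thesis unfolding h(2) by simp
  qed
  moreover have "g \<circ> h \<in> carrier G" using g h(1) by simp
  ultimately show "xs \<in> rel_interp (KX (a g x)) (Inr n)" unfolding KX_rel using h(3) by metis
qed

text \<open>
  Whether a relation holds of a tuple from \<open>A\<close> is a clopen condition on the point, invariant under
  \<open>stab A\<close>, and therefore decided by the cell.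
\<close>

lemma agree_if_cell_eq:
  assumes A: "finite A" and x: "x \<in> topspace X" and y: "y \<in> topspace X" and eq: "cell A x = cell A y"
  shows "agree A (KX x) (KX y)"
proof -
  have "xs \<in> rel_interp (KX y) (Inr n)"
    if xs: "set xs \<subseteq> A" "xs \<in> rel_interp (KX x) (Inr n)" and x: "x \<in> topspace X" and y: "y \<in> topspace X"
      and eq: "cell A x = cell A y" for x y xs n
  proof -
    obtain g where g: "g \<in> carrier G" "xs = map g (fst (symbol n))" "a (pinv g) x \<in> snd (symbol n)"
      using xs(2) unfolding KX_rel by blast
    let ?C = "a g ` snd (symbol n)"
    have sub: "snd (symbol n) \<subseteq> topspace X" using openin_subset[OF clopenD(1)[OF symbol_clopen]] .
    have "clopen (g ` set (fst (symbol n))) ?C" by (rule clopen_act[OF symbol_clopen g(1)])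
    then have C: "clopen A ?C" by (rule clopen_mono) (use xs(1) g(2) in simp)
    have "x \<in> ?C" using image_act_iff[OF g(1) sub x] g(3) by simp
    then have "y \<in> ?C" using cell_minimal[OF C] eq cell_self[of y A] by blast
    then have "a (pinv g) y \<in> snd (symbol n)" using image_act_iff[OF g(1) sub y] by simp
    then show ?thesis unfolding KX_rel using g(1,2) by blast
  qed
  then show ?thesis unfolding agree_def using x y eq by blast
qed

text \<open>
  An enumeration of \<open>A\<close> together with the cell of \<open>x\<close> is one of the symbols; its relation holds of this
  enumeration exactly at the points of the cell.
\<close>

lemma cell_eq_if_agree:
  assumes A: "finite A" and x: "x \<in> topspace X" and y: "y \<in> topspace X" and ag: "agree A (KX x) (KX y)"
  shows "cell A x = cell A y"
proof -
  obtain as where as: "set as = A" using finite_list[OF A] by blast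
  obtain n where n: "symbol n = (as, cell A x)" using symbol_onto[of as "cell A x"] cell_clopen[OF A x] as by auto
  have "as \<in> rel_interp (KX x) (Inr n)"
    unfolding KX_rel by (rule bexI[of _ id]) (use n x cell_self in \<open>simp_all add: inv_id\<close>)
  then have "as \<in> rel_interp (KX y) (Inr n)" using ag as unfolding agree_def by blast
  then obtain g where g: "g \<in> carrier G" "as = map g as" "a (pinv g) y \<in> cell A x"
    unfolding KX_rel n by auto
  have "g i = i" if "i \<in> A" for i
  proof -
    have "\<forall>i\<in>set as. g i = i" using g(2) by (metis map_eq_conv map_ident)
    then show ?thesis using that as by blast
  qed
  then have "pinv g \<in> stab A" using g(1) by (intro inv_stab) (simp add: stab_def)
  then have "y \<in> cell A x" using invariant_iff[OF clopenD(3)[OF cell_clopen[OF A x]] _ y] g(3) by blast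
  then show ?thesis using cell_eq[OF A x] by simp
qed

abbreviation "N \<equiv> KX x0"
abbreviation "\<K>' \<equiv> age L' N"

lemma partial_embedding:
  assumes A: "A \<in> fin_closed" and g: "g \<in> carrier G" and eq: "cell (g ` A) (a g x0) = cell (g ` A) x0"
  shows "(\<lambda>x\<in>A. g x) \<in> embeddings L' (induced N A) N"
proof (rule embeddings_expansion[OF ext])
  have "(\<lambda>x\<in>univ (induced K A). g ((\<lambda>x\<in>A. x) x)) \<in> embeddings L (induced K A) K"
    by (rule embedding_shift[OF g induced_K_structure[OF A] induced_K_embedding[OF A]])
  moreover have "(\<lambda>x\<in>univ (induced K A). g ((\<lambda>x\<in>A. x) x)) = (\<lambda>x\<in>A. g x)" by auto
  ultimately show "(\<lambda>x\<in>A. g x) \<in> embeddings L (reduct (induced N A)) (reduct N)"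
    by (simp only: reduct_induced reduct_KX)
  fix R xs assume "xs \<in> tuples (univ (induced N A)) (rel_arity L' (Inr R))"
  then have xs: "set xs \<subseteq> A" by (simp add: mem_tuples)
  have "agree (g ` A) (KX (a g x0)) N"
    by (rule agree_if_cell_eq[OF _ _ x0 eq]) (use A g x0 fin_closed_D(1) in auto)
  then have "map g xs \<in> rel_interp (KX (a g x0)) (Inr R) \<longleftrightarrow> map g xs \<in> rel_interp N (Inr R)"
    using xs unfolding agree_def by (simp add: image_mono)
  moreover have "map (pinv g) (map g xs) = xs" using g by (simp add: map_idI)
  ultimately have "map g xs \<in> rel_interp N (Inr R) \<longleftrightarrow> xs \<in> rel_interp N (Inr R)"
    using KX_shift[OF g x0, of "map g xs" R] by simp
  then show "xs \<in> rel_interp (induced N A) (Inr R) \<longleftrightarrow> map (\<lambda>x\<in>A. g x) xs \<in> rel_interp N (Inr R)"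
    using xs by (simp add: map_restrict_tuple)
qed

text \<open>
  The partial maps are restrictions of elements \<open>g\<close> of \<open>G\<close> that keep \<open>x0\<close> in its cell. A new point in
  the domain or range refines the cells, and genericity corrects \<open>g\<close> by an element that fixes the part
  already treated.
\<close>

lemma automorphism_from_cell:
  assumes A: "finite A" and g: "g \<in> carrier G" and eq: "cell (g ` A) (a g x0) = cell (g ` A) x0"
  shows "\<exists>h\<in>isomorphisms L' N N. \<forall>x\<in>A. h x = g x"
proof -
  define I :: "(nat set \<times> (nat \<Rightarrow> nat)) set" where
    "I = {p. finite (fst p) \<and> snd p \<in> carrier G \<and> cell (snd p ` fst p) (a (snd p) x0) = cell (snd p ` fst p) x0}"
  have start: "(A, g) \<in> I" using assms by (simp add: I_def)
  have forth: "\<exists>q\<in>I. fst p \<subseteq> fst q \<and> u \<in> fst q \<and> (\<forall>x\<in>fst p. snd q x = snd p x)" if p: "p \<in> I" for p u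
  proof -
    obtain A g where pe: "p = (A, g)" by fastforce
    have A: "finite A" and g: "g \<in> carrier G" and eq: "cell (g ` A) (a g x0) = cell (g ` A) x0"
      using p by (simp_all add: I_def pe)
    let ?A = "insert u A" and ?y = "a g x0"
    have yX: "?y \<in> topspace X" using g x0 by simp
    have fin: "finite (g ` A)" "finite (g ` ?A)" "g ` A \<subseteq> g ` ?A" using A by auto
    have "?y \<in> cell (g ` A) x0" using cell_self[of ?y "g ` A"] eq by simp
    then obtain k where k: "k \<in> stab (g ` A)" "a k x0 \<in> cell (g ` ?A) ?y" using generic[OF fin] by blast
    have kG: "k \<in> carrier G" by (rule stabD(1)[OF k(1)])
    have kx: "a k x0 \<in> topspace X" using kG x0 by simp
    have kA: "pinv k (g x) = g x" if "x \<in> A" for x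
      using stabD(2)[OF inv_stab[OF k(1)]] that by simp
    have ceq: "cell (g ` ?A) (a k x0) = cell (g ` ?A) ?y" by (rule cell_eq[OF fin(2) yX k(2)])
    have ik: "pinv k \<in> carrier G" using kG by simp
    have "cell (pinv k ` g ` ?A) (a (pinv k) ?y) = a (pinv k) ` cell (g ` ?A) ?y"
      by (rule cell_act[OF fin(2) yX ik])
    also have "\<dots> = cell (pinv k ` g ` ?A) (a (pinv k) (a k x0))"
      unfolding ceq[symmetric] by (rule cell_act[OF fin(2) kx ik, symmetric])
    also have "a (pinv k) (a k x0) = x0" using kG x0 by simp
    finally have "(?A, pinv k \<circ> g) \<in> I"
      using A g ik x0 by (simp add: I_def act_comp image_comp)
    then show ?thesis using kA by (intro bexI[of _ "(?A, pinv k \<circ> g)"]) (auto simp: pe)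
  qed
  have bak: "\<exists>q\<in>I. fst p \<subseteq> fst q \<and> v \<in> snd q ` fst q \<and> (\<forall>x\<in>fst p. snd q x = snd p x)" if p: "p \<in> I" for p v
  proof -
    obtain A g where pe: "p = (A, g)" by fastforce
    have A: "finite A" and g: "g \<in> carrier G" and eq: "cell (g ` A) (a g x0) = cell (g ` A) x0"
      using p by (simp_all add: I_def pe)
    let ?A = "insert (pinv g v) A" and ?y = "a (pinv g) x0"
    have ig: "pinv g \<in> carrier G" using g by simp
    have gx: "a g x0 \<in> topspace X" and yX: "?y \<in> topspace X" using g x0 by simp_all
    have fin: "finite A" "finite ?A" "A \<subseteq> ?A" "finite (g ` A)" using A by auto
    have gA: "pinv g ` g ` A = A" using g by (simp add: image_image)
    have "cell A ?y = a (pinv g) ` cell (g ` A) x0" using cell_act[OF fin(4) x0 ig] gA by simp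
    also have "\<dots> = cell A x0" using cell_act[OF fin(4) gx ig] gA eq g x0 by simp
    finally have "?y \<in> cell A x0" using cell_self[of ?y A] by simp
    then obtain k where k: "k \<in> stab A" "a k x0 \<in> cell ?A ?y" using generic[OF fin(1-3)] by blast
    have kG: "k \<in> carrier G" by (rule stabD(1)[OF k(1)])
    have kx: "a k x0 \<in> topspace X" using kG x0 by simp
    let ?B = "pinv k ` ?A"
    have kB: "k ` ?B = ?A" using kG by (simp add: image_image)
    have AB: "A \<subseteq> ?B"
    proof
      fix x assume "x \<in> A"
      then have "x = pinv k x" using stabD(2)[OF inv_stab[OF k(1)]] by simp
      then show "x \<in> ?B" using \<open>x \<in> A\<close> by blast
    qed
    have im: "(g \<circ> k) ` ?B = g ` ?A" using kB by (simp only: image_comp[symmetric])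
    have "cell (g ` ?A) (a g (a k x0)) = a g ` cell ?A (a k x0)" by (rule cell_act[OF fin(2) kx g])
    also have "\<dots> = a g ` cell ?A ?y" using cell_eq[OF fin(2) yX k(2)] by simp
    also have "\<dots> = cell (g ` ?A) (a g ?y)" by (rule cell_act[OF fin(2) yX g, symmetric])
    also have "a g ?y = x0" using g x0 by simp
    finally have "cell ((g \<circ> k) ` ?B) (a (g \<circ> k) x0) = cell ((g \<circ> k) ` ?B) x0"
      unfolding im using g kG x0 by (simp add: act_comp)
    moreover have "finite ?B" using A by simp
    moreover have "g \<circ> k \<in> carrier G" using g kG by simp
    ultimately have inI: "(?B, g \<circ> k) \<in> I" by (simp only: I_def mem_Collect_eq fst_conv snd_conv)
    have "v = g (pinv g v)" using g by simp
    then have "v \<in> (g \<circ> k) ` ?B" unfolding im by blast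
    moreover have "(g \<circ> k) x = g x" if "x \<in> A" for x using stabD(2)[OF k(1) that] by simp
    ultimately show ?thesis using AB inI by (intro bexI[of _ "(?B, g \<circ> k)"]) (simp_all add: pe)
  qed
  obtain f where f: "\<And>x. x \<in> fst (A, g) \<Longrightarrow> f x = snd (A, g) x"
    "\<And>S. finite S \<Longrightarrow> S \<subseteq> UNIV \<Longrightarrow> \<exists>q\<in>I. S \<subseteq> fst q \<and> (\<forall>x\<in>fst q. f x = snd q x)"
    "\<And>v::nat. v \<in> UNIV \<Longrightarrow> \<exists>q\<in>I. v \<in> snd q ` fst q \<and> (\<forall>x\<in>fst q. f x = snd q x)"
    by (rule back_and_forth[OF _ _ _ _ forth bak start, where U = "UNIV :: nat set" and V = "UNIV :: nat set"]) auto
  have "(\<lambda>x\<in>univ N. f x) \<in> embeddings L' N N"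
  proof (rule embeddings_local[OF KX_structure])
    fix S assume "finite S" "S \<subseteq> univ N"
    then obtain B where B: "B \<in> fin_closed" "S \<subseteq> B" using fin_closed_covers by blast
    obtain q where q: "q \<in> I" "B \<subseteq> fst q" "\<forall>x\<in>fst q. f x = snd q x" using f(2)[OF fin_closed_D(1)[OF B(1)]] by auto
    have q': "finite (fst q)" "snd q \<in> carrier G" "cell (snd q ` fst q) (a (snd q) x0) = cell (snd q ` fst q) x0"
      using q(1) by (simp_all add: I_def)
    have "cell (snd q ` B) (a (snd q) x0) = cell (snd q ` B) x0"
      by (rule cell_eq_mono[OF _ _ image_mono[OF q(2)] _ x0 q'(3)]) (use q' x0 fin_closed_D(1)[OF B(1)] in auto)
    then have "(\<lambda>x\<in>B. snd q x) \<in> embeddings L' (induced N B) N"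
      by (rule partial_embedding[OF B(1) q'(2)])
    moreover have "\<forall>x\<in>B. f x = (\<lambda>x\<in>B. snd q x) x" using q(2,3) by auto
    ultimately show "\<exists>A e. S \<subseteq> A \<and> e \<in> embeddings L' (induced N A) N \<and> (\<forall>x\<in>A. f x = e x)"
      using B(2) by blast
  qed
  then have emb: "f \<in> embeddings L' N N" by (simp add: restrict_UNIV)
  have "f ` UNIV = UNIV"
  proof (intro equalityI subsetI)
    fix v :: nat
    obtain q where q: "q \<in> I" "v \<in> snd q ` fst q" "\<forall>x\<in>fst q. f x = snd q x" using f(3)[of v] by auto
    then obtain x where "x \<in> fst q" "v = f x" by auto
    then show "v \<in> f ` UNIV" by simp
  qed simp
  then have "f \<in> isomorphisms L' N N" using emb by (simp add: isomorphisms_def)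
  then show ?thesis using f(1) by (intro bexI[of _ f]) auto
qed

lemma embedding_homogeneous:
  assumes A: "A \<in> fin_closed" and f: "f \<in> embeddings L' (induced N A) N"
  shows "\<exists>h\<in>isomorphisms L' N N. \<forall>x\<in>A. h x = f x"
proof -
  have cl: "closed_in L' N A" using fin_closed_D(3)[OF A] by (simp add: closed_in_reduct[OF ext])
  have fL: "f \<in> embeddings L (induced K A) K" using embeddings_reduct[OF ext f] by (simp add: reduct_induced)
  have "finite (univ (induced K A))" using fin_closed_D(1)[OF A] by simp
  then obtain g where g: "g \<in> carrier G" "\<And>x. x \<in> A \<Longrightarrow> g x = f x"
    using embedding_extends[OF induced_K_structure[OF A] _ induced_K_embedding[OF A] fL] by auto
  have "agree (g ` A) (KX (a g x0)) N"
    unfolding agree_def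
  proof (intro allI impI)
    fix R xs assume xs: "set xs \<subseteq> g ` A"
    have sub: "set (map (pinv g) xs) \<subseteq> A" using xs g(1) by auto
    have "map f (map (pinv g) xs) = map g (map (pinv g) xs)" using sub g(2) by (intro map_cong) auto
    also have "\<dots> = xs" using g(1) by (simp add: map_idI)
    finally have eq: "map f (map (pinv g) xs) = xs" .
    have "map (pinv g) xs \<in> rel_interp (induced N A) (Inr R) \<longleftrightarrow> map f (map (pinv g) xs) \<in> rel_interp N (Inr R)"
      by (rule embeddings_rel[OF induced_structure[OF KX_structure cl fin_closed_D(2)[OF A]] KX_structure f])
        (use sub in simp)
    then have "map (pinv g) xs \<in> rel_interp N (Inr R) \<longleftrightarrow> xs \<in> rel_interp N (Inr R)"
      unfolding eq using sub by simp
    then show "xs \<in> rel_interp (KX (a g x0)) (Inr R) \<longleftrightarrow> xs \<in> rel_interp N (Inr R)"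
      unfolding KX_shift[OF g(1) x0] .
  qed
  then have "cell (g ` A) (a g x0) = cell (g ` A) x0"
    by (intro cell_eq_if_agree) (use fin_closed_D(1)[OF A] g(1) x0 in auto)
  from automorphism_from_cell[OF fin_closed_D(1)[OF A] g(1) this] show ?thesis using g(2) by auto
qed

lemma N_fraisse: "fraisse_structure L' N"
proof -
  have "closed_in L' N = closed_in L K" by (simp add: fun_eq_iff closed_in_reduct[OF ext])
  then have "locally_finite L' N" using K_locally_finite by (simp add: locally_finite_def)
  moreover have "ultrahomogeneous L' N"
    unfolding ultrahomogeneous_def
  proof (intro ballI)
    fix A B f assume A: "A \<in> Fin L' N" and B: "B \<in> Fin L' N" and f: "f \<in> isomorphisms L' A B"
    obtain A' B' where A': "A = induced N A'" "finite A'" "A' \<noteq> {}" "closed_in L' N A'" and B': "B = induced N B'"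
      using A B unfolding Fin_def by blast
    have "A' \<in> fin_closed" using A' by (simp add: fin_closed_def closed_in_reduct[OF ext])
    moreover have "f \<in> embeddings L' (induced N A') N"
      using embeddings_from_induced[of f L' A N B'] isomorphismsD(1)[OF f] by (simp add: A' B')
    ultimately have "\<exists>h\<in>isomorphisms L' N N. \<forall>x\<in>A'. h x = f x" by (rule embedding_homogeneous)
    then show "\<exists>g\<in>isomorphisms L' N N. \<forall>x\<in>univ A. g x = f x" by (simp add: A'(1))
  qed
  ultimately show ?thesis by (simp add: fraisse_structure_def KX_structure)
qed

text \<open>
  The orbit of \<open>x0\<close> meets the cell of \<open>x\<close>, so the part of \<open>KX x\<close> below the image of \<open>e\<close> occurs in a
  translate of \<open>N\<close>.
\<close>

lemma pullback_in_age:
  assumes A: "lang_structure L A" "finite (univ A)" and e: "e \<in> embeddings L A K" and x: "x \<in> topspace X"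
  shows "pullback L' (KX x) e A \<in> \<K>'"
proof -
  let ?A = "e ` univ A" and ?P = "pullback L' (KX x) e A"
  have AF: "?A \<in> fin_closed" by (rule fin_closed_embedding_image[OF A e])
  have eP: "e \<in> embeddings L' ?P (KX x)" by (rule pullback_embedding[OF ext]) (simp add: e)
  have Ps: "lang_structure L' ?P" by (rule pullback_structure[OF ext A(1)])
  obtain g where g: "g \<in> carrier G" "a g x0 \<in> cell ?A x" using dense[OF fin_closed_D(1)[OF AF] x] by blast
  have gx: "a g x0 \<in> topspace X" using g(1) x0 by simp
  have "cell ?A (a g x0) = cell ?A x" by (rule cell_eq[OF fin_closed_D(1)[OF AF] x g(2)])
  then have ag: "agree ?A (KX x) (KX (a g x0))" using agree_if_cell_eq[OF fin_closed_D(1)[OF AF] x gx] by simp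
  have "(\<lambda>y\<in>univ ?P. pinv g (e y)) \<in> embeddings L' ?P N"
  proof (rule embeddings_expansion[OF ext])
    show "(\<lambda>y\<in>univ ?P. pinv g (e y)) \<in> embeddings L (reduct ?P) (reduct N)"
      using embedding_shift[OF inv_in[OF g(1)] A(1) e] by simp
    fix R xs assume "Inr R \<in> rels L'" and "xs \<in> tuples (univ ?P) (rel_arity L' (Inr R))"
    then have xs: "set xs \<subseteq> univ ?P" by (simp add: mem_tuples)
    have "xs \<in> rel_interp ?P (Inr R) \<longleftrightarrow> map e xs \<in> rel_interp (KX x) (Inr R)"
      by (rule embeddings_rel[OF Ps KX_structure eP xs])
    also have "\<dots> \<longleftrightarrow> map e xs \<in> rel_interp (KX (a g x0)) (Inr R)"
    proof -
      have "set (map e xs) \<subseteq> ?A" using xs by (simp add: image_mono)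
      then show ?thesis using ag unfolding agree_def by blast
    qed
    also have "\<dots> \<longleftrightarrow> map (pinv g) (map e xs) \<in> rel_interp N (Inr R)" by (rule KX_shift[OF g(1) x0])
    also have "map (pinv g) (map e xs) = map (\<lambda>y\<in>univ ?P. pinv g (e y)) xs"
      using map_restrict_tuple[OF xs, of "\<lambda>y. pinv g (e y)"] by (simp add: o_def)
    finally show "xs \<in> rel_interp ?P (Inr R) \<longleftrightarrow> map (\<lambda>y\<in>univ ?P. pinv g (e y)) xs \<in> rel_interp N (Inr R)" .
  qed
  from ageI[OF Ps _ this] show ?thesis by (simp add: A(2))
qed

text \<open>
  A copy of \<open>A\<close> in \<open>N\<close> can be moved to the copy \<open>e\<close> by an element of \<open>G\<close>; the point \<open>x\<close> is the
  corresponding translate of \<open>x0\<close>.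
\<close>

lemma age_is_pullback:
  assumes A: "A \<in> \<K>'" and e: "e \<in> embeddings L (reduct A) K"
  shows "\<exists>x\<in>topspace X. A = pullback L' (KX x) e (reduct A)"
proof -
  have As: "lang_structure L' A" and fin: "finite (univ (reduct A))" using A by (simp_all add: age_def)
  obtain f where f: "f \<in> embeddings L' A N" using A by (auto simp: age_def)
  have Rs: "lang_structure L (reduct A)" by (rule reduct_structure[OF ext As])
  have fL: "f \<in> embeddings L (reduct A) K" using embeddings_reduct[OF ext f] by simp
  obtain g where g: "g \<in> carrier G" "\<And>x. x \<in> univ (reduct A) \<Longrightarrow> g (e x) = f x"
    using embedding_extends[OF Rs fin e fL] by blast
  have ig: "pinv g \<in> carrier G" using g(1) by simp
  have "e \<in> embeddings L' A (KX (a (pinv g) x0))"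
  proof (rule embeddings_expansion[OF ext])
    show "e \<in> embeddings L (reduct A) (reduct (KX (a (pinv g) x0)))" by (simp add: e)
    fix R xs assume "xs \<in> tuples (univ A) (rel_arity L' (Inr R))"
    then have xs: "set xs \<subseteq> univ A" by (simp add: mem_tuples)
    have eq: "map (pinv (pinv g)) (map e xs) = map f xs" using g xs by auto
    show "xs \<in> rel_interp A (Inr R) \<longleftrightarrow> map e xs \<in> rel_interp (KX (a (pinv g) x0)) (Inr R)"
      unfolding KX_shift[OF ig x0] eq by (rule embeddings_rel[OF As KX_structure f xs])
  qed
  then have "A = pullback L' (KX (a (pinv g) x0)) e (reduct A)" by (rule pullback_unique[OF As])
  moreover have "a (pinv g) x0 \<in> topspace X" using ig x0 by simp
  ultimately show ?thesis by blast
qed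

lemma expansion: "countable_lang L \<Longrightarrow> fraisse_expansion L (age L K) L' \<K>'"
  unfolding fraisse_expansion_def fraisse_class_def
proof (intro conjI)
  show "\<exists>M :: ('f, 'r + nat, nat) struc. fraisse_structure L' M \<and> \<K>' = age L' M" using N_fraisse by blast
  show "reduct ` \<K>' = age L K"
  proof (intro equalityI subsetI)
    fix A assume "A \<in> reduct ` \<K>'"
    then obtain A' f where A': "A = reduct A'" "lang_structure L' A'" "finite (univ A')" "f \<in> embeddings L' A' N"
      by (auto simp: age_def)
    show "A \<in> age L K"
      unfolding A'(1)
      by (rule ageI[OF reduct_structure[OF ext A'(2)]]) (use A'(3) embeddings_reduct[OF ext A'(4)] in simp_all)
  next
    fix A assume "A \<in> age L K"
    then obtain e where "lang_structure L A" "finite (univ A)" "e \<in> embeddings L A K" by (auto simp: age_def)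
    then have "pullback L' N e A \<in> \<K>'" by (intro pullback_in_age x0)
    then show "A \<in> reduct ` \<K>'" by (rule image_eqI[rotated]) simp
  qed
qed (use countable_L' ext in simp_all)

lemma precompact: "precompact_expansion (age L K) \<K>'"
  unfolding precompact_expansion_def
proof
  fix A assume "A \<in> age L K"
  then obtain e where A: "lang_structure L A" "finite (univ A)" and e: "e \<in> embeddings L A K" by (auto simp: age_def)
  let ?A = "e ` univ A"
  have fin: "finite ?A" using A by simp
  have "finite ((\<lambda>x. pullback L' (KX x) e A) ` topspace X)"
  proof (rule finite_image_factor[OF finite_cells[OF fin]])
    fix x y assume xy: "x \<in> topspace X" "y \<in> topspace X" "cell ?A x = cell ?A y"
    have ag: "agree ?A (KX x) (KX y)" by (rule agree_if_cell_eq[OF fin xy])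
    show "pullback L' (KX x) e A = pullback L' (KX y) e A"
    proof (rule struc_eqI)
      fix R
      have "map e xs \<in> rel_interp (KX x) (Inr R) \<longleftrightarrow> map e xs \<in> rel_interp (KX y) (Inr R)"
        if "xs \<in> tuples (univ A) n" for xs n
      proof -
        have "set (map e xs) \<subseteq> ?A" using that by (simp add: mem_tuples image_mono)
        then show ?thesis using ag unfolding agree_def by blast
      qed
      then show "rel_interp (pullback L' (KX x) e A) (Inr R) = rel_interp (pullback L' (KX y) e A) (Inr R)"
        by auto
    qed simp
  qed
  moreover have "{A' \<in> \<K>'. reduct A' = A} \<subseteq> (\<lambda>x. pullback L' (KX x) e A) ` topspace X"
    using age_is_pullback e by blast
  ultimately show "finite {A' \<in> \<K>'. reduct A' = A}" by (rule rev_finite_subset)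
qed

text \<open>
  The expansion of \<open>A\<close> is induced by some \<open>KX x\<close> along the composition of \<open>f\<close> with an embedding \<open>j\<close> of
  \<open>B\<close> into \<open>K\<close>; the same \<open>x\<close> expands \<open>B\<close> along \<open>j\<close>.
\<close>

lemma reasonable: "reasonable_expansion L (age L K) L' \<K>'"
  unfolding reasonable_expansion_def
proof (intro ballI impI)
  fix A B f A' assume "A \<in> age L K" "B \<in> age L K" and f: "f \<in> embeddings L A B" and A': "A' \<in> \<K>'" "reduct A' = A"
  then have A: "lang_structure L A" and B: "lang_structure L B" "finite (univ B)" by (simp_all add: age_def)
  obtain j where j: "j \<in> embeddings L B K" using \<open>B \<in> age L K\<close> by (auto simp: age_def)
  let ?e = "\<lambda>x\<in>univ A. j (f x)"
  have e: "?e \<in> embeddings L A K" by (rule embeddings_compose[OF A f j])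
  obtain x where x: "x \<in> topspace X" "A' = pullback L' (KX x) ?e A"
    using age_is_pullback[OF A'(1), of ?e] e A'(2) by auto
  let ?B = "pullback L' (KX x) j B"
  have "f \<in> embeddings L' A' ?B"
  proof (rule embeddings_expansion[OF ext])
    show "f \<in> embeddings L (reduct A') (reduct ?B)" using f A'(2) by simp
    fix R xs assume R: "Inr R \<in> rels L'" and xs: "xs \<in> tuples (univ A') (rel_arity L' (Inr R))"
    have xsA: "xs \<in> tuples (univ A) (rel_arity L' (Inr R))" using xs by (simp add: x(2))
    have "map f xs \<in> tuples (univ B) (rel_arity L' (Inr R))"
      by (rule tuples_map[OF xsA embeddingsD(1)[OF f]])
    moreover have "map ?e xs = map j (map f xs)" using xsA by (simp add: mem_tuples map_restrict_tuple)
    ultimately show "xs \<in> rel_interp A' (Inr R) \<longleftrightarrow> map f xs \<in> rel_interp ?B (Inr R)"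
      using R xsA by (simp only: x(2) pullback_simps mem_Collect_eq simp_thms)
  qed
  moreover have "?B \<in> \<K>'" by (rule pullback_in_age[OF B j x(1)])
  ultimately show "\<exists>B'\<in>\<K>'. reduct B' = B \<and> f \<in> embeddings L' A' B'" by (intro bexI[of _ ?B]) simp_all
qed

lemma induced_KX_in_age:
  assumes x: "x \<in> topspace X" and A: "A \<in> fin_closed"
  shows "induced (KX x) A \<in> \<K>'"
proof -
  have cl: "closed_in L' (KX x) A" using fin_closed_D(3)[OF A] by (simp add: closed_in_reduct[OF ext])
  have s: "lang_structure L' (induced (KX x) A)" by (rule induced_structure[OF KX_structure cl fin_closed_D(2)[OF A]])
  have "induced (KX x) A = pullback L' (KX x) (\<lambda>x\<in>A. x) (reduct (induced (KX x) A))"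
    by (rule pullback_unique[OF s embeddings_induced[OF cl]])
  also have "reduct (induced (KX x) A) = induced K A" by (simp add: reduct_induced)
  also have "pullback L' (KX x) (\<lambda>x\<in>A. x) (induced K A) \<in> \<K>'"
    by (rule pullback_in_age[OF induced_K_structure[OF A] _ induced_K_embedding[OF A] x]) (simp add: fin_closed_D(1)[OF A])
  finally show ?thesis .
qed

lemma KX_in_expansions: "x \<in> topspace X \<Longrightarrow> KX x \<in> expansions L K L' \<K>'"
  unfolding expansions_def Fin_fin_closed using KX_structure induced_KX_in_age by auto

text \<open>
  The map \<open>KX\<close> is injective because cells separate points. An expansion in the space determines a cell
  for each finite substructure; these cells are directed, so by compactness they have a common point,
  which is the preimage.
\<close>

lemma flow_isomorphism:
  "G_flow_isomorphic G X a (expansions_topology L K L' \<K>') (logic_action L K L' \<K>')"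
proof -
  interpret E: expansion_space L K L' \<K>'
  proof unfold_locales
    show "relational_extension L L'" by (rule ext)
    show "precompact_expansion (age L K) \<K>'" by (rule precompact)
    show "lang_structure L' A" if "A \<in> \<K>'" for A using that by (simp add: age_def)
    show "A \<in> \<K>'" if "B \<in> \<K>'" "lang_structure L' A" "finite (univ A)" "f \<in> embeddings L' A B" for A B f
      by (rule age_hereditary[OF that])
    show "expansions L K L' \<K>' \<noteq> {}" using KX_in_expansions[OF x0] by blast
  qed
  have cont: "continuous_map X E.X KX"
    unfolding continuous_map_def
  proof (intro conjI allI impI)
    show "KX \<in> topspace X \<rightarrow> topspace E.X" using KX_in_expansions by simp
    fix V assume V: "openin E.X V"
    have "\<exists>W. openin X W \<and> x \<in> W \<and> W \<subseteq> {x \<in> topspace X. KX x \<in> V}" if xin: "x \<in> {x \<in> topspace X. KX x \<in> V}" for x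
    proof -
      have x: "x \<in> topspace X" "KX x \<in> V" using xin by simp_all
      obtain A where A: "finite A" "\<And>N'. N' \<in> E.E \<Longrightarrow> agree A (KX x) N' \<Longrightarrow> N' \<in> V"
        using V x(2) unfolding E.openin_X by blast
      have "cell A x \<subseteq> {x \<in> topspace X. KX x \<in> V}"
      proof
        fix y assume y: "y \<in> cell A x"
        have yX: "y \<in> topspace X" using y cell_subset[OF x(1)] by blast
        have "agree A (KX x) (KX y)"
          by (rule agree_if_cell_eq[OF A(1) x(1) yX cell_eq[OF A(1) x(1) y, symmetric]])
        then show "y \<in> {x \<in> topspace X. KX x \<in> V}" using A(2)[OF KX_in_expansions[OF yX]] yX by simp
      qed
      then show ?thesis using clopenD(1)[OF cell_clopen[OF A(1) x(1)]] cell_self by blast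
    qed
    then show "openin X {x \<in> topspace X. KX x \<in> V}" by (rule openinI)
  qed
  have inj: "inj_on KX (topspace X)"
  proof (rule inj_onI, rule ccontr)
    fix x y assume xy: "x \<in> topspace X" "y \<in> topspace X" and eq: "KX x = KX y" and "x \<noteq> y"
    then obtain A where A: "finite A" "y \<notin> cell A x" using cells_separate by blast
    have "agree A (KX x) (KX y)" unfolding eq by (rule agree_refl)
    then have "cell A x = cell A y" by (rule cell_eq_if_agree[OF A(1) xy])
    then show False using A(2) cell_self by blast
  qed
  have "N' \<in> KX ` topspace X" if N': "N' \<in> E.E" for N'
  proof -
    define C where "C A = {x \<in> topspace X. agree A (KX x) N'}" for A
    have C_closed: "closedin X (C A) \<and> C A \<noteq> {}" if A: "A \<in> fin_closed" for A
    proof -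
      have red: "reduct (induced N' A) = induced K A" by (simp add: reduct_induced E.E_D(2)[OF N'])
      obtain x where x: "x \<in> topspace X" "induced N' A = pullback L' (KX x) (\<lambda>x\<in>A. x) (induced K A)"
        using age_is_pullback[OF E.E_D(3)[OF N' A], of "\<lambda>x\<in>A. x"] induced_K_embedding[OF A] red by auto
      have cl: "closed_in L' (KX x) A" using fin_closed_D(3)[OF A] by (simp add: closed_in_reduct[OF ext])
      have s: "lang_structure L' (induced (KX x) A)" by (rule induced_structure[OF KX_structure cl fin_closed_D(2)[OF A]])
      have "induced (KX x) A = pullback L' (KX x) (\<lambda>x\<in>A. x) (induced K A)"
        using pullback_unique[OF s embeddings_induced[OF cl]] by (simp add: reduct_induced)
      then have "induced (KX x) A = induced N' A" using x(2) by simp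
      then have ag: "agree A (KX x) N'" using E.induced_E_iff[OF KX_in_expansions[OF x(1)] N'] by blast
      have "C A = cell A x"
      proof (intro equalityI subsetI)
        fix y assume "y \<in> C A"
        then have y: "y \<in> topspace X" "agree A (KX y) N'" by (simp_all add: C_def)
        then have "cell A x = cell A y"
          using cell_eq_if_agree[OF fin_closed_D(1)[OF A] x(1) y(1)] agree_trans[OF ag agree_sym[OF y(2)]] by blast
        then show "y \<in> cell A x" using cell_self by simp
      next
        fix y assume y: "y \<in> cell A x"
        have yX: "y \<in> topspace X" using y cell_subset[OF x(1)] by blast
        have "agree A (KX y) (KX x)"
          by (rule agree_if_cell_eq[OF fin_closed_D(1)[OF A] yX x(1) cell_eq[OF fin_closed_D(1)[OF A] x(1) y]])
        then show "y \<in> C A" using agree_trans[OF _ ag] yX by (simp add: C_def)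
      qed
      then show ?thesis using clopenD(2)[OF cell_clopen[OF fin_closed_D(1)[OF A] x(1)]] cell_self by auto
    qed
    have "\<Inter> (C ` fin_closed) \<noteq> {}"
    proof (rule compact[unfolded compact_space_fip, rule_format], intro conjI ballI allI impI)
      show "closedin X D" if "D \<in> C ` fin_closed" for D using that C_closed by blast
      fix \<F> assume "finite \<F> \<and> \<F> \<subseteq> C ` fin_closed"
      then obtain J where J: "finite J" "J \<subseteq> fin_closed" "\<F> = C ` J" by (meson finite_subset_image)
      have "finite (\<Union>J)" using J fin_closed_D(1) by blast
      then obtain B where B: "B \<in> fin_closed" "\<Union>J \<subseteq> B" by (rule fin_closed_covers)
      obtain x where x: "x \<in> C B" using C_closed[OF B(1)] by blast
      have "x \<in> C A" if "A \<in> J" for A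
      proof -
        have "A \<subseteq> B" using B(2) that by blast
        then show ?thesis using x agree_mono by (auto simp: C_def)
      qed
      then show "\<Inter>\<F> \<noteq> {}" using J(3) by blast
    qed
    then obtain x where x: "\<And>A. A \<in> fin_closed \<Longrightarrow> x \<in> C A" by blast
    obtain B where "B \<in> fin_closed" using fin_closed_covers[of "{}"] by auto
    then have xX: "x \<in> topspace X" using x by (auto simp: C_def)
    have "KX x = N'"
    proof (rule E.E_eqI[OF KX_in_expansions[OF xX] N'])
      fix A :: "nat set" assume "finite A"
      then obtain B where B: "B \<in> fin_closed" "A \<subseteq> B" by (rule fin_closed_covers)
      then show "agree A (KX x) N'" using x[OF B(1)] agree_mono by (auto simp: C_def)
    qed
    then show ?thesis using xX by blast
  qed
  then have onto: "KX ` topspace X = topspace E.X" using KX_in_expansions by auto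
  have "homeomorphic_map X E.X KX"
    by (rule continuous_imp_homeomorphic_map[OF cont compact E.X_compact_metrizable(2) onto inj])
  moreover have "G_map G X a E.X E.act KX"
    unfolding G_map_def
  proof (intro conjI ballI cont)
    fix g x assume g: "g \<in> carrier G" and x: "x \<in> topspace X"
    have KxE: "KX x \<in> E.E" by (rule KX_in_expansions[OF x])
    show "KX (a g x) = E.act g (KX x)"
    proof (rule struc_eqI)
      show "reduct (KX (a g x)) = reduct (E.act g (KX x))" using E.act_simps(1)[OF g KxE] by simp
      show "rel_interp (KX (a g x)) (Inr R) = rel_interp (E.act g (KX x)) (Inr R)" for R
        using KX_shift[OF g x] E.act_simps(2)[OF g KxE] by blast
    qed
  qed
  ultimately show ?thesis unfolding G_flow_isomorphic_def by blast
qed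

end

section \<open>The Ramsey property from projectivity\<close>

context projective_expansion
begin

text \<open>
  If \<open>A\<close>, \<open>B\<close> and \<open>r\<close> violate the Ramsey property, then by compactness every \<open>x\<close> admits a colouring of
  the copies of \<open>A\<close> in \<open>K\<close> without monochromatic copy of \<open>B\<close> in \<open>KX x\<close>. An equivariant continuous
  selection of such colourings gives all copies of \<open>A\<close> in \<open>N\<close> the same colour, because these copies
  correspond to translates of \<open>x0\<close> in a single cell, a contradiction.
\<close>

lemma ramsey: "ramsey_property L' \<K>'"
  unfolding ramsey_property_def
proof (intro ballI impI allI, rule ccontr)
  fix A B and r :: nat
  assume AK: "A \<in> \<K>'" and BK: "B \<in> \<K>'" and AB: "embeddings L' A B \<noteq> {}" and r: "r \<ge> 1"
    and no: "\<not> (\<exists>C\<in>\<K>'. \<forall>col\<in>embeddings L' A C \<rightarrow> {..<r}. \<exists>f\<in>embeddings L' B C. \<exists>k.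
        \<forall>e\<in>embeddings L' A B. col (compose (univ A) f e) = k)"
  have As: "lang_structure L' A" and Bs: "lang_structure L' B" and fA: "finite (univ A)" and fB: "finite (univ B)"
    using AK BK by (simp_all add: age_def)
  have ARs: "lang_structure L (reduct A)" and BRs: "lang_structure L (reduct B)"
    using reduct_structure[OF ext] As Bs by blast+
  obtain e0 where e0: "e0 \<in> embeddings L' A N" using AK by (auto simp: age_def)
  have e0L: "e0 \<in> embeddings L (reduct A) K" using embeddings_reduct[OF ext e0] by simp
  let ?S = "e0 ` univ A"
  have fS: "finite ?S" using fA by simp
  let ?E = "embeddings L' A B" and ?F = "embeddings L (reduct B) K"
  have "?E \<subseteq> univ A \<rightarrow>\<^sub>E univ B" by (auto simp: embeddings_def)
  then have finE: "finite ?E" using finite_PiE[OF fA, of "\<lambda>_. univ B"] fB finite_subset by blast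
  \<comment> \<open>The copies of \<open>A\<close> in \<open>K\<close> are the translates of the copy \<open>e0\<close>, so they correspond to cosets of the
  stabilizer of its image; \<open>t f e\<close> will represent the copy \<open>f \<circ> e\<close>.\<close>
  have "\<exists>g\<in>carrier G. \<forall>y\<in>univ A. g (e0 y) = f (e y)" if f: "f \<in> ?F" and e: "e \<in> ?E" for f e
  proof -
    have fe: "(\<lambda>y\<in>univ (reduct A). f (e y)) \<in> embeddings L (reduct A) K"
      by (rule embeddings_compose[OF ARs embeddings_reduct[OF ext e] f])
    have "finite (univ (reduct A))" using fA by simp
    then obtain g where "g \<in> carrier G" "\<And>y. y \<in> univ (reduct A) \<Longrightarrow> g (e0 y) = (\<lambda>y\<in>univ (reduct A). f (e y)) y"
      using embedding_extends[OF ARs _ e0L fe] by blast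
    then show ?thesis by (intro bexI[of _ g]) simp_all
  qed
  then have "\<forall>f\<in>?F. \<forall>e\<in>?E. \<exists>g. g \<in> carrier G \<and> (\<forall>y\<in>univ A. g (e0 y) = f (e y))" by blast
  then obtain t where t: "\<forall>f\<in>?F. \<forall>e\<in>?E. t f e \<in> carrier G \<and> (\<forall>y\<in>univ A. t f e (e0 y) = f (e y))" by metis
  have tG: "t f e \<in> carrier G" and te: "y \<in> univ A \<Longrightarrow> t f e (e0 y) = f (e y)" if "f \<in> ?F" "e \<in> ?E" for f e y
    using t that by blast+
  let ?C = "product_topology (\<lambda>_. discrete_topology {..<r}) (carrier G)"
  define coset_colourings where "coset_colourings = {c \<in> topspace ?C. \<forall>g\<in>carrier G. \<forall>h\<in>{h \<in> carrier G. \<forall>y\<in>?S. g y = h y}. c g = c h}"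
  define polychromatic where "polychromatic f = {c \<in> topspace ?C. \<exists>e\<in>?E. \<exists>e'\<in>?E. c (t f e) \<noteq> c (t f e')}" for f
  have coset_closed: "closedin ?C coset_colourings"
    unfolding coset_colourings_def
  proof (intro closedin_Collect_ball)
    fix g h assume "g \<in> carrier G" "h \<in> {h \<in> carrier G. \<forall>y\<in>?S. g y = h y}"
    then show "closedin ?C {c \<in> topspace ?C. c g = c h}"
      by (intro closedin_continuous_maps_eq[OF _ continuous_map_product_projection continuous_map_product_projection]) simp_all
  qed
  have polychromatic_closed: "closedin ?C (polychromatic f)" if f: "f \<in> ?F" for f
  proof -
    let ?M = "{c \<in> topspace ?C. \<forall>e\<in>?E. \<forall>e'\<in>?E. c (t f e) = c (t f e')}"
    have "openin ?C ?M"
      unfolding openin_product_discrete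
    proof (intro conjI ballI)
      fix c assume c: "c \<in> ?M"
      show "\<exists>J. finite J \<and> J \<subseteq> carrier G \<and> (\<forall>h\<in>carrier G \<rightarrow>\<^sub>E {..<r}. (\<forall>i\<in>J. h i = c i) \<longrightarrow> h \<in> ?M)"
      proof (intro exI[of _ "t f ` ?E"] conjI ballI impI)
        show "finite (t f ` ?E)" using finE by simp
        show "t f ` ?E \<subseteq> carrier G" using tG[OF f] by blast
        fix d assume d: "d \<in> carrier G \<rightarrow>\<^sub>E {..<r}" "\<forall>i\<in>t f ` ?E. d i = c i"
        have eq: "d (t f e) = c (t f e)" if "e \<in> ?E" for e using d(2) that by blast
        have deq: "d (t f e) = d (t f e')" if "e \<in> ?E" "e' \<in> ?E" for e e'
        proof -
          have "c (t f e) = c (t f e')" using c that by blast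
          then show ?thesis by (simp only: eq[OF that(1)] eq[OF that(2)])
        qed
        have "d \<in> topspace ?C" using d(1) by simp
        then show "d \<in> ?M" by (intro CollectI conjI ballI deq)
      qed
    qed auto
    then have "closedin ?C (topspace ?C - ?M)" by (rule closedin_diff[OF closedin_topspace])
    moreover have "topspace ?C - ?M = polychromatic f" unfolding polychromatic_def by blast
    ultimately show ?thesis by simp
  qed
  let ?P = "prod_topology X ?C"
  define W where "W = {p \<in> topspace ?P. snd p \<in> coset_colourings \<and> (\<forall>f\<in>?F. f \<in> embeddings L' B (KX (fst p)) \<longrightarrow> snd p \<in> polychromatic f)}"
  have emb_open: "openin X {x \<in> topspace X. f \<in> embeddings L' B (KX x)}" if f: "f \<in> ?F" for f
  proof -
    let ?D = "f ` univ B"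
    have fD: "finite ?D" using fB by simp
    have "\<exists>V. openin X V \<and> x \<in> V \<and> V \<subseteq> {x \<in> topspace X. f \<in> embeddings L' B (KX x)}"
      if xin: "x \<in> {x \<in> topspace X. f \<in> embeddings L' B (KX x)}" for x
    proof -
      have x: "x \<in> topspace X" "f \<in> embeddings L' B (KX x)" using xin by simp_all
      have "cell ?D x \<subseteq> {x \<in> topspace X. f \<in> embeddings L' B (KX x)}"
      proof
        fix y assume y: "y \<in> cell ?D x"
        have yX: "y \<in> topspace X" using y cell_subset[OF x(1)] by blast
        have ag: "agree ?D (KX x) (KX y)"
          by (rule agree_if_cell_eq[OF fD x(1) yX cell_eq[OF fD x(1) y, symmetric]])
        have "f \<in> embeddings L' B (KX y)"
        proof (rule embeddings_expansion[OF ext])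
          show "f \<in> embeddings L (reduct B) (reduct (KX y))" by (simp add: f)
          fix R xs assume "xs \<in> tuples (univ B) (rel_arity L' (Inr R))"
          then have xs: "set xs \<subseteq> univ B" by (simp add: mem_tuples)
          then have "set (map f xs) \<subseteq> ?D" by (simp add: image_mono)
          then have "map f xs \<in> rel_interp (KX x) (Inr R) \<longleftrightarrow> map f xs \<in> rel_interp (KX y) (Inr R)"
            using ag unfolding agree_def by blast
          then show "xs \<in> rel_interp B (Inr R) \<longleftrightarrow> map f xs \<in> rel_interp (KX y) (Inr R)"
            using embeddings_rel[OF Bs KX_structure x(2) xs] by blast
        qed
        then show "y \<in> {x \<in> topspace X. f \<in> embeddings L' B (KX x)}" using yX by simp
      qed
      then show ?thesis using clopenD(1)[OF cell_clopen[OF fD x(1)]] cell_self by blast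
    qed
    then show ?thesis by (rule openinI)
  qed
  have w1: "closedin ?P W"
    unfolding W_def
  proof (intro closedin_Collect_conj closedin_Collect_ball closedin_Collect_imp)
    show "closedin ?P {p \<in> topspace ?P. snd p \<in> coset_colourings}"
      by (rule closedin_continuous_map_preimage[OF continuous_map_snd coset_closed])
    fix f assume f: "f \<in> ?F"
    show "closedin ?P {p \<in> topspace ?P. snd p \<in> polychromatic f}"
      by (rule closedin_continuous_map_preimage[OF continuous_map_snd polychromatic_closed[OF f]])
    have "openin ?P {p \<in> topspace ?P. fst p \<in> {x \<in> topspace X. f \<in> embeddings L' B (KX x)}}"
      by (rule openin_continuous_map_preimage[OF continuous_map_fst emb_open[OF f]])
    moreover have "{p \<in> topspace ?P. fst p \<in> {x \<in> topspace X. f \<in> embeddings L' B (KX x)}}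
        = {p \<in> topspace ?P. f \<in> embeddings L' B (KX (fst p))}" by auto
    ultimately show "openin ?P {p \<in> topspace ?P. f \<in> embeddings L' B (KX (fst p))}" by simp
  qed
  have coset: "c g = c h" if "c \<in> coset_colourings" "g \<in> carrier G" "h \<in> carrier G" "\<forall>y\<in>?S. g y = h y" for c g h
    using that unfolding coset_colourings_def by blast
  have w2: "(a h x, \<lambda>g\<in>carrier G. c (pinv h \<circ> g)) \<in> W" if xc: "(x, c) \<in> W" and h: "h \<in> carrier G" for x c h
  proof -
    let ?c = "\<lambda>g\<in>carrier G. c (pinv h \<circ> g)"
    have x: "x \<in> topspace X" and c: "c \<in> coset_colourings" and cC: "c \<in> carrier G \<rightarrow>\<^sub>E {..<r}" using xc by (simp_all add: W_def)
    have ih: "pinv h \<in> carrier G" using h by simp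
    have c1: "?c \<in> topspace ?C"
      unfolding topspace_product_topology topspace_discrete_topology
    proof (rule restrict_PiE_iff[THEN iffD2], rule ballI)
      fix g assume "g \<in> carrier G"
      then have "pinv h \<circ> g \<in> carrier G" using h by simp
      then show "c (pinv h \<circ> g) \<in> {..<r}" by (rule PiE_mem[OF cC])
    qed
    have c2: "?c \<in> coset_colourings"
      unfolding coset_colourings_def
    proof (intro CollectI conjI ballI c1)
      fix g g' assume g: "g \<in> carrier G" and "g' \<in> {g' \<in> carrier G. \<forall>y\<in>?S. g y = g' y}"
      then have g': "g' \<in> carrier G" "\<forall>y\<in>?S. g y = g' y" by simp_all
      have "c (pinv h \<circ> g) = c (pinv h \<circ> g')"
        by (rule coset[OF c comp_in[OF ih g] comp_in[OF ih g'(1)]]) (use g'(2) in simp)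
      then show "?c g = ?c g'" by (simp only: restrict_apply' g g'(1))
    qed
    have c3: "?c \<in> polychromatic f" if f: "f \<in> ?F" and fx: "f \<in> embeddings L' B (KX (a h x))" for f
    proof -
      let ?f = "\<lambda>y\<in>univ B. pinv h (f y)"
      have f': "?f \<in> ?F" using embedding_shift[OF ih BRs f] by simp
      have "?f \<in> embeddings L' B (KX x)"
      proof (rule embeddings_expansion[OF ext])
        show "?f \<in> embeddings L (reduct B) (reduct (KX x))" by (simp add: f')
        fix R xs assume "xs \<in> tuples (univ B) (rel_arity L' (Inr R))"
        then have xs: "set xs \<subseteq> univ B" by (simp add: mem_tuples)
        have eq: "map ?f xs = map (pinv h) (map f xs)" using map_restrict_tuple[OF xs, of "\<lambda>y. pinv h (f y)"] by (simp add: o_def)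
        show "xs \<in> rel_interp B (Inr R) \<longleftrightarrow> map ?f xs \<in> rel_interp (KX x) (Inr R)"
          unfolding eq KX_shift[OF h x, symmetric] by (rule embeddings_rel[OF Bs KX_structure fx xs])
      qed
      then have "c \<in> polychromatic ?f" using xc f' by (simp add: W_def)
      then obtain e e' where e: "e \<in> ?E" "e' \<in> ?E" "c (t ?f e) \<noteq> c (t ?f e')" unfolding polychromatic_def by blast
      have "c (pinv h \<circ> t f e) = c (t ?f e)" if e: "e \<in> ?E" for e
      proof (rule coset[OF c comp_in[OF ih tG[OF f e]] tG[OF f' e]], rule ballI)
        fix y assume "y \<in> ?S"
        then obtain z where z: "z \<in> univ A" "y = e0 z" by blast
        have "t ?f e y = pinv h (f (e z))" using te[OF f' e z(1)] embeddingsD(1)[OF e z(1)] by (simp add: z(2))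
        moreover have "t f e y = f (e z)" using te[OF f e z(1)] by (simp add: z(2))
        ultimately show "(pinv h \<circ> t f e) y = t ?f e y" by simp
      qed
      then have "?c (t f e) \<noteq> ?c (t f e')" using e tG[OF f] by simp
      then show ?thesis using c1 e(1,2) unfolding polychromatic_def by blast
    qed
    show ?thesis
      unfolding W_def
    proof (intro CollectI conjI ballI impI)
      show "(a h x, ?c) \<in> topspace ?P" using c1 act_in[OF h x] by simp
      show "snd (a h x, ?c) \<in> coset_colourings" using c2 by simp
      show "snd (a h x, ?c) \<in> polychromatic f" if "f \<in> ?F" "f \<in> embeddings L' B (KX (fst (a h x, ?c)))" for f
        using c3 that by simp
    qed
  qed
  have w3: "snd p g = snd p h" if "p \<in> W" "g \<in> carrier G" "h \<in> carrier G" "\<forall>y\<in>?S. g y = h y" for p g h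
  proof -
    have "snd p \<in> coset_colourings" using that(1) by (simp add: W_def)
    then show ?thesis by (rule coset[OF _ that(2-4)])
  qed
  have w4: "\<exists>c. (x, c) \<in> W" if x: "x \<in> topspace X" for x
  proof -
    let ?Fx = "{f \<in> ?F. f \<in> embeddings L' B (KX x)}"
    have "\<Inter> (insert coset_colourings (polychromatic ` ?Fx)) \<noteq> {}"
    proof -
      have "compact_space ?C" by (simp add: compact_space_product_topology compact_space_discrete_topology)
      then show ?thesis
        unfolding compact_space_fip
      proof (elim allE impE, intro conjI ballI allI impI)
        show "closedin ?C D" if "D \<in> insert coset_colourings (polychromatic ` ?Fx)" for D using that coset_closed polychromatic_closed by blast
        fix \<F> assume \<F>: "finite \<F> \<and> \<F> \<subseteq> insert coset_colourings (polychromatic ` ?Fx)"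
        then have "finite (\<F> - {coset_colourings})" "\<F> - {coset_colourings} \<subseteq> polychromatic ` ?Fx" by auto
        then obtain J where J: "finite J" "J \<subseteq> ?Fx" "\<F> - {coset_colourings} = polychromatic ` J" by (meson finite_subset_image)
        \<comment> \<open>Finitely many copies of \<open>B\<close> lie in one finite substructure \<open>D\<close>; as \<open>D\<close> does not witness the
        Ramsey property, it has a colouring in which none of them is monochromatic.\<close>
        have "finite (\<Union>f\<in>J. f ` univ B)" using J(1) fB by simp
        then obtain D where D: "D \<in> fin_closed" "(\<Union>f\<in>J. f ` univ B) \<subseteq> D" by (rule fin_closed_covers)
        let ?D = "induced (KX x) D"
        have "\<not> (\<forall>col\<in>embeddings L' A ?D \<rightarrow> {..<r}. \<exists>f\<in>embeddings L' B ?D. \<exists>k.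
            \<forall>e\<in>?E. col (compose (univ A) f e) = k)"
          using no induced_KX_in_age[OF x D(1)] by blast
        then obtain col where col: "col \<in> embeddings L' A ?D \<rightarrow> {..<r}"
          and bad: "\<And>f k. f \<in> embeddings L' B ?D \<Longrightarrow> \<not> (\<forall>e\<in>?E. col (compose (univ A) f e) = k)" by blast
        define w where "w g = (\<lambda>y\<in>univ A. g (e0 y))" for g :: "nat \<Rightarrow> nat"
        define c where "c = (\<lambda>g\<in>carrier G. if w g \<in> embeddings L' A ?D then col (w g) else 0)"
        have c1: "c \<in> topspace ?C" using col r by (auto simp: c_def Pi_iff)
        have c2: "c \<in> coset_colourings"
          unfolding coset_colourings_def
        proof (intro CollectI conjI ballI c1)
          fix g h assume g: "g \<in> carrier G" and "h \<in> {h \<in> carrier G. \<forall>y\<in>?S. g y = h y}"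
          then have h: "h \<in> carrier G" "\<forall>y\<in>?S. g y = h y" by simp_all
          have "w g = w h" unfolding w_def by (rule restrict_ext) (use h(2) in simp)
          then show "c g = c h" using g h(1) by (simp add: c_def)
        qed
        have c3: "c \<in> polychromatic f" if f: "f \<in> J" for f
        proof -
          have fF: "f \<in> ?F" and fx: "f \<in> embeddings L' B (KX x)" using f J(2) by auto
          have fD: "f \<in> embeddings L' B ?D" by (rule embeddings_into_induced[OF fx]) (use D(2) f in blast)
          have cw: "c (t f e) = col (compose (univ A) f e)" if e: "e \<in> ?E" for e
          proof -
            have w: "w (t f e) = compose (univ A) f e"
              unfolding w_def compose_def by (rule restrict_ext) (rule te[OF fF e])
            have "compose (univ A) f e \<in> embeddings L' A ?D"
              using embeddings_compose[OF As e fD] by (simp add: compose_def)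
            then show ?thesis using tG[OF fF e] by (simp add: c_def w)
          qed
          obtain e1 where e1: "e1 \<in> ?E" using AB by blast
          obtain e2 where e2: "e2 \<in> ?E" "col (compose (univ A) f e2) \<noteq> col (compose (univ A) f e1)"
            using bad[OF fD, of "col (compose (univ A) f e1)"] by blast
          have "c (t f e2) \<noteq> c (t f e1)" using e2(2) unfolding cw[OF e1] cw[OF e2(1)] .
          then show ?thesis using c1 e1 e2(1) unfolding polychromatic_def by blast
        qed
        have "c \<in> D" if "D \<in> \<F>" for D
          using that J(3) c2 c3 by blast
        then show "\<Inter>\<F> \<noteq> {}" by blast
      qed
    qed
    then obtain c where c: "c \<in> coset_colourings" "\<And>f. f \<in> ?Fx \<Longrightarrow> c \<in> polychromatic f" by blast
    have "c \<in> topspace ?C" using c(1) by (simp add: coset_colourings_def)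
    then have "(x, c) \<in> W" using x c by (simp add: W_def)
    then show ?thesis by blast
  qed
  obtain \<gamma> where \<gamma>: "continuous_map X (discrete_topology {..<r}) \<gamma>"
    "\<And>g x. g \<in> stab ?S \<Longrightarrow> x \<in> topspace X \<Longrightarrow> \<gamma> (a g x) = \<gamma> x"
    "\<And>x. x \<in> topspace X \<Longrightarrow> (x, \<lambda>g\<in>carrier G. \<gamma> (a (pinv g) x)) \<in> W"
    by (rule equivariant_selection[OF fS w1 w2 w3 w4]) blast+
  obtain f where f: "f \<in> embeddings L' B N" using BK by (auto simp: age_def)
  have fF: "f \<in> ?F" using embeddings_reduct[OF ext f] by simp
  let ?c = "\<lambda>g\<in>carrier G. \<gamma> (a (pinv g) x0)"
  have "(x0, ?c) \<in> W" by (rule \<gamma>(3)[OF x0])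
  then have "?c \<in> polychromatic f" using fF f by (simp add: W_def)
  then obtain e e' where e: "e \<in> ?E" "e' \<in> ?E" "?c (t f e) \<noteq> ?c (t f e')" unfolding polychromatic_def by blast
  let ?C0 = "{x \<in> topspace X. \<gamma> x \<in> {\<gamma> x0}}"
  have \<gamma>r: "\<gamma> x0 \<in> {..<r}" using continuous_map_image_subset_topspace[OF \<gamma>(1)] x0 by auto
  have "openin X ?C0" by (rule openin_continuous_map_preimage[OF \<gamma>(1)]) (use \<gamma>r in simp)
  moreover have "closedin X ?C0" by (rule closedin_continuous_map_preimage[OF \<gamma>(1)]) (use \<gamma>r in simp)
  moreover have "invariant ?S ?C0" unfolding invariant_def using \<gamma>(2) stabD(1) by auto
  ultimately have C0: "clopen ?S ?C0" by (simp add: clopen_def)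
  have "?c (t f e) = \<gamma> x0" if e: "e \<in> ?E" for e
  proof -
    let ?g = "t f e"
    have g: "?g \<in> carrier G" and ig: "pinv ?g \<in> carrier G" using tG[OF fF e] by simp_all
    have gX: "a (pinv ?g) x0 \<in> topspace X" using ig x0 by simp
    have fe: "(\<lambda>y\<in>univ A. f (e y)) \<in> embeddings L' A N" by (rule embeddings_compose[OF As e f])
    \<comment> \<open>The translates of \<open>x0\<close> that correspond to copies of \<open>A\<close> in \<open>N\<close> lie in the cell of \<open>x0\<close>, on which \<open>\<gamma>\<close> is
    constant.\<close>
    have "agree ?S (KX x0) (KX (a (pinv ?g) x0))"
      unfolding agree_def
    proof (intro allI impI)
      fix R xs assume "set xs \<subseteq> ?S"
      then obtain ys where ys: "set ys \<subseteq> univ A" "xs = map e0 ys" by (rule map_onto_tuple)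
      have "map (pinv (pinv ?g)) xs = map (\<lambda>y\<in>univ A. f (e y)) ys"
        using ys te[OF fF e] g by auto
      then have "xs \<in> rel_interp (KX (a (pinv ?g) x0)) (Inr R) \<longleftrightarrow> map (\<lambda>y\<in>univ A. f (e y)) ys \<in> rel_interp N (Inr R)"
        using KX_shift[OF ig x0, of xs R] by simp
      also have "\<dots> \<longleftrightarrow> ys \<in> rel_interp A (Inr R)" by (rule embeddings_rel[OF As KX_structure fe ys(1), symmetric])
      also have "\<dots> \<longleftrightarrow> xs \<in> rel_interp N (Inr R)" unfolding ys(2) by (rule embeddings_rel[OF As KX_structure e0 ys(1)])
      finally show "xs \<in> rel_interp N (Inr R) \<longleftrightarrow> xs \<in> rel_interp (KX (a (pinv ?g) x0)) (Inr R)" by blast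
    qed
    then have "cell ?S x0 = cell ?S (a (pinv ?g) x0)" by (rule cell_eq_if_agree[OF fS x0 gX])
    then have "a (pinv ?g) x0 \<in> cell ?S x0" using cell_self by simp
    then have "a (pinv ?g) x0 \<in> ?C0" using cell_minimal[OF C0] x0 by blast
    then show ?thesis using g by simp
  qed
  then have "?c (t f e) = ?c (t f e')" using e(1,2) by metis
  then show False using e(3) by blast
qed

end

theorem proposition3p20:
  fixes L :: "('f, 'r) lang" and K :: "('f, 'r, nat) struc"
    and G :: "(nat \<Rightarrow> nat) monoid" and T :: "(nat \<Rightarrow> nat) topology"
  assumes "countable_lang L"
    and "fraisse_structure L K"
    and "univ K = UNIV"
    and "G = aut_group L K"
    and "T = aut_topology L K"
    and large_universe: "(UNIV :: nat set set set) \<lesssim> (UNIV :: 'u set)"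
  shows "(\<forall>(L' :: ('f, 'r + nat) lang) \<K>'.
            fraisse_expansion L (age L K) L' \<K>' \<and>
            reasonable_expansion L (age L K) L' \<K>' \<and>
            precompact_expansion (age L K) \<K>' \<and>
            ramsey_property L' \<K>' \<longrightarrow>
            G_flow G T (expansions_topology L K L' \<K>') (logic_action L K L' \<K>') \<and>
            metrizable_space (expansions_topology L K L' \<K>') \<and>
            topologically_transitive G (expansions_topology L K L' \<K>') (logic_action L K L' \<K>') \<and>
            G_projective TYPE('u) G T (expansions_topology L K L' \<K>') (logic_action L K L' \<K>'))
       \<and> (\<forall>(X :: 'x topology) a.
            G_flow G T X a \<and>
            metrizable_space X \<and>
            topologically_transitive G X a \<and>
            G_projective TYPE('u) G T X a \<longrightarrow>
            (\<exists>(L' :: ('f, 'r + nat) lang) \<K>'.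
               fraisse_expansion L (age L K) L' \<K>' \<and>
               reasonable_expansion L (age L K) L' \<K>' \<and>
               precompact_expansion (age L K) \<K>' \<and>
               ramsey_property L' \<K>' \<and>
               G_flow_isomorphic G X a (expansions_topology L K L' \<K>') (logic_action L K L' \<K>')))"
proof -
  interpret fraisse_limit L K using assms(2,3) by (rule fraisse_limit.intro)
  show ?thesis
    unfolding assms(4,5)
  proof (intro conjI[where P = "\<forall>L' \<K>'. P L' \<K>'" for P] allI impI)
    fix L' :: "('f, 'r + nat) lang" and \<K>'
    assume "fraisse_expansion L (age L K) L' \<K>' \<and> reasonable_expansion L (age L K) L' \<K>' \<and>
      precompact_expansion (age L K) \<K>' \<and> ramsey_property L' \<K>'"
    then show "G_flow (aut_group L K) (aut_topology L K) (expansions_topology L K L' \<K>') (logic_action L K L' \<K>') \<and>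
        metrizable_space (expansions_topology L K L' \<K>') \<and>
        topologically_transitive (aut_group L K) (expansions_topology L K L' \<K>') (logic_action L K L' \<K>') \<and>
        G_projective TYPE('u) (aut_group L K) (aut_topology L K) (expansions_topology L K L' \<K>') (logic_action L K L' \<K>')"
      by (elim conjE) (rule expansion_flow_properties)
  next
    fix X :: "'x topology" and a
    assume X: "G_flow (aut_group L K) (aut_topology L K) X a \<and> metrizable_space X \<and>
      topologically_transitive (aut_group L K) X a \<and> G_projective TYPE('u) (aut_group L K) (aut_topology L K) X a"
    interpret metrizable_projective_flow "aut_group L K" "aut_topology L K" X a "TYPE('u)"
      by unfold_locales (use X large_universe in auto)
    have "topologically_transitive (aut_group L K) X a" using X by blast
    then obtain x0 where x0: "x0 \<in> topspace X"
      "\<And>A B y. finite A \<Longrightarrow> finite B \<Longrightarrow> A \<subseteq> B \<Longrightarrow> y \<in> cell A x0 \<Longrightarrow> \<exists>g\<in>stab A. a g x0 \<in> cell B y"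
      "\<And>A y. finite A \<Longrightarrow> y \<in> topspace X \<Longrightarrow> \<exists>g\<in>carrier (aut_group L K). a g x0 \<in> cell A y"
      by (rule generic_point_exists) blast
    interpret projective_expansion L K X a "TYPE('u)" x0
      by unfold_locales (use x0 in blast)+
    show "\<exists>(L' :: ('f, 'r + nat) lang) \<K>'. fraisse_expansion L (age L K) L' \<K>' \<and>
        reasonable_expansion L (age L K) L' \<K>' \<and> precompact_expansion (age L K) \<K>' \<and> ramsey_property L' \<K>' \<and>
        G_flow_isomorphic (aut_group L K) X a (expansions_topology L K L' \<K>') (logic_action L K L' \<K>')"
      using expansion[OF assms(1)] reasonable precompact ramsey flow_isomorphism by blast
  qed
qed

end
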